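(* Consider the latent block model (LBM) or the stochastic block model (SBM) with true parameter $\theta^\star=(\boldsymbol\mu^\star,\boldsymbol\pi^\star)\in\Theta$, and assume (all defined in the context) identifiability, symmetry, the concentration inequality, bounded Kullback--Leibler divergences, the Lipschitz condition with constant $L_0$, and the asymptotic setup for $m=m_n$. Let $c=\mu_{\min}^2\kappa_{\min}/16$, $C=2\kappa_{\max}$, and assume that $K:=\log(\alpha_{\max}/\alpha_{\min})\vee\log(\beta_{\max}/\beta_{\min})=0$ (uniform group proportions). Then for any small enough $\eta>0$ (namely $\eta\in(0,c/(2L_0))$) there exist positive reals $\{\varepsilon_{n,m}\}$ with $\sum_n\varepsilon_{n,m_n}<+\infty$ and a set $\Omega_1$ with $\mathbb P_\star(\Omega_1)\ge1-\varepsilon_{n,m}$ such that on $\Omega_1$, for any $\theta=(\boldsymbol\mu,\boldsymbol\pi)\in\Theta$ satisfying $\|\boldsymbol\pi-\boldsymbol\pi^\star\|_\infty\le\eta$, $$p^\theta_{n,m}\big(\{(\mathbf z_n,\mathbf w_m)\in\mathcal U:(\mathbf z_n,\mathbf w_m)\sim(\mathbf Z_n,\mathbf W_m)\}\big)\ge1-|\mathfrak S|\,a_{n,m}e^{a_{n,m}}$$ and $$p^\theta_{n,m}\big(\{(\mathbf z_n,\mathbf w_m)\in\mathcal U:(\mathbf z_n,\mathbf w_m)\sim(\mathbf Z_n,\mathbf W_m)\}\big)\le\big(1+|\mathfrak S|\,b_{n,m}e^{b_{n,m}}\big)^{-1},$$ where $$\begin{cases}a_{n,m}=ne^{-(c-2L_0\eta)m}+me^{-(c-2L_0\eta)n},\quad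 b_{n,m}=ne^{-Cm}+me^{-Cn}&\text{(LBM)},\\ a_{n,n}=ne^{-2n(c-2L_0\eta)},\quad b_{n,n}=ne^{-2Cn}&\text{(SBM)},\end{cases}$$ converge to $0$ as $n\to+\infty$. Moreover, $$p^\theta_{n,m}(\mathbf Z_n,\mathbf W_m)=\frac1{|\mathfrak S|}\,p^\theta_{n,m}\big(\{(\mathbf z_n,\mathbf w_m)\in\mathcal U:(\mathbf z_n,\mathbf w_m)\sim(\mathbf Z_n,\mathbf W_m)\}\big).$$
   Context: Model. Let $Q,L\ge1$, $\mathcal Q=\{1,\dots,Q\}$, $\mathcal L=\{1,\dots,L\}$, $\boldsymbol\alpha=(\alpha_q)$ and $\boldsymbol\beta=(\beta_l)$ probability distributions with positive weights on $\mathcal Q$ and $\mathcal L$. $\mathbf Z_n=(Z_1,\dots,Z_n)$ is i.i.d. with law $\boldsymbol\alpha$, $\mathbf W_m=(W_1,\dots,W_m)$ is i.i.d. with law $\boldsymbol\beta$. LBM: $\mathbf Z_n$ and $\mathbf W_m$ are independent, $\mathcal I=\{1,\dots,n\}\times\{1,\dots,m\}$, $\boldsymbol\mu=\boldsymbol\alpha^{\otimes n}\otimes\boldsymbol\beta^{\otimes m}$, $\mathcal U=\mathcal Q^n\times\mathcal L^m$. SBM: $n=m$, $\mathcal Q=\mathcal L$, $\boldsymbol\alpha=\boldsymbol\beta$, $Z_i=W_i$ for all $i$, $\boldsymbol\mu=\boldsymbol\alpha^{\otimes n}$, and $\mathcal U$ is the set of pairs $(\mathbf z_n,\mathbf w_n)$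 with $\mathbf z_n=\mathbf w_n\in\mathcal Q^n$. Here $\mathcal I=\{1,\dots,n\}^2$ (the data are the adjacency matrix of a random graph); as particular cases one may also consider graphs with no self-loops, in which case $\mathcal I=\{1,\dots,n\}^2\setminus\{(i,i):1\le i\le n\}$, or undirected graphs, possibly with no self-loops, by imposing $X_{ij}=X_{ji}$, in which latter case $\mathcal I=\{(i,j):1\le i<j\le n\}$. Let $\boldsymbol\pi=(\pi_{ql})_{(q,l)\in\mathcal Q\times\mathcal L}$ belong to a set of matrices $\Pi_{\mathcal Q\mathcal L}$ with entries in a set $\Pi$. Conditionally on $(\mathbf Z_n,\mathbf W_m)$ the observations $\mathbf X_{n,m}=(X_{ij})_{(i,j)\in\mathcal I}$ (values in $\mathcal X$) are independent and, given $(Z_i,W_j)=(q,l)$, $X_{ij}$ has density $f(\cdot;\pi_{ql})$ (w.r.t. counting or Lebesgue measure). The parameter set is $\Theta=\{\theta=(\boldsymbol\mu,\boldsymbol\pi):\boldsymbol\pi\in\Pi_{\mathcal Q\mathcal L},\ \alpha_q\ge\alpha_{\min}>0,\ \beta_l\ge\beta_{\min}>0\ \forall (q,l)\}$; $\alpha_{\max}$, $\beta_{\max}$ are the maxima of $\alpha_q$, $\beta_l$ over $q$, $l$ and $\theta\in\Theta$; $\mu_{\min}=\alpha_{\min}\wedge\beta_{\min}$. $\mathbb P_\theta$ is the distribution under $\theta$; $\mathbb P_\star,\mathbb E_\star$ are probability and expectation under the true $\theta^\star$; $\mathbb P_\star^{\mathbf z^\star\mathbf w^\star},\mathbb E_\star^{\mathbf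 z^\star\mathbf w^\star}$ are those conditional on $(\mathbf Z_n,\mathbf W_m)=(\mathbf z^\star_n,\mathbf w^\star_m)$. $\|\boldsymbol\pi\|_\infty$ is the maximum of the entries' absolute values. Posterior: $p^\theta_{n,m}(\mathbf z_n,\mathbf w_m):=\mathbb P_\theta((\mathbf Z_n,\mathbf W_m)=(\mathbf z_n,\mathbf w_m)\mid\mathbf X_{n,m})$, and $p^\theta_{n,m}(A)$ for $A\subset\mathcal U$ is the sum over $A$. Equivalence. $\mathfrak S_{\mathcal Q\mathcal L}$ is $\mathfrak S_Q\times\mathfrak S_L$ (LBM) or $\{(s,s):s\in\mathfrak S_Q\}$ (SBM), where $\mathfrak S_Q,\mathfrak S_L$ are the permutation groups of $\mathcal Q,\mathcal L$; $\boldsymbol\pi^{s,t}:=(\pi_{s(q)t(l)})_{q,l}$. Permutations act entrywise on $\mathbf z_n$, $\mathbf w_m$. For the subgroup $\mathfrak S$ of the symmetry assumption below, $(\mathbf z_n,\mathbf w_m)\sim(\mathbf z'_n,\mathbf w'_m)$ iff $(s(\mathbf z'_n),t(\mathbf w'_m))=(\mathbf z_n,\mathbf w_m)$ for some $(s,t)\in\mathfrak S$; $\tilde{\mathcal U}=\mathcal U/\sim$. With $\|u\|_0$ the number of nonzero coordinates, $d((\mathbf z_n,\mathbf w_m),(\mathbf z'_n,\mathbf w'_m)):=\min\{\|\mathbf z_n-s(\mathbf z'_n)\|_0+\|\mathbf w_m-t(\mathbf w'_m)\|_0:(s,t)\in\mathfrak S\}$. $\mathcal U^0$ is the set of $(\mathbf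 z_n,\mathbf w_m)\in\mathcal U$ such that each $q\in\mathcal Q$ appears at least $n\mu_{\min}/2$ times in $\mathbf z_n$ and each $l\in\mathcal L$ at least $m\mu_{\min}/2$ times in $\mathbf w_m$; $\tilde{\mathcal U}^0$ is its image in $\tilde{\mathcal U}$. Notation: $\delta^{\boldsymbol\pi}(\mathbf z^\star_n,\mathbf w^\star_m,\mathbf z_n,\mathbf w_m)=\sum_{(i,j)\in\mathcal I}\log\frac{f(X_{ij};\pi_{z^\star_iw^\star_j})}{f(X_{ij};\pi_{z_iw_j})}$; $D(\pi\|\pi')=\int_{\mathcal X}\log\frac{f(x;\pi)}{f(x;\pi')}f(x;\pi)\,dx$; $\kappa_{\min}=\min\{D(\pi^\star_{ql}\|\pi^\star_{q'l'}):(q,l),(q',l')\in\mathcal Q\times\mathcal L,\ \pi^\star_{ql}\ne\pi^\star_{q'l'}\}>0$. Assumptions. Identifiability: $f(\cdot;\pi)=f(\cdot;\pi')\Rightarrow\pi=\pi'$; for all $q\ne q'$ there is $l$ with $\pi_{ql}\ne\pi_{q'l}$, and for all $l\ne l'$ there is $q$ with $\pi_{ql}\ne\pi_{ql'}$. Symmetry: there is a (maximal) subgroup $\mathfrak S$ of $\mathfrak S_{\mathcal Q\mathcal L}$ with $\boldsymbol\pi^{s,t}=\boldsymbol\pi$ for all $(s,t)\in\mathfrak S$, $\boldsymbol\pi\in\Pi_{\mathcal Q\mathcal L}$, and $\boldsymbol\pi^{s,t}\ne\boldsymbol\pi$ for all $(s,t)\in\mathfrak S_{\mathcal Q\mathcal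 L}\setminus\mathfrak S$, $\boldsymbol\pi\in\Pi_{\mathcal Q\mathcal L}$. Concentration inequality: fix $(\mathbf z^\star_n,\mathbf w^\star_m)\in\tilde{\mathcal U}^0$ and $(\mathbf z_n,\mathbf w_m)\in\tilde{\mathcal U}$ such that $(\mathbf z_n,\mathbf w_m)\not\sim(\mathbf z^\star_n,\mathbf w^\star_m)$. There exists some positive function $\psi^\star:(0,+\infty)\to(0,+\infty]$ such that for any $\boldsymbol\pi\in\Pi_{\mathcal Q\mathcal L}$ and any $\varepsilon>0$, $\mathbb P_\star^{\mathbf z^\star\mathbf w^\star}\big(|\delta^{\boldsymbol\pi}-\mathbb E_\star^{\mathbf z^\star\mathbf w^\star}(\delta^{\boldsymbol\pi})|\ge\varepsilon(mr_1+nr_2)\big)\le2\exp[-\psi^\star(\varepsilon)(mr_1+nr_2)]$, where $\delta^{\boldsymbol\pi}=\delta^{\boldsymbol\pi}(\mathbf z^\star_n,\mathbf w^\star_m,\mathbf z_n,\mathbf w_m)$, $r_1=\|\mathbf z^\star_n-s(\mathbf z_n)\|_0$, $r_2=\|\mathbf w^\star_m-t(\mathbf w_m)\|_0$ and $(s,t)\in\mathfrak S$ attains $d((\mathbf z^\star_n,\mathbf w^\star_m),(\mathbf z_n,\mathbf w_m))$. Bounded Kullback--Leibler divergences: $\kappa_{\max}:=\max\{D(\pi\|\pi'):\pi,\pi'\in\Pi\}<+\infty$. Lipschitz condition: there is $L_0>0$ with $\big|\int_{\mathcal X}\log\frac{f(x;\pi_{ql})}{f(x;\pi'_{ql})}f(x;\pi_{q'l'})\,dx\big|\le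 L_0\|\boldsymbol\pi-\boldsymbol\pi'\|_\infty$ for all $\boldsymbol\pi,\boldsymbol\pi'\in\Pi_{\mathcal Q\mathcal L}$ and all $(q,l),(q',l')$. Asymptotic setup: $m=m_n\to+\infty$ with $m_n\le n$ and $(\log n)/m_n\to0$ (for SBM, $m_n=n$).
   Formalization: One Ω₁ for all θ is shown only if the concentration inequality also holds for the supremum over π with ‖π−π*‖∞≤η (vanishing densities count as deviations); otherwise Ω₁ may depend on θ, ε not. The upper bound is claimed only for Q≥2. The literal statement fails in both respects. *)

theory Defs
  imports "HOL-Probability.Probability" "HOL-Algebra.Sym_Groups"
begin

text \<open>
  The flags of \<open>SBM undirected loops\<close> select the observed part of the adjacency matrix.
\<close>

datatype shape = LBM | SBM (undirected: bool) (loops: bool)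

text \<open>
  Group labels are \<open>{1..numQ}\<close> and \<open>{1..numL}\<close>, nodes are \<open>{1..n}\<close> and \<open>{1..m}\<close>, and matrices are
  functions of which only the entries with indices in range matter.  The measure \<open>refm\<close> is the one
  the densities refer to (counting or Lebesgue measure), and \<open>dens B x p\<close> is \<open>f(x; p)\<close>.
\<close>

type_synonym params = "nat \<Rightarrow> nat \<Rightarrow> real"
type_synonym config = "(nat \<Rightarrow> nat) \<times> (nat \<Rightarrow> nat)"

record 'x block_model =
  shape :: shape
  numQ :: nat
  numL :: nat
  amin :: real
  bmin :: real
  refm :: "'x measure"
  dens :: "'x \<Rightarrow> real \<Rightarrow> real"
  Entries :: "real set"
  Mats :: "params set"

abbreviation is_sbm :: "'x block_model \<Rightarrow> bool" where
  "is_sbm B \<equiv> shape B \<noteq> LBM"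

definition obs_dist :: "'x block_model \<Rightarrow> real \<Rightarrow> 'x measure" where
  "obs_dist B p = density (refm B) (\<lambda>x. ennreal (dens B x p))"

text \<open>
  In an undirected graph \<open>X i j = X j i\<close> has density \<open>f(\<cdot>; \<pi> q l)\<close> as well as \<open>f(\<cdot>; \<pi> l q)\<close> when the
  labels of \<open>i\<close> and \<open>j\<close> are \<open>q\<close> and \<open>l\<close>, so the matrices are symmetric.
\<close>

definition block_model :: "'x block_model \<Rightarrow> bool" where
  "block_model B \<longleftrightarrow>
     1 \<le> numQ B \<and> 1 \<le> numL B \<and> 0 < amin B \<and> 0 < bmin B \<and>
     (\<forall>p\<in>Entries B. (\<lambda>x. dens B x p) \<in> borel_measurable (refm B) \<and>
        (\<forall>x\<in>space (refm B). 0 \<le> dens B x p) \<and> prob_space (obs_dist B p)) \<and>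
     (\<forall>P\<in>Mats B. \<forall>q\<in>{1..numQ B}. \<forall>l\<in>{1..numL B}. P q l \<in> Entries B) \<and>
     (is_sbm B \<longrightarrow> numQ B = numL B) \<and>
     (\<forall>g. shape B = SBM True g \<longrightarrow>
        (\<forall>P\<in>Mats B. \<forall>q\<in>{1..numQ B}. \<forall>l\<in>{1..numL B}. P q l = P l q))"

definition Theta :: "'x block_model \<Rightarrow> (nat pmf \<times> nat pmf \<times> params) set" where
  "Theta B = {(\<alpha>, \<beta>, P). set_pmf \<alpha> = {1..numQ B} \<and> set_pmf \<beta> = {1..numL B} \<and>
     (\<forall>q\<in>{1..numQ B}. amin B \<le> pmf \<alpha> q) \<and> (\<forall>l\<in>{1..numL B}. bmin B \<le> pmf \<beta> l) \<and>
     (is_sbm B \<longrightarrow> \<alpha> = \<beta>) \<and> P \<in> Mats B}"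

definition amax :: "'x block_model \<Rightarrow> real" where
  "amax B = Sup {pmf \<alpha> q |\<alpha> \<beta> P q. (\<alpha>, \<beta>, P) \<in> Theta B \<and> q \<in> {1..numQ B}}"

definition bmax :: "'x block_model \<Rightarrow> real" where
  "bmax B = Sup {pmf \<beta> l |\<alpha> \<beta> P l. (\<alpha>, \<beta>, P) \<in> Theta B \<and> l \<in> {1..numL B}}"

definition mumin :: "'x block_model \<Rightarrow> real" where
  "mumin B = min (amin B) (bmin B)"

definition K_const :: "'x block_model \<Rightarrow> real" where
  "K_const B = max (ln (amax B / amin B)) (ln (bmax B / bmin B))"

definition obs_index :: "'x block_model \<Rightarrow> nat \<Rightarrow> nat \<Rightarrow> (nat \<times> nat) set" where
  "obs_index B n m = (case shape B of
      LBM \<Rightarrow> {1..n} \<times> {1..m}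
    | SBM undir lps \<Rightarrow> {(i, j) \<in> {1..n} \<times> {1..m}. (undir \<longrightarrow> i \<le> j) \<and> (\<not> lps \<longrightarrow> i \<noteq> j)})"

text \<open>For the SBM the size parameters \<open>n\<close> and \<open>m\<close> are always taken equal.\<close>

definition configs :: "'x block_model \<Rightarrow> nat \<Rightarrow> nat \<Rightarrow> config set" where
  "configs B n m = {(z, w). z \<in> {1..n} \<rightarrow>\<^sub>E {1..numQ B} \<and> w \<in> {1..m} \<rightarrow>\<^sub>E {1..numL B} \<and>
     (is_sbm B \<longrightarrow> z = w)}"

definition latent :: "'x block_model \<Rightarrow> nat pmf \<Rightarrow> nat pmf \<Rightarrow> nat \<Rightarrow> nat \<Rightarrow> config pmf" where
  "latent B \<alpha> \<beta> n m =
     (if is_sbm B then map_pmf (\<lambda>z. (z, z)) (Pi_pmf {1..n} undefined (\<lambda>_. \<alpha>))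
      else pair_pmf (Pi_pmf {1..n} undefined (\<lambda>_. \<alpha>)) (Pi_pmf {1..m} undefined (\<lambda>_. \<beta>)))"

abbreviation obs_space :: "'x block_model \<Rightarrow> nat \<Rightarrow> nat \<Rightarrow> (nat \<times> nat \<Rightarrow> 'x) measure" where
  "obs_space B n m \<equiv> PiM (obs_index B n m) (\<lambda>_. refm B)"

definition cond_law ::
    "'x block_model \<Rightarrow> params \<Rightarrow> nat \<Rightarrow> nat \<Rightarrow> config \<Rightarrow> (nat \<times> nat \<Rightarrow> 'x) measure" where
  "cond_law B P n m = (\<lambda>(z, w). PiM (obs_index B n m) (\<lambda>(i, j). obs_dist B (P (z i) (w j))))"

text \<open>
  Joint law of \<open>((Z, W), X)\<close>.  The latent law is restricted to \<open>configs\<close>, which carries all its mass,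
  since \<open>cond_law\<close> need not be a probability measure for labels out of range.
\<close>

definition joint_law ::
    "'x block_model \<Rightarrow> nat pmf \<times> nat pmf \<times> params \<Rightarrow> nat \<Rightarrow> nat
      \<Rightarrow> (config \<times> (nat \<times> nat \<Rightarrow> 'x)) measure" where
  "joint_law B = (\<lambda>(\<alpha>, \<beta>, P) n m.
     Giry_Monad.bind (point_measure (configs B n m) (\<lambda>u. ennreal (pmf (latent B \<alpha> \<beta> n m) u)))
       (\<lambda>u. distr (cond_law B P n m u)
              (count_space UNIV \<Otimes>\<^sub>M obs_space B n m) (\<lambda>x. (u, x))))"

definition lik ::
    "'x block_model \<Rightarrow> params \<Rightarrow> nat \<Rightarrow> nat \<Rightarrow> config \<Rightarrow> (nat \<times> nat \<Rightarrow> 'x) \<Rightarrow> real" where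
  "lik B P n m = (\<lambda>(z, w) x. \<Prod>(i, j)\<in>obs_index B n m. dens B (x (i, j)) (P (z i) (w j)))"

text \<open>
  The posterior is the version of the conditional probability given by Bayes' formula, which is
  defined for every value of the observations; see \<open>posterior_conditional\<close> below.
\<close>

definition posterior ::
    "'x block_model \<Rightarrow> nat pmf \<times> nat pmf \<times> params \<Rightarrow> nat \<Rightarrow> nat
      \<Rightarrow> (nat \<times> nat \<Rightarrow> 'x) \<Rightarrow> config \<Rightarrow> real" where
  "posterior B = (\<lambda>(\<alpha>, \<beta>, P) n m x u.
     pmf (latent B \<alpha> \<beta> n m) u * lik B P n m u x /
     (\<Sum>v\<in>configs B n m. pmf (latent B \<alpha> \<beta> n m) v * lik B P n m v x))"

lemma finite_obs_index: "finite (obs_index B n m)"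
proof -
  have "obs_index B n m \<subseteq> {1..n} \<times> {1..m}"
    by (auto simp: obs_index_def split: shape.splits)
  then show ?thesis
    by (rule finite_subset) simp
qed

lemma finite_configs: "finite (configs B n m)"
proof -
  have "configs B n m \<subseteq> ({1..n} \<rightarrow>\<^sub>E {1..numQ B}) \<times> ({1..m} \<rightarrow>\<^sub>E {1..numL B})"
    by (auto simp: configs_def)
  then show ?thesis
    by (rule finite_subset) (auto intro!: finite_PiE)
qed

lemma PiM_density:
  fixes I :: "'i set" and M0 :: "'x measure" and g :: "'i \<Rightarrow> 'x \<Rightarrow> ennreal"
  assumes fin: "finite I"
    and sf: "\<And>i. i \<in> I \<Longrightarrow> sigma_finite_measure M0"
    and g: "\<And>i. i \<in> I \<Longrightarrow> g i \<in> borel_measurable M0"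
    and pr: "\<And>i. i \<in> I \<Longrightarrow> prob_space (density M0 (g i))"
  shows "PiM I (\<lambda>i. density M0 (g i)) = density (PiM I (\<lambda>_. M0)) (\<lambda>x. \<Prod>i\<in>I. g i (x i))"
proof (cases "I = {}")
  case True
  then show ?thesis
    by (auto simp: density_1 intro!: PiM_cong)
next
  case False
  then have sf': "sigma_finite_measure M0"
    using sf by auto
  interpret M0: sigma_finite_measure M0 by (fact sf')
  interpret P: product_sigma_finite "\<lambda>_::'i. M0"
    by standard
  have sets: "sets (PiM I (\<lambda>i. density M0 (g i))) = sets (PiM I (\<lambda>_. M0))"
    by (rule sets_PiM_cong) auto
  have pm: "(\<lambda>x. \<Prod>i\<in>I. g i (x i)) \<in> borel_measurable (PiM I (\<lambda>_. M0))"
  proof (rule borel_measurable_prod_ennreal)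
    fix i assume i: "i \<in> I"
    show "(\<lambda>x. g i (x i)) \<in> borel_measurable (PiM I (\<lambda>_. M0))"
      using measurable_compose[OF measurable_component_singleton[OF i] g[OF i]] .
  qed
  define g' where "g' i = (if i \<in> I then g i else g (SOME i. i \<in> I))" for i
  have someI: "(SOME i. i \<in> I) \<in> I"
    using False by (simp add: some_in_eq)
  interpret Q: product_prob_space "\<lambda>i. density M0 (g' i)"
    unfolding product_prob_space_def product_prob_space_axioms_def product_sigma_finite_def
    using pr someI by (auto simp: g'_def intro!: prob_space_imp_sigma_finite)
  interpret Q: finite_product_prob_space "\<lambda>i. density M0 (g' i)" I
    by standard (fact fin)
  have "density (PiM I (\<lambda>_. M0)) (\<lambda>x. \<Prod>i\<in>I. g i (x i)) = PiM I (\<lambda>i. density M0 (g' i))"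
  proof (rule Q.PiM_eqI)
    show "finite I" by (fact fin)
    show "sets (density (PiM I (\<lambda>_. M0)) (\<lambda>x. \<Prod>i\<in>I. g i (x i))) = sets (PiM I (\<lambda>i. density M0 (g' i)))"
      by (simp, rule sets_PiM_cong) auto
    fix A assume A: "\<And>i. i \<in> I \<Longrightarrow> A i \<in> sets (density M0 (g' i))"
    have A': "A i \<in> sets M0" if "i \<in> I" for i
      using A[OF that] by simp
    have "emeasure (density (PiM I (\<lambda>_. M0)) (\<lambda>x. \<Prod>i\<in>I. g i (x i))) (PiE I A)
        = (\<integral>\<^sup>+x. (\<Prod>i\<in>I. g i (x i)) * indicator (PiE I A) x \<partial>PiM I (\<lambda>_. M0))"
      by (rule emeasure_density[OF pm]) (auto intro!: sets_PiM_I_finite fin A')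
    also have "\<dots> = (\<integral>\<^sup>+x. (\<Prod>i\<in>I. g i (x i) * indicator (A i) (x i)) \<partial>PiM I (\<lambda>_. M0))"
    proof (rule nn_integral_cong)
      fix x assume x: "x \<in> space (PiM I (\<lambda>_. M0))"
      have "indicator (PiE I A) x = (\<Prod>i\<in>I. indicator (A i) (x i) :: ennreal)"
      proof (cases "x \<in> PiE I A")
        case True
        then have "x i \<in> A i" if "i \<in> I" for i
          using that by auto
        then have "(\<Prod>i\<in>I. indicator (A i) (x i) :: ennreal) = 1"
          by (intro prod.neutral ballI) (simp add: indicator_def)
        then show ?thesis
          by (metis True indicator_simps(1))
      next
        case False
        then obtain i where i: "i \<in> I" "x i \<notin> A i"
          using x by (auto simp: space_PiM PiE_def)
        then have "(\<Prod>i\<in>I. indicator (A i) (x i) :: ennreal) = 0"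
          using fin by (intro prod_zero bexI[of _ i]) simp_all
        then show ?thesis
          by (metis False indicator_simps(2))
      qed
      then show "(\<Prod>i\<in>I. g i (x i)) * indicator (PiE I A) x = (\<Prod>i\<in>I. g i (x i) * indicator (A i) (x i))"
        by (simp add: prod.distrib)
    qed
    also have "\<dots> = (\<Prod>i\<in>I. \<integral>\<^sup>+y. g i y * indicator (A i) y \<partial>M0)"
      by (rule P.product_nn_integral_prod[OF fin])
        (intro borel_measurable_times_ennreal g borel_measurable_indicator A')
    also have "\<dots> = (\<Prod>i\<in>I. emeasure (density M0 (g' i)) (A i))"
    proof (rule prod.cong[OF refl])
      fix i assume i: "i \<in> I"
      show "(\<integral>\<^sup>+y. g i y * indicator (A i) y \<partial>M0) = emeasure (density M0 (g' i)) (A i)"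
        unfolding g'_def if_P[OF i] by (rule emeasure_density[OF g[OF i] A'[OF i], symmetric])
    qed
    finally show "emeasure (density (PiM I (\<lambda>_. M0)) (\<lambda>x. \<Prod>i\<in>I. g i (x i))) (PiE I A) =
      (\<Prod>i\<in>I. emeasure (density M0 (g' i)) (A i))" .
  qed
  also have "\<dots> = PiM I (\<lambda>i. density M0 (g i))"
    by (rule PiM_cong) (auto simp: g'_def)
  finally show ?thesis by simp
qed


lemma cond_law_density:
  assumes B: "block_model B" and sf: "sigma_finite_measure (refm B)"
    and \<theta>: "(\<alpha>, \<beta>, P) \<in> Theta B" and nm: "is_sbm B \<longrightarrow> n = m" and u: "u \<in> configs B n m"
  shows "cond_law B P n m u = density (obs_space B n m) (\<lambda>x. ennreal (lik B P n m u x))"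
    and "lik B P n m u \<in> borel_measurable (obs_space B n m)"
    and "\<And>x. x \<in> space (obs_space B n m) \<Longrightarrow> 0 \<le> lik B P n m u x"
    and "prob_space (cond_law B P n m u)"
proof -
  obtain z w where zw: "u = (z, w)" by (cases u)
  have ent: "P (z i) (w j) \<in> Entries B" if "(i, j) \<in> obs_index B n m" for i j
  proof -
    have "i \<in> {1..n}" "j \<in> {1..m}"
      using that by (auto simp: obs_index_def split: shape.splits)
    then have "z i \<in> {1..numQ B}" "w j \<in> {1..numL B}"
      using u by (auto simp: zw configs_def simp del: atLeastAtMost_iff)
    then show ?thesis
      using B \<theta> by (auto simp: block_model_def Theta_def)
  qed
  have D: "(\<lambda>x. dens B x p) \<in> borel_measurable (refm B)" "\<forall>x\<in>space (refm B). 0 \<le> dens B x p"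
    "prob_space (obs_dist B p)" if "p \<in> Entries B" for p
    using B that by (auto simp: block_model_def)
  have nn: "0 \<le> dens B (x (i, j)) (P (z i) (w j))"
    if "x \<in> space (obs_space B n m)" "(i, j) \<in> obs_index B n m" for x i j
    using D(2)[OF ent[OF that(2)]] that by (auto simp: space_PiM PiE_def Pi_def)
  have nn': "0 \<le> dens B (x ij) (P (z (fst ij)) (w (snd ij)))"
    if "x \<in> space (obs_space B n m)" "ij \<in> obs_index B n m" for x ij
    using nn[of x "fst ij" "snd ij"] that by simp
  show meas: "lik B P n m u \<in> borel_measurable (obs_space B n m)"
    unfolding lik_def zw prod.case
  proof (rule borel_measurable_prod, clarify)
    fix i j assume ij: "(i, j) \<in> obs_index B n m"
    show "(\<lambda>x. dens B (x (i, j)) (P (z i) (w j))) \<in> borel_measurable (obs_space B n m)"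
      using measurable_compose[OF measurable_component_singleton[OF ij] D(1)[OF ent[OF ij]]] .
  qed
  show "0 \<le> lik B P n m u x" if "x \<in> space (obs_space B n m)" for x
    unfolding lik_def zw prod.case using nn[OF that] by (auto intro!: prod_nonneg)
  have "cond_law B P n m u = PiM (obs_index B n m)
      (\<lambda>ij. density (refm B) (\<lambda>x. ennreal (dens B x (P (z (fst ij)) (w (snd ij))))))"
    by (simp add: cond_law_def zw obs_dist_def split_def)
  also have "\<dots> = density (obs_space B n m)
      (\<lambda>x. \<Prod>ij\<in>obs_index B n m. ennreal (dens B (x ij) (P (z (fst ij)) (w (snd ij)))))"
    using D(1,3) ent by (intro PiM_density finite_obs_index sf) (auto simp: obs_dist_def)
  also have "\<dots> = density (obs_space B n m) (\<lambda>x. ennreal (lik B P n m u x))"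
  proof (rule density_cong)
    show "(\<lambda>x. \<Prod>ij\<in>obs_index B n m. ennreal (dens B (x ij) (P (z (fst ij)) (w (snd ij)))))
        \<in> borel_measurable (obs_space B n m)"
    proof (rule borel_measurable_prod_ennreal)
      fix ij assume ij: "ij \<in> obs_index B n m"
      then have "(\<lambda>x. dens B x (P (z (fst ij)) (w (snd ij)))) \<in> borel_measurable (refm B)"
        by (intro D(1) ent) simp
      from measurable_compose[OF measurable_component_singleton[OF ij] this]
      show "(\<lambda>x. ennreal (dens B (x ij) (P (z (fst ij)) (w (snd ij))))) \<in> borel_measurable (obs_space B n m)"
        by simp
    qed
    show "(\<lambda>x. ennreal (lik B P n m u x)) \<in> borel_measurable (obs_space B n m)"
      using meas by simp
    show "AE x in obs_space B n m.
      (\<Prod>ij\<in>obs_index B n m. ennreal (dens B (x ij) (P (z (fst ij)) (w (snd ij))))) = ennreal (lik B P n m u x)"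
    proof (rule AE_I2)
      fix x assume "x \<in> space (obs_space B n m)"
      then show "(\<Prod>ij\<in>obs_index B n m. ennreal (dens B (x ij) (P (z (fst ij)) (w (snd ij)))))
          = ennreal (lik B P n m u x)"
        by (simp add: lik_def zw split_def, intro prod_ennreal) (use nn' in auto)
    qed
  qed
  finally show "cond_law B P n m u = density (obs_space B n m) (\<lambda>x. ennreal (lik B P n m u x))" .
  show "prob_space (cond_law B P n m u)"
    unfolding cond_law_def zw prod.case
    by (rule prob_space_PiM) (use D(3) ent in auto)
qed

lemma posterior_conditional:
  assumes B: "block_model B" and sf: "sigma_finite_measure (refm B)"
    and \<theta>: "(\<alpha>, \<beta>, P) \<in> Theta B" and nm: "is_sbm B \<longrightarrow> n = m" and u: "u \<in> configs B n m"
    and A: "A \<in> sets (obs_space B n m)"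
  shows "emeasure (joint_law B (\<alpha>, \<beta>, P) n m) ({u} \<times> A) =
    (\<integral>\<^sup>+(v, x). ennreal (posterior B (\<alpha>, \<beta>, P) n m x u) * indicator A x \<partial>joint_law B (\<alpha>, \<beta>, P) n m)"
proof -
  let ?U = "configs B n m" and ?X = "obs_space B n m"
  let ?N = "count_space UNIV \<Otimes>\<^sub>M obs_space B n m :: (config \<times> (nat \<times> nat \<Rightarrow> 'a)) measure"
  let ?post = "\<lambda>x. posterior B (\<alpha>, \<beta>, P) n m x u"
  let ?p = "pmf (latent B \<alpha> \<beta> n m)" and ?L = "lik B P n m"
  let ?K = "\<lambda>v. distr (cond_law B P n m v) ?N (\<lambda>x. (v, x))"
  note cl = cond_law_density[OF B sf \<theta> nm]
  have setsK: "sets (cond_law B P n m v) = sets ?X" if "v \<in> ?U" for v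
    using cl(1)[OF that] by simp
  have Pm: "(\<lambda>x. (v, x)) \<in> measurable (cond_law B P n m v) ?N" if "v \<in> ?U" for v
    unfolding measurable_cong_sets[OF setsK[OF that] refl] by (rule measurable_Pair1') simp
  have K: "?K \<in> measurable (point_measure ?U (\<lambda>u. ennreal (?p u))) (subprob_algebra ?N)"
  proof (subst measurable_point_measure_eq1, rule)
    fix v assume v: "v \<in> ?U"
    have "prob_space (?K v)"
      by (rule prob_space.prob_space_distr[OF cl(4)[OF v] Pm[OF v]])
    then show "?K v \<in> space (subprob_algebra ?N)"
      by (auto simp: space_subprob_algebra intro: prob_space_imp_subprob_space)
  qed
  have postm: "?post \<in> borel_measurable ?X"
    unfolding posterior_def prod.case
    by (intro borel_measurable_divide borel_measurable_times borel_measurable_sum borel_measurable_const cl(2) u)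
  have F: "(\<lambda>(v, x). ennreal (?post x) * indicator A x) \<in> borel_measurable ?N"
    using postm A by measurable
  have uA: "{u} \<times> A \<in> sets ?N"
    using A by (intro pair_measureI) auto
  have wm: "(\<lambda>x. ennreal (?L v x)) \<in> borel_measurable ?X" if "v \<in> ?U" for v
    using cl(2)[OF that] by simp
  have "emeasure (joint_law B (\<alpha>, \<beta>, P) n m) ({u} \<times> A)
      = (\<Sum>v\<in>?U. ennreal (?p v) * emeasure (?K v) ({u} \<times> A))"
    unfolding joint_law_def prod.case
    by (subst emeasure_bind[OF _ K uA])
       (use u in \<open>auto simp: space_point_measure nn_integral_point_measure_finite finite_configs\<close>)
  also have "\<dots> = (\<Sum>v\<in>?U. if v = u then ennreal (?p v) * emeasure (cond_law B P n m v) A else 0)"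
  proof (rule sum.cong[OF refl])
    fix v assume v: "v \<in> ?U"
    have "emeasure (?K v) ({u} \<times> A) = emeasure (cond_law B P n m v) ((\<lambda>x. (v, x)) -` ({u} \<times> A) \<inter> space (cond_law B P n m v))"
      by (rule emeasure_distr[OF Pm[OF v] uA])
    also have "(\<lambda>x. (v, x)) -` ({u} \<times> A) \<inter> space (cond_law B P n m v) = (if v = u then A else {})"
      using sets.sets_into_space[OF A] sets_eq_imp_space_eq[OF setsK[OF v]] by auto
    finally show "ennreal (?p v) * emeasure (?K v) ({u} \<times> A) =
        (if v = u then ennreal (?p v) * emeasure (cond_law B P n m v) A else 0)"
      by simp
  qed
  also have "\<dots> = ennreal (?p u) * emeasure (cond_law B P n m u) A"
    using u by (simp add: finite_configs)
  also have "\<dots> = ennreal (?p u) * (\<integral>\<^sup>+x. ennreal (?L u x) * indicator A x \<partial>?X)"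
    unfolding cl(1)[OF u] by (subst emeasure_density[OF wm[OF u] A]) simp
  also have "\<dots> = (\<integral>\<^sup>+x. ennreal (?p u) * (ennreal (?L u x) * indicator A x) \<partial>?X)"
    by (rule nn_integral_cmult[symmetric]) (use wm[OF u] A in measurable)
  also have "\<dots> = (\<integral>\<^sup>+x. (\<Sum>v\<in>?U. ennreal (?p v) * (ennreal (?L v x) * (ennreal (?post x) * indicator A x))) \<partial>?X)"
  proof (rule nn_integral_cong)
    fix x assume x: "x \<in> space ?X"
    have L0: "0 \<le> ?L v x" if "v \<in> ?U" for v
      using cl(3)[OF that x] .
    let ?s = "\<Sum>v\<in>?U. ?p v * ?L v x"
    have s: "0 \<le> ?s" by (intro sum_nonneg mult_nonneg_nonneg L0) auto
    have "?p u * ?L u x \<le> ?s"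
      by (rule member_le_sum[OF u]) (auto intro!: mult_nonneg_nonneg L0 simp: finite_configs)
    moreover have "0 \<le> ?p u * ?L u x" by (intro mult_nonneg_nonneg L0 u) auto
    ultimately have eq: "?s * ?post x = ?p u * ?L u x"
      by (auto simp: posterior_def)
    have "(\<Sum>v\<in>?U. ennreal (?p v) * (ennreal (?L v x) * (ennreal (?post x) * indicator A x)))
        = (\<Sum>v\<in>?U. ennreal (?p v * ?L v x)) * (ennreal (?post x) * indicator A x)"
      unfolding sum_distrib_right by (rule sum.cong) (auto simp: ennreal_mult L0 mult.assoc)
    also have "(\<Sum>v\<in>?U. ennreal (?p v * ?L v x)) = ennreal ?s"
      by (rule sum_ennreal) (auto intro!: mult_nonneg_nonneg L0)
    also have "ennreal ?s * (ennreal (?post x) * indicator A x) = ennreal (?s * ?post x) * indicator A x"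
      using s by (simp add: ennreal_mult' mult.assoc)
    also have "\<dots> = ennreal (?p u) * (ennreal (?L u x) * indicator A x)"
      unfolding eq by (simp add: ennreal_mult L0 u mult.assoc)
    finally show "ennreal (?p u) * (ennreal (?L u x) * indicator A x) =
      (\<Sum>v\<in>?U. ennreal (?p v) * (ennreal (?L v x) * (ennreal (?post x) * indicator A x)))" ..
  qed
  also have "\<dots> = (\<Sum>v\<in>?U. \<integral>\<^sup>+x. ennreal (?p v) * (ennreal (?L v x) * (ennreal (?post x) * indicator A x)) \<partial>?X)"
    by (rule nn_integral_sum) (use wm postm A in measurable)
  also have "\<dots> = (\<Sum>v\<in>?U. ennreal (?p v) * (\<integral>\<^sup>+y. (case y of (v, x) \<Rightarrow> ennreal (?post x) * indicator A x) \<partial>?K v))"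
  proof (rule sum.cong[OF refl])
    fix v assume v: "v \<in> ?U"
    have "(\<integral>\<^sup>+y. (case y of (v, x) \<Rightarrow> ennreal (?post x) * indicator A x) \<partial>?K v)
        = (\<integral>\<^sup>+x. ennreal (?post x) * indicator A x \<partial>cond_law B P n m v)"
      by (subst nn_integral_distr[OF Pm[OF v]]) (use F in simp_all)
    also have "\<dots> = (\<integral>\<^sup>+x. ennreal (?L v x) * (ennreal (?post x) * indicator A x) \<partial>?X)"
      unfolding cl(1)[OF v] by (rule nn_integral_density) (use wm[OF v] postm A in measurable)
    finally show "(\<integral>\<^sup>+x. ennreal (?p v) * (ennreal (?L v x) * (ennreal (?post x) * indicator A x)) \<partial>?X)
        = ennreal (?p v) * (\<integral>\<^sup>+y. (case y of (v, x) \<Rightarrow> ennreal (?post x) * indicator A x) \<partial>?K v)"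
      by (simp, intro nn_integral_cmult) (use wm[OF v] postm A in measurable)
  qed
  also have "\<dots> = (\<integral>\<^sup>+(v, x). ennreal (?post x) * indicator A x \<partial>joint_law B (\<alpha>, \<beta>, P) n m)"
    unfolding joint_law_def prod.case
    by (subst nn_integral_bind[OF F K]) (simp add: nn_integral_point_measure_finite finite_configs)
  finally show ?thesis .
qed

definition label_perms :: "'x block_model \<Rightarrow> ((nat \<Rightarrow> nat) \<times> (nat \<Rightarrow> nat)) set" where
  "label_perms B = {(s, t). s \<in> carrier (sym_group (numQ B)) \<and> t \<in> carrier (sym_group (numL B)) \<and>
     (is_sbm B \<longrightarrow> s = t)}"

definition mats_eq :: "'x block_model \<Rightarrow> params \<Rightarrow> params \<Rightarrow> bool" where
  "mats_eq B P P' \<longleftrightarrow> (\<forall>q\<in>{1..numQ B}. \<forall>l\<in>{1..numL B}. P q l = P' q l)"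

definition permuted :: "(nat \<Rightarrow> nat) \<times> (nat \<Rightarrow> nat) \<Rightarrow> params \<Rightarrow> params" where
  "permuted = (\<lambda>(s, t) P q l. P (s q) (t l))"

definition symmetry :: "'x block_model \<Rightarrow> ((nat \<Rightarrow> nat) \<times> (nat \<Rightarrow> nat)) set \<Rightarrow> bool" where
  "symmetry B S \<longleftrightarrow>
     subgroup S (sym_group (numQ B) \<times>\<times> sym_group (numL B)) \<and> S \<subseteq> label_perms B \<and>
     (\<forall>P\<in>Mats B. \<forall>g\<in>S. mats_eq B (permuted g P) P) \<and>
     (\<forall>P\<in>Mats B. \<forall>g\<in>label_perms B - S. \<not> mats_eq B (permuted g P) P)"

definition equivalent ::
    "((nat \<Rightarrow> nat) \<times> (nat \<Rightarrow> nat)) set \<Rightarrow> nat \<Rightarrow> nat \<Rightarrow> config \<Rightarrow> config \<Rightarrow> bool" where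
  "equivalent S n m = (\<lambda>(z, w) (z', w').
     \<exists>(s, t)\<in>S. (\<forall>i\<in>{1..n}. s (z' i) = z i) \<and> (\<forall>j\<in>{1..m}. t (w' j) = w j))"

definition hamming :: "nat \<Rightarrow> (nat \<Rightarrow> nat) \<Rightarrow> (nat \<Rightarrow> nat) \<Rightarrow> nat" where
  "hamming n z z' = card {i\<in>{1..n}. z i \<noteq> z' i}"

definition config_dist ::
    "((nat \<Rightarrow> nat) \<times> (nat \<Rightarrow> nat)) set \<Rightarrow> nat \<Rightarrow> nat \<Rightarrow> config \<Rightarrow> config \<Rightarrow> nat" where
  "config_dist S n m = (\<lambda>(z, w) (z', w').
     Min ((\<lambda>(s, t). hamming n z (s \<circ> z') + hamming m w (t \<circ> w')) ` S))"

definition posterior_class ::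
    "'x block_model \<Rightarrow> ((nat \<Rightarrow> nat) \<times> (nat \<Rightarrow> nat)) set \<Rightarrow> nat pmf \<times> nat pmf \<times> params
      \<Rightarrow> nat \<Rightarrow> nat \<Rightarrow> (nat \<times> nat \<Rightarrow> 'x) \<Rightarrow> config \<Rightarrow> real" where
  "posterior_class B S \<theta> n m x u =
     (\<Sum>v | v \<in> configs B n m \<and> equivalent S n m v u. posterior B \<theta> n m x v)"

definition regular_configs :: "'x block_model \<Rightarrow> nat \<Rightarrow> nat \<Rightarrow> config set" where
  "regular_configs B n m = {(z, w) \<in> configs B n m.
     (\<forall>q\<in>{1..numQ B}. real n * mumin B / 2 \<le> real (card {i\<in>{1..n}. z i = q})) \<and>
     (\<forall>l\<in>{1..numL B}. real m * mumin B / 2 \<le> real (card {j\<in>{1..m}. w j = l}))}"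

definition mat_dist :: "'x block_model \<Rightarrow> params \<Rightarrow> params \<Rightarrow> real" where
  "mat_dist B P P' = Max ((\<lambda>(q, l). \<bar>P q l - P' q l\<bar>) ` ({1..numQ B} \<times> {1..numL B}))"

text \<open>
  The negative part of the integrand is always integrable, so the integral is either finite or
  \<open>\<infinity>\<close>.  The first condition is needed because \<open>ln 0 = 0\<close> and \<open>x / 0 = 0\<close> in HOL.
\<close>

definition KL :: "'x block_model \<Rightarrow> real \<Rightarrow> real \<Rightarrow> ereal" where
  "KL B p p' =
     (if (AE x in obs_dist B p. 0 < dens B x p') \<and>
         integrable (refm B) (\<lambda>x. ln (dens B x p / dens B x p') * dens B x p)
      then ereal (\<integral>x. ln (dens B x p / dens B x p') * dens B x p \<partial>refm B) else \<infinity>)"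

text \<open>
  If all entries of the true matrix coincide, there is no pair to minimise over, and \<open>kappa_min\<close>
  is \<open>\<infinity>\<close>; then \<open>c_rate\<close> is \<open>0\<close>.
\<close>

definition kappa_min :: "'x block_model \<Rightarrow> params \<Rightarrow> ereal" where
  "kappa_min B P = Inf {KL B (P q l) (P q' l') |q l q' l'.
     q \<in> {1..numQ B} \<and> l \<in> {1..numL B} \<and> q' \<in> {1..numQ B} \<and> l' \<in> {1..numL B} \<and> P q l \<noteq> P q' l'}"

definition kappa_max :: "'x block_model \<Rightarrow> ereal" where
  "kappa_max B = (SUP (p, p')\<in>Entries B \<times> Entries B. KL B p p')"

definition c_rate :: "'x block_model \<Rightarrow> params \<Rightarrow> real" where
  "c_rate B P = (mumin B)\<^sup>2 * real_of_ereal (kappa_min B P) / 16"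

definition C_rate :: "'x block_model \<Rightarrow> real" where
  "C_rate B = 2 * real_of_ereal (kappa_max B)"

definition identifiable :: "'x block_model \<Rightarrow> bool" where
  "identifiable B \<longleftrightarrow>
     (\<forall>p\<in>Entries B. \<forall>p'\<in>Entries B.
        (\<forall>x\<in>space (refm B). dens B x p = dens B x p') \<longrightarrow> p = p') \<and>
     (\<forall>P\<in>Mats B.
        (\<forall>q\<in>{1..numQ B}. \<forall>q'\<in>{1..numQ B}. q \<noteq> q' \<longrightarrow> (\<exists>l\<in>{1..numL B}. P q l \<noteq> P q' l)) \<and>
        (\<forall>l\<in>{1..numL B}. \<forall>l'\<in>{1..numL B}. l \<noteq> l' \<longrightarrow> (\<exists>q\<in>{1..numQ B}. P q l \<noteq> P q l')))"

definition lipschitz_kl :: "'x block_model \<Rightarrow> real \<Rightarrow> bool" where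
  "lipschitz_kl B L0 \<longleftrightarrow> 0 < L0 \<and>
     (\<forall>P\<in>Mats B. \<forall>P'\<in>Mats B. \<forall>q\<in>{1..numQ B}. \<forall>l\<in>{1..numL B}. \<forall>q'\<in>{1..numQ B}. \<forall>l'\<in>{1..numL B}.
        \<bar>\<integral>x. ln (dens B x (P q l) / dens B x (P' q l)) * dens B x (P q' l') \<partial>refm B\<bar>
          \<le> L0 * mat_dist B P P')"

definition asymptotic_setup :: "'x block_model \<Rightarrow> (nat \<Rightarrow> nat) \<Rightarrow> bool" where
  "asymptotic_setup B m \<longleftrightarrow>
     (\<forall>n\<ge>1. 1 \<le> m n \<and> m n \<le> n) \<and> filterlim m at_top sequentially \<and>
     (\<lambda>n. ln (real n) / real (m n)) \<longlonglongrightarrow> 0 \<and> (is_sbm B \<longrightarrow> (\<forall>n. m n = n))"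

definition delta ::
    "'x block_model \<Rightarrow> params \<Rightarrow> nat \<Rightarrow> nat \<Rightarrow> config \<Rightarrow> config \<Rightarrow> (nat \<times> nat \<Rightarrow> 'x) \<Rightarrow> real" where
  "delta B P n m = (\<lambda>(z', w') (z, w) x. \<Sum>(i, j)\<in>obs_index B n m.
     ln (dens B (x (i, j)) (P (z' i) (w' j)) / dens B (x (i, j)) (P (z i) (w j))))"

text \<open>
  The event that \<open>delta\<close> deviates by at least \<open>e\<close> from its conditional mean under the matrix \<open>P0\<close>,
  where a vanishing density (an infinite or undefined log-ratio) counts as a deviation.  For a
  single matrix \<open>P\<close> this addition is a null event when all divergences are finite.
\<close>

definition deviation ::
    "'x block_model \<Rightarrow> params \<Rightarrow> nat \<Rightarrow> nat \<Rightarrow> config \<Rightarrow> config \<Rightarrow> params \<Rightarrow> real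
      \<Rightarrow> (nat \<times> nat \<Rightarrow> 'x) set" where
  "deviation B P0 n m u v P e = {x \<in> space (cond_law B P0 n m u).
     lik B P n m u x = 0 \<or> lik B P n m v x = 0 \<or>
     e \<le> \<bar>delta B P n m u v x - (\<integral>y. delta B P n m u v y \<partial>cond_law B P0 n m u)\<bar>}"

definition exp_neg :: "ereal \<Rightarrow> real \<Rightarrow> real" where
  "exp_neg a r = (if a = \<infinity> then 0 else exp (- (real_of_ereal a * r)))"

text \<open>
  The function \<open>\<psi>\<close> depends neither on the sizes nor on the configurations nor on \<open>P\<close>.  The number \<open>r\<close>
  is \<open>m r1 + n r2\<close> for a pair \<open>(s, t)\<close> at which the distance of the configurations is attained.
\<close>

definition concentration ::
    "'x block_model \<Rightarrow> params \<Rightarrow> ((nat \<Rightarrow> nat) \<times> (nat \<Rightarrow> nat)) set \<Rightarrow> (nat \<Rightarrow> nat) \<Rightarrow> bool" where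
  "concentration B P0 S m \<longleftrightarrow> (\<exists>\<psi>::real \<Rightarrow> ereal. (\<forall>e>0. 0 < \<psi> e) \<and>
     (\<forall>n\<ge>1. \<forall>(z', w')\<in>regular_configs B n (m n). \<forall>(z, w)\<in>configs B n (m n).
        \<not> equivalent S n (m n) (z, w) (z', w') \<longrightarrow>
        (\<exists>(s, t)\<in>S. \<exists>r.
           hamming n z' (s \<circ> z) + hamming (m n) w' (t \<circ> w) = config_dist S n (m n) (z', w') (z, w) \<and>
           r = real (m n) * real (hamming n z' (s \<circ> z)) + real n * real (hamming (m n) w' (t \<circ> w)) \<and>
           (\<forall>P\<in>Mats B. \<forall>e>0.
              measure (cond_law B P0 n (m n) (z', w'))
                (deviation B P0 n (m n) (z', w') (z, w) P (e * r)) \<le> 2 * exp_neg (\<psi> e) r))))"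

text \<open>
  The same inequality for the supremum of the deviations over the matrices in \<open>N\<close>.  The union
  over \<open>N\<close> need not be measurable, hence the measurable cover \<open>A\<close>.
\<close>

definition uniform_concentration ::
    "'x block_model \<Rightarrow> params \<Rightarrow> ((nat \<Rightarrow> nat) \<times> (nat \<Rightarrow> nat)) set \<Rightarrow> (nat \<Rightarrow> nat) \<Rightarrow> params set
      \<Rightarrow> bool" where
  "uniform_concentration B P0 S m N \<longleftrightarrow> (\<exists>\<psi>::real \<Rightarrow> ereal. (\<forall>e>0. 0 < \<psi> e) \<and>
     (\<forall>n\<ge>1. \<forall>(z', w')\<in>regular_configs B n (m n). \<forall>(z, w)\<in>configs B n (m n).
        \<not> equivalent S n (m n) (z, w) (z', w') \<longrightarrow>
        (\<exists>(s, t)\<in>S. \<exists>r.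
           hamming n z' (s \<circ> z) + hamming (m n) w' (t \<circ> w) = config_dist S n (m n) (z', w') (z, w) \<and>
           r = real (m n) * real (hamming n z' (s \<circ> z)) + real n * real (hamming (m n) w' (t \<circ> w)) \<and>
           (\<forall>e>0. \<exists>A\<in>sets (cond_law B P0 n (m n) (z', w')).
              (\<Union>P\<in>N. deviation B P0 n (m n) (z', w') (z, w) P (e * r)) \<subseteq> A \<and>
              measure (cond_law B P0 n (m n) (z', w')) A \<le> 2 * exp_neg (\<psi> e) r))))"

definition a_term :: "'x block_model \<Rightarrow> params \<Rightarrow> real \<Rightarrow> real \<Rightarrow> nat \<Rightarrow> nat \<Rightarrow> real" where
  "a_term B P0 L0 \<eta> n m = (let k = c_rate B P0 - 2 * L0 * \<eta> in
     if is_sbm B then real n * exp (- (2 * real n * k))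
     else real n * exp (- (k * real m)) + real m * exp (- (k * real n)))"

definition b_term :: "'x block_model \<Rightarrow> nat \<Rightarrow> nat \<Rightarrow> real" where
  "b_term B n m = (let k = C_rate B in
     if is_sbm B then real n * exp (- (2 * k * real n))
     else real n * exp (- (k * real m)) + real m * exp (- (k * real n)))"

end

theory Submission
  imports Defs
begin

text \<open>
  Uniform proportions give every configuration the same prior weight, so the posterior of \<open>v\<close> is
  \<open>lik v / (\<Sum>v'. lik v')\<close>.  If all labels occur in the true configuration \<open>u\<close>, its class consists of
  \<open>|S|\<close> configurations with the same likelihood, and the class has posterior probability
  \<open>1 / (1 + T)\<close> with the odds \<open>T = (\<Sum>v \<notin> class. lik v / lik u) / |S|\<close>
  (\<open>posterior_class_odds\<close>).  Everything else bounds \<open>T\<close> on an event of high probability.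

  Let \<open>r\<close> be the number \<open>m r1 + n r2\<close> of the concentration inequality.  There
  \<open>lik v / lik u = exp (- \<delta>)\<close> and \<open>\<delta>\<close> differs from its mean by less than \<open>e r\<close>, where \<open>e\<close> is a small fixed
  multiple of \<open>\<mu>\<^sup>2 \<kappa>\<close>.  The mean is at least \<open>\<kappa>\<close> times the number of observed entries at which \<open>u\<close> and
  \<open>v\<close> give different values of the true matrix, minus a Lipschitz error \<open>2 L0 \<eta> r\<close>
  (\<open>expected_delta_bounds\<close>).  Identifiability forces that number to be at least a multiple of
  \<open>\<mu>\<^sup>2 r\<close> (\<open>disagreements_lower_bound\<close>, \<open>observed_disagreements\<close>), with a constant strictly above
  \<open>1 / 16\<close>.  Hence \<open>\<delta> \<ge> (k + e) r\<close> with \<open>k = c - 2 L0 \<eta>\<close>.  Since \<open>r\<close> is a weighted Hamming distance up to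
  relabelling, the sum of \<open>exp (- (k + e) r)\<close> over all \<open>v\<close> factorises over the nodes
  (\<open>sum_exp_distance_le\<close>), which gives \<open>T \<le> a exp a\<close>; the surplus \<open>e\<close> in the exponent absorbs the
  numbers of labels.

  For the other bound it is enough to keep in \<open>T\<close> the \<open>n\<close> configurations that change the label of one
  row.  Each has \<open>\<delta> \<le> 1.1 \<kappa>max r\<close> with \<open>r\<close> at most \<open>m\<close> (\<open>2 n\<close> for the SBM), and \<open>b\<close>
  decays with the rate \<open>C = 2 \<kappa>max\<close>, so the gap between \<open>1.1\<close> and \<open>2\<close> covers all constants for large
  sizes (\<open>odds_ge\<close>).

  Where does the constant above \<open>1 / 16\<close> come from?  Proportions being uniform, a Chernoff bound
  shows that with probability exponentially close to one every class has at least \<open>0.9 \<mu> n\<close> (for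
  columns \<open>0.9 \<mu> m\<close>) members, almost twice the number required of regular configurations (\<open>prob_good_configs\<close>).  The counting
  argument then gains a factor that pays even for undirected graphs, where only half of the entries
  are observed.  The failure probability is this Chernoff bound plus a union bound over \<open>v\<close>, whose sum is
  again \<open>sum_exp_distance_le\<close>; it is summable because \<open>log n = o(m)\<close>.  For the finitely many small sizes
  the bound \<open>\<epsilon> = 1\<close> with the empty event is used.
\<close>

section \<open>The symmetry group\<close>

lemma finite_label_perms: "finite (label_perms B)"
proof (rule finite_subset)
  show "label_perms B \<subseteq> {s. s permutes {1..numQ B}} \<times> {t. t permutes {1..numL B}}"
    by (auto simp: label_perms_def sym_group_def)
qed (simp add: finite_permutations)

lemma symmetry_permutes:
  assumes "symmetry B S" and "(s, t) \<in> S"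
  shows "s permutes {1..numQ B}" "t permutes {1..numL B}" "is_sbm B \<Longrightarrow> s = t"
  using assms by (auto simp: symmetry_def label_perms_def sym_group_carrier)

lemma symmetry_finite:
  assumes "symmetry B S"
  shows "finite S"
  using assms finite_label_perms finite_subset unfolding symmetry_def by blast

lemma symmetry_inv:
  assumes "symmetry B S" and "(s, t) \<in> S"
  shows "(inv' s, inv' t) \<in> S"
proof -
  have "subgroup S (sym_group (numQ B) \<times>\<times> sym_group (numL B))"
    using assms(1) by (simp add: symmetry_def)
  moreover have "inv\<^bsub>sym_group (numQ B) \<times>\<times> sym_group (numL B)\<^esub> (s, t) = (inv' s, inv' t)"
    using symmetry_permutes[OF assms]
    by (subst inv_DirProd) (auto simp: sym_group_is_group sym_group_carrier sym_group_inv_equality)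
  ultimately show ?thesis
    using subgroup.m_inv_closed assms(2) by metis
qed

lemma symmetry_id:
  assumes "symmetry B S"
  shows "(id, id) \<in> S"
proof -
  have "\<one>\<^bsub>sym_group (numQ B) \<times>\<times> sym_group (numL B)\<^esub> \<in> S"
    using assms subgroup.one_closed unfolding symmetry_def by blast
  then show ?thesis
    by (simp add: sym_group_one)
qed

lemma symmetry_card_pos:
  assumes "symmetry B S"
  shows "1 \<le> card S"
  using symmetry_id[OF assms] symmetry_finite[OF assms] by (metis card_gt_0_iff empty_iff less_eq_Suc_le One_nat_def)

section \<open>Entries changed by a misclassification\<close>

definition row_cost :: "params \<Rightarrow> nat \<Rightarrow> (nat \<Rightarrow> nat) \<Rightarrow> (nat \<Rightarrow> nat) \<Rightarrow> nat \<Rightarrow> nat \<Rightarrow> nat" where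
  "row_cost P m w w' q q' = card {j\<in>{1..m}. P q (w j) \<noteq> P q' (w' j)}"

definition disagreements :: "params \<Rightarrow> nat \<Rightarrow> nat \<Rightarrow> config \<Rightarrow> config \<Rightarrow> (nat \<times> nat) set" where
  "disagreements P n m = (\<lambda>(z, w) (z', w').
     {(i, j)\<in>{1..n} \<times> {1..m}. P (z i) (w j) \<noteq> P (z' i) (w' j)})"

lemma finite_disagreements: "finite (disagreements P n m u v)"
  by (rule finite_subset[of _ "{1..n} \<times> {1..m}"]) (auto simp: disagreements_def split: prod.splits)

lemma card_disagreements:
  "card (disagreements P n m (z, w) (z', w')) = (\<Sum>i\<in>{1..n}. row_cost P m w w' (z i) (z' i))"
proof -
  have "disagreements P n m (z, w) (z', w')
      = Sigma {1..n} (\<lambda>i. {j\<in>{1..m}. P (z i) (w j) \<noteq> P (z' i) (w' j)})"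
    by (auto simp: disagreements_def)
  then show ?thesis
    by (simp add: row_cost_def)
qed

lemma disagreements_transpose:
  "card (disagreements (\<lambda>l q. P q l) m n (w, z) (w', z')) = card (disagreements P n m (z, w) (z', w'))"
proof (rule bij_betw_same_card)
  show "bij_betw (\<lambda>(j, i). (i, j)) (disagreements (\<lambda>l q. P q l) m n (w, z) (w', z'))
      (disagreements P n m (z, w) (z', w'))"
    by (rule bij_betwI[where g = "\<lambda>(i, j). (j, i)"]) (auto simp: disagreements_def)
qed

text \<open>
  The triangle inequality for Hamming distances of rows: an entry that separates \<open>q1\<close> from \<open>q2\<close>
  also separates one of them from \<open>q'\<close>.
\<close>

lemma row_cost_triangle:
  assumes "P q1 l \<noteq> P q2 l"
  shows "card {j\<in>{1..m}. w j = l} \<le> row_cost P m w w' q1 q' + row_cost P m w w' q2 q'"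
proof -
  have "card {j\<in>{1..m}. w j = l}
      \<le> card ({j\<in>{1..m}. P q1 (w j) \<noteq> P q' (w' j)} \<union> {j\<in>{1..m}. P q2 (w j) \<noteq> P q' (w' j)})"
    by (rule card_mono) (use assms in auto)
  also have "\<dots> \<le> row_cost P m w w' q1 q' + row_cost P m w w' q2 q'"
    unfolding row_cost_def by (rule card_Un_le)
  finally show ?thesis .
qed

text \<open>
  A row is bad if its label in the second configuration is not the natural counterpart of its label
  in the first: the rows of entries differ in at least half as many columns as a column class is sure to have.
\<close>

definition bad_rows ::
    "params \<Rightarrow> real \<Rightarrow> nat \<Rightarrow> nat \<Rightarrow> config \<Rightarrow> config \<Rightarrow> nat set" where
  "bad_rows P \<nu> n m = (\<lambda>(z, w) (z', w').
     {i\<in>{1..n}. \<nu> * real m \<le> 2 * real (row_cost P m w w' (z i) (z' i))})"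

lemma bad_rows_subset: "bad_rows P \<nu> n m u v \<subseteq> {1..n}"
  by (auto simp: bad_rows_def split: prod.splits)

lemma bad_rows_cost:
  "real (card (bad_rows P \<nu> n m u v)) * (\<nu> * real m) \<le> 2 * real (card (disagreements P n m u v))"
proof (cases u, cases v)
  fix z w z' w' assume uv: "u = (z, w)" "v = (z', w')"
  let ?R = "bad_rows P \<nu> n m u v"
  have "real (card ?R) * (\<nu> * real m) = (\<Sum>i\<in>?R. \<nu> * real m)"
    by simp
  also have "\<dots> \<le> (\<Sum>i\<in>?R. 2 * real (row_cost P m w w' (z i) (z' i)))"
    by (rule sum_mono) (auto simp: bad_rows_def uv)
  also have "\<dots> \<le> (\<Sum>i\<in>{1..n}. 2 * real (row_cost P m w w' (z i) (z' i)))"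
    by (rule sum_mono2) (auto simp: bad_rows_def uv)
  also have "\<dots> = 2 * real (card (disagreements P n m u v))"
    by (simp add: uv card_disagreements sum_distrib_left)
  finally show ?thesis .
qed

text \<open>
  A label \<open>q'\<close> is cheap for at most one \<open>q\<close>, by the triangle inequality and identifiability.  If there
  are fewer bad rows than any class has members, then every \<open>q\<close> has a cheap \<open>q'\<close>, and so the relation is
  the graph of a permutation.
\<close>

lemma few_bad_rows_permutation:
  assumes z': "z' \<in> {1..n} \<rightarrow> {1..Q}"
    and rows: "\<And>q. q \<in> {1..Q} \<Longrightarrow> \<nu> * real n \<le> real (card {i\<in>{1..n}. z i = q})"
    and cols: "\<And>l. l \<in> {1..L} \<Longrightarrow> \<nu> * real m \<le> real (card {j\<in>{1..m}. w j = l})"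
    and ident: "\<And>q q'. q \<in> {1..Q} \<Longrightarrow> q' \<in> {1..Q} \<Longrightarrow> q \<noteq> q' \<Longrightarrow> \<exists>l\<in>{1..L}. P q l \<noteq> P q' l"
    and few: "real (card (bad_rows P \<nu> n m (z, w) (z', w'))) < \<nu> * real n"
  obtains \<sigma> where "\<sigma> permutes {1..Q}"
    "\<And>q q'. q \<in> {1..Q} \<Longrightarrow> q' \<in> {1..Q} \<Longrightarrow>
       2 * real (row_cost P m w w' q q') < \<nu> * real m \<longleftrightarrow> q' = \<sigma> q"
proof -
  define good where "good q q' \<longleftrightarrow> 2 * real (row_cost P m w w' q q') < \<nu> * real m" for q q'
  have uniq: "q1 = q2" if q12: "q1 \<in> {1..Q}" "q2 \<in> {1..Q}" "good q1 q'" "good q2 q'" for q1 q2 q'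
  proof (rule ccontr)
    assume "q1 \<noteq> q2"
    then obtain l where l: "l \<in> {1..L}" "P q1 l \<noteq> P q2 l"
      using ident[OF q12(1,2)] by blast
    have "\<nu> * real m \<le> real (card {j\<in>{1..m}. w j = l})"
      by (rule cols[OF l(1)])
    also have "\<dots> \<le> real (row_cost P m w w' q1 q' + row_cost P m w w' q2 q')"
      using row_cost_triangle[of P q1 l q2 m w w' q', OF l(2)] by (simp only: of_nat_le_iff)
    finally show False
      using q12(3,4) by (simp add: good_def)
  qed
  have ex: "\<exists>q'\<in>{1..Q}. good q q'" if q: "q \<in> {1..Q}" for q
  proof -
    have "\<not> {i\<in>{1..n}. z i = q} \<subseteq> bad_rows P \<nu> n m (z, w) (z', w')"
    proof
      assume "{i\<in>{1..n}. z i = q} \<subseteq> bad_rows P \<nu> n m (z, w) (z', w')"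
      then have "card {i\<in>{1..n}. z i = q} \<le> card (bad_rows P \<nu> n m (z, w) (z', w'))"
        by (intro card_mono finite_subset[OF bad_rows_subset]) auto
      then show False
        using rows[OF q] few by simp
    qed
    then obtain i where "i \<in> {1..n}" "z i = q" "i \<notin> bad_rows P \<nu> n m (z, w) (z', w')"
      by auto
    then show ?thesis
      using z' by (intro bexI[of _ "z' i"]) (auto simp: bad_rows_def good_def)
  qed
  then obtain f where f: "\<And>q. q \<in> {1..Q} \<Longrightarrow> f q \<in> {1..Q} \<and> good q (f q)"
    by metis
  define \<sigma> where "\<sigma> q = (if q \<in> {1..Q} then f q else q)" for q
  have inj: "inj_on f {1..Q}"
    using f uniq by (metis inj_onI)
  then have "f ` {1..Q} = {1..Q}"
    using f by (intro endo_inj_surj) auto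
  then have bij: "bij_betw f {1..Q} {1..Q}"
    using inj by (simp add: bij_betw_def)
  have perm: "\<sigma> permutes {1..Q}"
  proof (rule bij_imp_permutes)
    show "bij_betw \<sigma> {1..Q} {1..Q}"
      by (rule iffD1[OF bij_betw_cong bij]) (simp add: \<sigma>_def)
  qed (auto simp: \<sigma>_def)
  have "good q q' \<longleftrightarrow> q' = \<sigma> q" if q: "q \<in> {1..Q}" "q' \<in> {1..Q}" for q q'
  proof
    assume g: "good q q'"
    obtain p where p: "p \<in> {1..Q}" "q' = f p"
      using \<open>f ` {1..Q} = {1..Q}\<close> q by (metis imageE)
    then have "p = q"
      using uniq[of p q q'] f[OF p(1)] g q by simp
    then show "q' = \<sigma> q"
      using p by (simp add: \<sigma>_def)
  qed (use f q in \<open>simp add: \<sigma>_def\<close>)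
  then show thesis
    using that[of \<sigma>] perm by (simp add: good_def)
qed

text \<open>
  If \<open>\<sigma>\<close> and \<open>\<tau>\<close> change the matrix at \<open>(q, l)\<close>, all entries of the block \<open>(q, l)\<close> that lie in
  correctly matched rows and columns disagree, in addition to the cost of the bad rows.
\<close>

lemma incompatible_block_cost:
  assumes neq: "P q l \<noteq> P (\<sigma> q) (\<tau> l)"
    and rows: "\<nu> * real n \<le> real (card {i\<in>{1..n}. z i = q})"
    and cols: "\<nu> * real m \<le> real (card {j\<in>{1..m}. w j = l})"
    and R: "{i\<in>{1..n}. z' i \<noteq> \<sigma> (z i)} = bad_rows P \<nu> n m (z, w) (z', w')"
    and C: "real (card {j\<in>{1..m}. w' j \<noteq> \<tau> (w j)}) \<le> \<nu> * real m"
  shows "real (card (bad_rows P \<nu> n m (z, w) (z', w'))) * (\<nu> * real m)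
      + 2 * ((\<nu> * real n - real (card (bad_rows P \<nu> n m (z, w) (z', w'))))
        * (\<nu> * real m - real (card {j\<in>{1..m}. w' j \<noteq> \<tau> (w j)})))
      \<le> 2 * real (card (disagreements P n m (z, w) (z', w')))"
proof -
  let ?R = "bad_rows P \<nu> n m (z, w) (z', w')" and ?C = "{j\<in>{1..m}. w' j \<noteq> \<tau> (w j)}"
  let ?G = "{i\<in>{1..n}. z i = q} - ?R"
  let ?rc = "\<lambda>i. real (row_cost P m w w' (z i) (z' i))"
  have finR: "finite ?R"
    by (rule finite_subset[OF bad_rows_subset]) simp
  have G: "\<nu> * real n - real (card ?R) \<le> real (card ?G)"
    using diff_card_le_card_Diff[OF finR, of "{i\<in>{1..n}. z i = q}"] rows by linarith
  have good: "\<nu> * real m - real (card ?C) \<le> ?rc i" if "i \<in> ?G" for i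
  proof -
    have i: "z i = q" "z' i = \<sigma> q"
      using that R by auto
    have "card {j\<in>{1..m}. w j = l} - card ?C \<le> card ({j\<in>{1..m}. w j = l} - ?C)"
      by (rule diff_card_le_card_Diff) simp
    also have "\<dots> \<le> row_cost P m w w' (z i) (z' i)"
      unfolding row_cost_def i by (rule card_mono) (use neq in auto)
    finally show ?thesis
      using cols by linarith
  qed
  have "(\<nu> * real n - real (card ?R)) * (\<nu> * real m - real (card ?C))
      \<le> real (card ?G) * (\<nu> * real m - real (card ?C))"
    using G C by (intro mult_right_mono) auto
  also have "\<dots> \<le> (\<Sum>i\<in>?G. ?rc i)"
    using sum_mono[of ?G "\<lambda>_. \<nu> * real m - real (card ?C)" ?rc, OF good] by simp
  finally have 1: "(\<nu> * real n - real (card ?R)) * (\<nu> * real m - real (card ?C)) \<le> (\<Sum>i\<in>?G. ?rc i)" .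
  have "real (card ?R) * (\<nu> * real m) = (\<Sum>i\<in>?R. \<nu> * real m)"
    by simp
  also have "\<dots> \<le> (\<Sum>i\<in>?R. 2 * ?rc i)"
    by (rule sum_mono) (auto simp: bad_rows_def)
  finally have 2: "real (card ?R) * (\<nu> * real m) \<le> 2 * (\<Sum>i\<in>?R. ?rc i)"
    by (simp add: sum_distrib_left)
  have "(\<Sum>i\<in>?R. ?rc i) + (\<Sum>i\<in>?G. ?rc i) = (\<Sum>i\<in>?R \<union> ?G. ?rc i)"
    by (rule sum.union_disjoint[symmetric]) (use finR in auto)
  also have "\<dots> \<le> (\<Sum>i\<in>{1..n}. ?rc i)"
    by (rule sum_mono2) (use bad_rows_subset in auto)
  also have "\<dots> = real (card (disagreements P n m (z, w) (z', w')))"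
    by (simp add: card_disagreements)
  finally show ?thesis
    using 1 2 by (simp add: algebra_simps)
qed

text \<open>
  Either the configurations disagree on a fixed fraction of all entries, or they agree up to few nodes
  after a relabelling that preserves the matrix.  Few disagreements mean few bad rows and few bad
  columns, hence permutations \<open>\<sigma>\<close> and \<open>\<tau>\<close>; if these changed the matrix, the block above would already be
  too expensive.  The flag \<open>d\<close> stands for the SBM, in which \<open>\<sigma> = \<tau>\<close> has to be shown: for \<open>t \<le> 1 / 2\<close> each
  class has a member that is neither a bad row nor a bad column, and for a symmetric matrix
  the bad rows and the bad columns are the same.
\<close>

lemma many_disagreements_or_relabelled:
  assumes t: "0 < t" "t \<le> 2 / 3" and \<nu>: "0 < \<nu>"
    and z: "z \<in> {1..n} \<rightarrow> {1..Q}" and w: "w \<in> {1..m} \<rightarrow> {1..L}"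
    and z': "z' \<in> {1..n} \<rightarrow> {1..Q}" and w': "w' \<in> {1..m} \<rightarrow> {1..L}"
    and rows': "\<forall>q\<in>{1..Q}. \<nu> * real n \<le> real (card {i\<in>{1..n}. z i = q})"
    and cols': "\<forall>l\<in>{1..L}. \<nu> * real m \<le> real (card {j\<in>{1..m}. w j = l})"
    and identr': "\<forall>q\<in>{1..Q}. \<forall>q'\<in>{1..Q}. q \<noteq> q' \<longrightarrow> (\<exists>l\<in>{1..L}. P q l \<noteq> P q' l)"
    and identc': "\<forall>l\<in>{1..L}. \<forall>l'\<in>{1..L}. l \<noteq> l' \<longrightarrow> (\<exists>q\<in>{1..Q}. P q l \<noteq> P q l')"
    and diag': "d \<longrightarrow> n = m \<and> Q = L \<and> z = w \<and> z' = w' \<and> 1 \<le> n \<and>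
      (t \<le> 1 / 2 \<or> (\<forall>q\<in>{1..Q}. \<forall>l\<in>{1..L}. P q l = P l q))"
    and few: "2 * real (card (disagreements P n m (z, w) (z', w'))) < t * \<nu>\<^sup>2 * real n * real m"
  shows "\<exists>\<sigma> \<tau>. \<sigma> permutes {1..Q} \<and> \<tau> permutes {1..L} \<and> (d \<longrightarrow> \<sigma> = \<tau>) \<and>
    (\<forall>q\<in>{1..Q}. \<forall>l\<in>{1..L}. P q l = P (\<sigma> q) (\<tau> l)) \<and>
    real (card {i\<in>{1..n}. z' i \<noteq> \<sigma> (z i)}) < t * \<nu> * real n \<and>
    real (card {j\<in>{1..m}. w' j \<noteq> \<tau> (w j)}) < t * \<nu> * real m \<and>
    real (card {i\<in>{1..n}. z' i \<noteq> \<sigma> (z i)}) * (\<nu> * real m)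
      \<le> 2 * real (card (disagreements P n m (z, w) (z', w'))) \<and>
    real (card {j\<in>{1..m}. w' j \<noteq> \<tau> (w j)}) * (\<nu> * real n)
      \<le> 2 * real (card (disagreements P n m (z, w) (z', w')))"
proof -
  note rows = rows'[rule_format] and cols = cols'[rule_format] and identr = identr'[rule_format]
    and identc = identc'[rule_format] and diag = diag'[rule_format]
  let ?P' = "\<lambda>l q. P q l"
  let ?D = "real (card (disagreements P n m (z, w) (z', w')))"
  let ?R = "bad_rows P \<nu> n m (z, w) (z', w')" and ?C = "bad_rows ?P' \<nu> m n (w, z) (w', z')"
  have R: "real (card ?R) * (\<nu> * real m) \<le> 2 * ?D"
    by (rule bad_rows_cost)
  have C: "real (card ?C) * (\<nu> * real n) \<le> 2 * ?D"
    using bad_rows_cost[of ?P' \<nu> m n "(w, z)" "(w', z')"]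
    unfolding disagreements_transpose[of P m n w z w' z'] .
  have pos: "0 < n" "0 < m"
    using few by (auto intro!: gr0I)
  have tnn: "t * \<nu>\<^sup>2 * real n * real m = (t * \<nu> * real n) * (\<nu> * real m)"
    "t * \<nu>\<^sup>2 * real n * real m = (t * \<nu> * real m) * (\<nu> * real n)"
    by (simp_all add: power2_eq_square)
  have "real (card ?R) * (\<nu> * real m) < (t * \<nu> * real n) * (\<nu> * real m)"
    using R few tnn(1) by linarith
  then have Rs: "real (card ?R) < t * \<nu> * real n"
    by (rule mult_right_less_imp_less) (use \<nu> in simp)
  have "real (card ?C) * (\<nu> * real n) < (t * \<nu> * real m) * (\<nu> * real n)"
    using C few tnn(2) by linarith
  then have Cs: "real (card ?C) < t * \<nu> * real m"
    by (rule mult_right_less_imp_less) (use \<nu> in simp)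
  have tn: "t * \<nu> * real n < \<nu> * real n" "t * \<nu> * real m < \<nu> * real m"
    using t \<nu> pos by simp_all
  obtain \<sigma> where \<sigma>: "\<sigma> permutes {1..Q}"
    "\<And>q q'. q \<in> {1..Q} \<Longrightarrow> q' \<in> {1..Q} \<Longrightarrow>
       2 * real (row_cost P m w w' q q') < \<nu> * real m \<longleftrightarrow> q' = \<sigma> q"
    by (rule few_bad_rows_permutation[OF z' rows cols identr]) (use Rs tn in auto)
  obtain \<tau> where \<tau>: "\<tau> permutes {1..L}"
    "\<And>q q'. q \<in> {1..L} \<Longrightarrow> q' \<in> {1..L} \<Longrightarrow>
       2 * real (row_cost ?P' n z z' q q') < \<nu> * real n \<longleftrightarrow> q' = \<tau> q"
    by (rule few_bad_rows_permutation[where P = ?P' and w' = z', OF w' cols rows]) (use Cs tn identc in auto)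
  have R_eq: "{i\<in>{1..n}. z' i \<noteq> \<sigma> (z i)} = ?R"
    unfolding bad_rows_def prod.case
  proof (intro Collect_cong conj_cong refl)
    fix i assume "i \<in> {1..n}"
    then show "z' i \<noteq> \<sigma> (z i) \<longleftrightarrow> \<nu> * real m \<le> 2 * real (row_cost P m w w' (z i) (z' i))"
      using \<sigma>(2)[OF funcset_mem[OF z] funcset_mem[OF z']] by (simp add: not_less[symmetric])
  qed
  have C_eq: "{j\<in>{1..m}. w' j \<noteq> \<tau> (w j)} = ?C"
    unfolding bad_rows_def prod.case
  proof (intro Collect_cong conj_cong refl)
    fix j assume "j \<in> {1..m}"
    then show "w' j \<noteq> \<tau> (w j) \<longleftrightarrow> \<nu> * real n \<le> 2 * real (row_cost ?P' n z z' (w j) (w' j))"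
      using \<tau>(2)[OF funcset_mem[OF w] funcset_mem[OF w']] by (simp add: not_less[symmetric])
  qed
  have same: "\<sigma> = \<tau>" if d: d
  proof
    fix q
    show "\<sigma> q = \<tau> q"
    proof (cases "q \<in> {1..Q}")
      case False
      then show ?thesis
        using \<sigma>(1) \<tau>(1) diag[OF d] by (metis permutes_not_in)
    next
      case q: True
      have e: "n = m" "Q = L" "z = w" "z' = w'"
        using diag[OF d] by auto
      consider "t \<le> 1 / 2" | "\<forall>q\<in>{1..Q}. \<forall>l\<in>{1..L}. P q l = P l q"
        using diag[OF d] by blast
      then show ?thesis
      proof cases
        case 1
        have "\<not> {i\<in>{1..n}. z i = q} \<subseteq> ?R \<union> ?C"
        proof
          assume "{i\<in>{1..n}. z i = q} \<subseteq> ?R \<union> ?C"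
          then have "card {i\<in>{1..n}. z i = q} \<le> card (?R \<union> ?C)"
            by (intro card_mono) (auto intro: finite_subset[OF bad_rows_subset])
          also have "\<dots> \<le> card ?R + card ?C"
            by (rule card_Un_le)
          finally have "\<nu> * real n < 2 * (t * \<nu> * real n)"
            using rows[OF q] Rs Cs e by simp
          also have "\<dots> \<le> \<nu> * real n"
            using 1 \<nu> pos by simp
          finally show False
            by simp
        qed
        then obtain i where "i \<in> {1..n}" "z i = q" "i \<notin> ?R" "i \<notin> ?C"
          by auto
        then show ?thesis
          unfolding R_eq[symmetric] C_eq[symmetric] using e by auto
      next
        case 2
        have \<sigma>q: "\<sigma> q \<in> {1..Q}"
          using \<sigma>(1) q permutes_in_image by metis
        have "row_cost P m w w' q (\<sigma> q) = row_cost ?P' n z z' q (\<sigma> q)"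
          unfolding row_cost_def e
          by (intro arg_cong[where f = card] Collect_cong conj_cong refl)
             (use 2 q \<sigma>q w w' e in \<open>auto simp: Pi_iff\<close>)
        then have "2 * real (row_cost ?P' n z z' q (\<sigma> q)) < \<nu> * real n"
          using \<sigma>(2)[OF q \<sigma>q] e by simp
        then show ?thesis
          using \<tau>(2)[of q "\<sigma> q"] q \<sigma>q e by simp
      qed
    qed
  qed
  have inv: "P q l = P (\<sigma> q) (\<tau> l)" if q: "q \<in> {1..Q}" and l: "l \<in> {1..L}" for q l
  proof (rule ccontr)
    assume neq: "P q l \<noteq> P (\<sigma> q) (\<tau> l)"
    define x where "x = real (card ?R)"
    define y where "y = real (card ?C)"
    define a where "a = \<nu> * real n"
    define b where "b = \<nu> * real m"
    have xy: "0 \<le> x" "x < t * a" "y < t * b" "0 < a" "0 < b" "t * b < b"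
      using Rs Cs \<nu> pos tn by (simp_all add: x_def y_def a_def b_def mult.assoc)
    have "x * b + 2 * ((a - x) * (b - y)) \<le> 2 * ?D"
      using incompatible_block_cost[where P = P and \<sigma> = \<sigma> and \<tau> = \<tau>, OF neq rows[OF q] cols[OF l] R_eq] Cs tn
      unfolding C_eq x_def y_def a_def b_def by linarith
    moreover have ax: "0 \<le> a - x"
      using xy tn by (simp add: a_def mult.assoc)
    then have "(a - x) * (b - t * b) \<le> (a - x) * (b - y)"
      by (rule mult_left_mono[rotated]) (use xy in simp)
    moreover have "t * (a * b) \<le> x * b + 2 * ((a - x) * (b - t * b))"
    proof -
      \<comment> \<open>The difference is affine in \<open>x\<close>: interpolation between \<open>x = 0\<close> and \<open>x = a\<close>.\<close>
      have "x * b + 2 * ((a - x) * (b - t * b)) - t * (a * b)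
          = (a - x) * b * (2 - 3 * t) + x * b * (1 - t)"
        by (simp add: algebra_simps)
      moreover have "0 \<le> (a - x) * b * (2 - 3 * t)" "0 \<le> x * b * (1 - t)"
        using xy t ax by simp_all
      ultimately show ?thesis
        by linarith
    qed
    ultimately have "t * (a * b) \<le> 2 * ?D"
      by linarith
    then show False
      using few tnn(1) by (simp add: a_def b_def)
  qed
  show ?thesis
    by (intro exI[of _ \<sigma>] exI[of _ \<tau>] conjI impI ballI)
       (use \<sigma>(1) \<tau>(1) same inv Rs Cs R C in \<open>simp_all only: R_eq C_eq\<close>)
qed

lemma hamming_le: "hamming n z z' \<le> n"
proof -
  have "hamming n z z' \<le> card {1..n}"
    unfolding hamming_def by (rule card_mono) auto
  then show ?thesis
    by simp
qed

lemma hamming_inv_permutation: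
  assumes "\<sigma> permutes A"
  shows "hamming n z (inv' \<sigma> \<circ> z') = card {i\<in>{1..n}. z' i \<noteq> \<sigma> (z i)}"
  unfolding hamming_def comp_def
proof (intro arg_cong[where f = card] Collect_cong conj_cong refl)
  fix i
  show "z i \<noteq> inv' \<sigma> (z' i) \<longleftrightarrow> z' i \<noteq> \<sigma> (z i)"
    using permutes_inv_eq[OF assms, of "z' i" "z i"] by metis
qed

text \<open>
  A permutation other than \<open>inv \<sigma>\<close> misplaces the good members of at least two classes, since no permutation
  moves exactly one point.  Thus \<open>inv \<sigma>\<close> is the best alignment as soon as less than one class is bad.
\<close>

lemma hamming_wrong_permutation:
  assumes \<sigma>: "\<sigma> permutes {1..Q}" and s: "s permutes {1..Q}" and neq: "s \<noteq> inv' \<sigma>"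
    and rows: "\<And>q. q \<in> {1..Q} \<Longrightarrow> a \<le> real (card {i\<in>{1..n}. z i = q})"
    and few: "real (card {i\<in>{1..n}. z' i \<noteq> \<sigma> (z i)}) < a"
  shows "card {i\<in>{1..n}. z' i \<noteq> \<sigma> (z i)} < hamming n z (s \<circ> z')"
proof -
  let ?R = "{i\<in>{1..n}. z' i \<noteq> \<sigma> (z i)}"
  have "s \<circ> \<sigma> \<noteq> id"
    using neq \<sigma> by (metis permutes_inv_o(1) comp_assoc comp_id fun.map_id id_comp)
  then obtain p where p: "s (\<sigma> p) \<noteq> p"
    by (metis comp_apply eq_id_iff)
  define q where "q = s (\<sigma> p)"
  have pq: "p \<noteq> q"
    using p by (simp add: q_def)
  have perm: "(s \<circ> \<sigma>) permutes {1..Q}"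
    by (rule permutes_compose[OF \<sigma> s])
  have pQ: "p \<in> {1..Q}"
    using p perm by (metis comp_apply permutes_not_in)
  have qQ: "q \<in> {1..Q}"
    using pQ perm unfolding q_def by (metis comp_apply permutes_in_image)
  have q: "s (\<sigma> q) \<noteq> q"
  proof
    assume "s (\<sigma> q) = q"
    then have "(s \<circ> \<sigma>) q = (s \<circ> \<sigma>) p"
      by (simp add: q_def)
    then show False
      using injD[OF permutes_inj[OF perm]] p by (simp add: q_def)
  qed
  have "card {i\<in>{1..n}. z i = p} + card {i\<in>{1..n}. z i = q}
      = card ({i\<in>{1..n}. z i = p} \<union> {i\<in>{1..n}. z i = q})"
    by (rule card_Un_disjoint[symmetric]) (use pq in auto)
  also have "\<dots> \<le> card ({i\<in>{1..n}. z i \<noteq> s (z' i)} \<union> ?R)"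
  proof (rule card_mono)
    show "{i\<in>{1..n}. z i = p} \<union> {i\<in>{1..n}. z i = q} \<subseteq> {i\<in>{1..n}. z i \<noteq> s (z' i)} \<union> ?R"
    proof
      fix i assume "i \<in> {i\<in>{1..n}. z i = p} \<union> {i\<in>{1..n}. z i = q}"
      then show "i \<in> {i\<in>{1..n}. z i \<noteq> s (z' i)} \<union> ?R"
        using p q by (cases "z' i = \<sigma> (z i)") auto
    qed
  qed simp
  also have "\<dots> \<le> hamming n z (s \<circ> z') + card ?R"
    unfolding hamming_def comp_def by (rule card_Un_le)
  finally show ?thesis
    using rows[OF pQ] rows[OF qQ] few by linarith
qed

text \<open>
  In the second case of the dichotomy the pair \<open>(inv \<sigma>, inv \<tau>)\<close> is the unique closest element
  of \<open>S\<close>, so that the misclassified rows and columns are exactly the bad ones, and each of them costs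
  half a class.  In the first case the bound holds because \<open>r \<le> 2 n m\<close>.
\<close>

lemma disagreements_lower_bound:
  fixes B :: "'x block_model"
  assumes model: "block_model B" and ident: "identifiable B" and symm: "symmetry B S" and P: "P \<in> Mats B"
    and u: "(z, w) \<in> configs B n m" and v: "(z', w') \<in> configs B n m"
    and nm: "1 \<le> n" "is_sbm B \<longrightarrow> n = m"
    and \<nu>: "0 < \<nu>" "\<nu> \<le> 1"
    and rows: "\<forall>q\<in>{1..numQ B}. \<nu> * real n \<le> real (card {i\<in>{1..n}. z i = q})"
    and cols: "\<forall>l\<in>{1..numL B}. \<nu> * real m \<le> real (card {j\<in>{1..m}. w j = l})"
    and t: "0 < t" "t \<le> 2 / 3" "is_sbm B \<Longrightarrow> t \<le> 1 / 2 \<or> (\<exists>g. shape B = SBM True g)"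
    and g: "(s, s') \<in> S" "hamming n z (s \<circ> z') + hamming m w (s' \<circ> w') = config_dist S n m (z, w) (z', w')"
  shows "t / 4 * \<nu>\<^sup>2 * (real m * real (hamming n z (s \<circ> z')) + real n * real (hamming m w (s' \<circ> w')))
      \<le> real (card (disagreements P n m (z, w) (z', w')))"
proof (cases "2 * real (card (disagreements P n m (z, w) (z', w'))) < t * \<nu>\<^sup>2 * real n * real m")
  case False
  have "real m * real (hamming n z (s \<circ> z')) + real n * real (hamming m w (s' \<circ> w'))
      \<le> real m * real n + real n * real m"
    by (intro add_mono mult_left_mono) (simp_all add: hamming_le)
  then have "t / 4 * \<nu>\<^sup>2 * (real m * real (hamming n z (s \<circ> z')) + real n * real (hamming m w (s' \<circ> w')))
      \<le> t / 4 * \<nu>\<^sup>2 * (real m * real n + real n * real m)"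
    using t by (intro mult_left_mono) auto
  then show ?thesis
    using False by (simp add: algebra_simps)
next
  case few: True
  let ?Q = "numQ B" and ?L = "numL B"
  let ?D = "real (card (disagreements P n m (z, w) (z', w')))"
  have cf: "z \<in> {1..n} \<rightarrow> {1..?Q}" "w \<in> {1..m} \<rightarrow> {1..?L}" "z' \<in> {1..n} \<rightarrow> {1..?Q}" "w' \<in> {1..m} \<rightarrow> {1..?L}"
    "is_sbm B \<Longrightarrow> z = w \<and> z' = w'"
    using u v by (auto simp: configs_def PiE_def)
  have id: "\<forall>q\<in>{1..?Q}. \<forall>q'\<in>{1..?Q}. q \<noteq> q' \<longrightarrow> (\<exists>l\<in>{1..?L}. P q l \<noteq> P q' l)"
    "\<forall>l\<in>{1..?L}. \<forall>l'\<in>{1..?L}. l \<noteq> l' \<longrightarrow> (\<exists>q\<in>{1..?Q}. P q l \<noteq> P q l')"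
    using ident P unfolding identifiable_def by blast+
  have "is_sbm B \<longrightarrow> ?Q = ?L"
    "\<forall>g. shape B = SBM True g \<longrightarrow> (\<forall>q\<in>{1..?Q}. \<forall>l\<in>{1..?L}. P q l = P l q)"
    using model P unfolding block_model_def by blast+
  then have sbm: "is_sbm B \<longrightarrow> n = m \<and> ?Q = ?L \<and> z = w \<and> z' = w' \<and> 1 \<le> n \<and>
      (t \<le> 1 / 2 \<or> (\<forall>q\<in>{1..?Q}. \<forall>l\<in>{1..?L}. P q l = P l q))"
    using nm cf(5) t(3) by blast
  obtain \<sigma> \<tau> where \<sigma>: "\<sigma> permutes {1..?Q}" and \<tau>: "\<tau> permutes {1..?L}" and d: "is_sbm B \<longrightarrow> \<sigma> = \<tau>"
    and inv: "\<forall>q\<in>{1..?Q}. \<forall>l\<in>{1..?L}. P q l = P (\<sigma> q) (\<tau> l)"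
    and R: "real (card {i\<in>{1..n}. z' i \<noteq> \<sigma> (z i)}) < t * \<nu> * real n"
      "real (card {i\<in>{1..n}. z' i \<noteq> \<sigma> (z i)}) * (\<nu> * real m) \<le> 2 * ?D"
    and C: "real (card {j\<in>{1..m}. w' j \<noteq> \<tau> (w j)}) < t * \<nu> * real m"
      "real (card {j\<in>{1..m}. w' j \<noteq> \<tau> (w j)}) * (\<nu> * real n) \<le> 2 * ?D"
    using many_disagreements_or_relabelled[OF t(1,2) \<nu>(1) cf(1-4) rows cols id sbm few] by blast
  have lt: "t * \<nu> * real n \<le> \<nu> * real n" "t * \<nu> * real m \<le> \<nu> * real m"
    using t(1,2) \<nu>(1) mult_left_le_one_le[of "\<nu> * real n" t] mult_left_le_one_le[of "\<nu> * real m" t]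
    by (simp_all add: mult.assoc)
  have perms: "(\<sigma>, \<tau>) \<in> label_perms B"
    unfolding label_perms_def using \<sigma> \<tau> d by (auto simp only: sym_group_carrier)
  have "mats_eq B (permuted (\<sigma>, \<tau>) P) P"
    unfolding mats_eq_def permuted_def prod.case using inv by metis
  then have "(\<sigma>, \<tau>) \<in> S"
    using symm P perms unfolding symmetry_def by blast
  then have invS: "(inv' \<sigma>, inv' \<tau>) \<in> S"
    by (rule symmetry_inv[OF symm])
  have "config_dist S n m (z, w) (z', w') \<le> hamming n z (inv' \<sigma> \<circ> z') + hamming m w (inv' \<tau> \<circ> w')"
    unfolding config_dist_def prod.case using invS symmetry_finite[OF symm] by (intro Min_le) force+
  then have min: "hamming n z (s \<circ> z') + hamming m w (s' \<circ> w')
      \<le> card {i\<in>{1..n}. z' i \<noteq> \<sigma> (z i)} + card {j\<in>{1..m}. w' j \<noteq> \<tau> (w j)}"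
    using g(2) by (simp add: hamming_inv_permutation[OF \<sigma>] hamming_inv_permutation[OF \<tau>])
  have s: "s permutes {1..?Q}" "s' permutes {1..?L}"
    using symmetry_permutes(1,2)[OF symm g(1)] .
  have h1: "card {i\<in>{1..n}. z' i \<noteq> \<sigma> (z i)} < hamming n z (s \<circ> z')" if "s \<noteq> inv' \<sigma>"
    by (rule hamming_wrong_permutation[OF \<sigma> s(1) that rows[rule_format]]) (assumption, rule less_le_trans[OF R(1) lt(1)])
  have h2: "card {j\<in>{1..m}. w' j \<noteq> \<tau> (w j)} < hamming m w (s' \<circ> w')" if "s' \<noteq> inv' \<tau>"
    by (rule hamming_wrong_permutation[OF \<tau> s(2) that cols[rule_format]]) (assumption, rule less_le_trans[OF C(1) lt(2)])
  have e1: "hamming n z (inv' \<sigma> \<circ> z') = card {i\<in>{1..n}. z' i \<noteq> \<sigma> (z i)}"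
    and e2: "hamming m w (inv' \<tau> \<circ> w') = card {j\<in>{1..m}. w' j \<noteq> \<tau> (w j)}"
    by (simp_all only: hamming_inv_permutation[OF \<sigma>] hamming_inv_permutation[OF \<tau>])
  have "s = inv' \<sigma> \<and> s' = inv' \<tau>"
    using h1 h2 min e1 e2 by (cases "s = inv' \<sigma>"; cases "s' = inv' \<tau>") auto
  then have "hamming n z (s \<circ> z') = card {i\<in>{1..n}. z' i \<noteq> \<sigma> (z i)}"
    "hamming m w (s' \<circ> w') = card {j\<in>{1..m}. w' j \<noteq> \<tau> (w j)}"
    using e1 e2 by auto
  then have r: "\<nu> * (real m * real (hamming n z (s \<circ> z')) + real n * real (hamming m w (s' \<circ> w'))) \<le> 4 * ?D"
    (is "\<nu> * ?r \<le> _")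
    using R(2) C(2) by (simp add: algebra_simps)
  have "t * \<nu> \<le> 1 * 1"
    using t \<nu> by (intro mult_mono) auto
  then have "t * \<nu> * (\<nu> * ?r) \<le> 1 * (\<nu> * ?r)"
    using \<nu> by (intro mult_right_mono mult_nonneg_nonneg add_nonneg_nonneg) auto
  then show ?thesis
    using r by (simp add: power2_eq_square algebra_simps)
qed

section \<open>Mean log-likelihood ratios\<close>

definition mean_llr :: "'x block_model \<Rightarrow> real \<Rightarrow> real \<Rightarrow> real \<Rightarrow> real" where
  "mean_llr B p p1 p2 = (\<integral>x. ln (dens B x p1 / dens B x p2) * dens B x p \<partial>refm B)"

lemma entry_density:
  assumes "block_model B" and "p \<in> Entries B"
  shows "(\<lambda>x. dens B x p) \<in> borel_measurable (refm B)"
    and "\<And>x. x \<in> space (refm B) \<Longrightarrow> 0 \<le> dens B x p"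
    and "prob_space (obs_dist B p)"
  using assms unfolding block_model_def by blast+

lemma llr_measurable:
  assumes "block_model B" and "p1 \<in> Entries B" "p2 \<in> Entries B"
  shows "(\<lambda>x. ln (dens B x p1 / dens B x p2)) \<in> borel_measurable (refm B)"
  using entry_density(1)[OF assms(1,2)] entry_density(1)[OF assms(1,3)] by measurable

lemma KL_finite:
  assumes "kappa_max B < \<infinity>" and "p \<in> Entries B" "p' \<in> Entries B"
  shows "AE x in obs_dist B p. 0 < dens B x p'"
    and "integrable (refm B) (\<lambda>x. ln (dens B x p / dens B x p') * dens B x p)"
    and "KL B p p' = ereal (mean_llr B p p p')"
    and "ereal (mean_llr B p p p') \<le> kappa_max B"
proof -
  have le: "KL B p p' \<le> kappa_max B"
    unfolding kappa_max_def by (rule SUP_upper2[of "(p, p')"]) (use assms in auto)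
  then have "KL B p p' \<noteq> \<infinity>"
    using assms(1) by auto
  then have *: "(AE x in obs_dist B p. 0 < dens B x p') \<and>
      integrable (refm B) (\<lambda>x. ln (dens B x p / dens B x p') * dens B x p)"
    unfolding KL_def by (auto split: if_splits)
  then show "AE x in obs_dist B p. 0 < dens B x p'"
    "integrable (refm B) (\<lambda>x. ln (dens B x p / dens B x p') * dens B x p)"
    by auto
  show KL: "KL B p p' = ereal (mean_llr B p p p')"
    unfolding KL_def mean_llr_def using * by simp
  show "ereal (mean_llr B p p p') \<le> kappa_max B"
    using le KL by simp
qed

text \<open>
  Finite divergences turn mean log-likelihood ratios under a third parameter into differences of two
  divergences; they are therefore integrable and additive.
\<close>

lemma mean_llr_diff:
  assumes model: "block_model B" and fin: "kappa_max B < \<infinity>"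
    and p: "p \<in> Entries B" and p1: "p1 \<in> Entries B" and p2: "p2 \<in> Entries B"
  shows "integrable (refm B) (\<lambda>x. ln (dens B x p1 / dens B x p2) * dens B x p)"
    and "mean_llr B p p1 p2 = mean_llr B p p p2 - mean_llr B p p p1"
proof -
  let ?f = "\<lambda>x. ln (dens B x p / dens B x p2) * dens B x p - ln (dens B x p / dens B x p1) * dens B x p"
  have pos: "AE x in refm B. 0 < dens B x p \<longrightarrow> 0 < dens B x p'" if "p' \<in> Entries B" for p'
  proof -
    have m: "(\<lambda>x. ennreal (dens B x p)) \<in> borel_measurable (refm B)"
      using entry_density(1)[OF model p] by simp
    show ?thesis
      using KL_finite(1)[OF fin p that] unfolding obs_dist_def AE_density[OF m] by simp
  qed
  have eq: "AE x in refm B. ?f x = ln (dens B x p1 / dens B x p2) * dens B x p"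
    using pos[OF p1] pos[OF p2] AE_space
  proof eventually_elim
    case (elim x)
    then show ?case
      using entry_density(2)[OF model p, of x]
      by (cases "dens B x p = 0") (auto simp: ln_div algebra_simps)
  qed
  have int: "integrable (refm B) ?f"
    using KL_finite(2)[OF fin p p2] KL_finite(2)[OF fin p p1] by (rule Bochner_Integration.integrable_diff)
  have m: "(\<lambda>x. ln (dens B x p1 / dens B x p2) * dens B x p) \<in> borel_measurable (refm B)"
    using llr_measurable[OF model p1 p2] entry_density(1)[OF model p] by measurable
  show "integrable (refm B) (\<lambda>x. ln (dens B x p1 / dens B x p2) * dens B x p)"
    by (rule iffD1[OF integrable_cong_AE int]) (use m eq int in auto)
  have "mean_llr B p p1 p2 = integral\<^sup>L (refm B) ?f"
    unfolding mean_llr_def by (rule integral_cong_AE[symmetric]) (use m eq int in auto)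
  also have "\<dots> = mean_llr B p p p2 - mean_llr B p p p1"
    unfolding mean_llr_def
    by (rule Bochner_Integration.integral_diff) (rule KL_finite(2)[OF fin p p2], rule KL_finite(2)[OF fin p p1])
  finally show "mean_llr B p p1 p2 = mean_llr B p p p2 - mean_llr B p p p1" .
qed

lemma integral_obs_dist:
  assumes model: "block_model B" and fin: "kappa_max B < \<infinity>"
    and p: "p \<in> Entries B" and p1: "p1 \<in> Entries B" and p2: "p2 \<in> Entries B"
  shows "integrable (obs_dist B p) (\<lambda>x. ln (dens B x p1 / dens B x p2))"
    and "(\<integral>x. ln (dens B x p1 / dens B x p2) \<partial>obs_dist B p) = mean_llr B p p1 p2"
proof -
  have nn: "AE x in refm B. 0 \<le> dens B x p"
    using entry_density(2)[OF model p] by (intro AE_I2) auto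
  show "integrable (obs_dist B p) (\<lambda>x. ln (dens B x p1 / dens B x p2))"
    unfolding obs_dist_def
    using mean_llr_diff(1)[OF model fin p p1 p2]
    by (subst integrable_density[OF llr_measurable[OF model p1 p2] entry_density(1)[OF model p] nn])
       (simp add: mult.commute)
  show "(\<integral>x. ln (dens B x p1 / dens B x p2) \<partial>obs_dist B p) = mean_llr B p p1 p2"
    unfolding obs_dist_def
    by (subst integral_density[OF llr_measurable[OF model p1 p2] entry_density(1)[OF model p] nn])
       (simp add: mean_llr_def mult.commute)
qed

lemma obs_index_subset: "obs_index B n m \<subseteq> {1..n} \<times> {1..m}"
  by (auto simp: obs_index_def split: shape.splits)

lemma config_entry:
  assumes "block_model B" and "P \<in> Mats B" and "(z, w) \<in> configs B n m" and "(i, j) \<in> {1..n} \<times> {1..m}"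
  shows "z i \<in> {1..numQ B}" "w j \<in> {1..numL B}" "P (z i) (w j) \<in> Entries B"
proof -
  show "z i \<in> {1..numQ B}" "w j \<in> {1..numL B}"
    using assms(3,4) by (auto simp: configs_def simp del: atLeastAtMost_iff)
  then show "P (z i) (w j) \<in> Entries B"
    using assms(1,2) unfolding block_model_def by blast
qed

lemma prob_space_cond_law:
  assumes "block_model B" and "P \<in> Mats B" and "u \<in> configs B n m"
  shows "prob_space (cond_law B P n m u)" and "sets (cond_law B P n m u) = sets (obs_space B n m)"
    and "space (cond_law B P n m u) = space (obs_space B n m)"
proof -
  obtain z w where u: "u = (z, w)"
    by (cases u)
  show "prob_space (cond_law B P n m u)"
    unfolding cond_law_def u prod.case
  proof (rule prob_space_PiM)
    fix ij assume ij: "ij \<in> obs_index B n m"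
    obtain i j where "ij = (i, j)" "(i, j) \<in> {1..n} \<times> {1..m}"
      using ij obs_index_subset[of B n m] by (cases ij) blast
    then show "prob_space (case ij of (i, j) \<Rightarrow> obs_dist B (P (z i) (w j)))"
      using entry_density(3)[OF assms(1) config_entry(3)[OF assms(1,2) assms(3)[unfolded u]]] by simp
  qed
  show s: "sets (cond_law B P n m u) = sets (obs_space B n m)"
    unfolding cond_law_def u prod.case
    by (rule sets_PiM_cong) (auto simp: obs_dist_def split: prod.splits)
  show "space (cond_law B P n m u) = space (obs_space B n m)"
    by (rule sets_eq_imp_space_eq[OF s])
qed

lemma expectation_delta:
  assumes model: "block_model B" and fin: "kappa_max B < \<infinity>" and P0: "P0 \<in> Mats B" and P: "P \<in> Mats B"
    and u: "(z, w) \<in> configs B n m" and v: "(z', w') \<in> configs B n m"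
  shows "(\<integral>x. delta B P n m (z, w) (z', w') x \<partial>cond_law B P0 n m (z, w))
    = (\<Sum>(i, j)\<in>obs_index B n m. mean_llr B (P0 (z i) (w j)) (P (z i) (w j)) (P (z' i) (w' j)))"
proof -
  let ?I = "obs_index B n m"
  let ?M = "\<lambda>ij. obs_dist B (P0 (z (fst ij)) (w (snd ij)))"
  let ?f = "\<lambda>ij x. ln (dens B x (P (z (fst ij)) (w (snd ij))) / dens B x (P (z' (fst ij)) (w' (snd ij))))"
  have ent: "P0 (z (fst ij)) (w (snd ij)) \<in> Entries B" "P (z (fst ij)) (w (snd ij)) \<in> Entries B"
    "P (z' (fst ij)) (w' (snd ij)) \<in> Entries B" if "ij \<in> ?I" for ij
    using config_entry(3)[OF model P0 u] config_entry(3)[OF model P u] config_entry(3)[OF model P v]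
      that obs_index_subset[of B n m] by force+
  have law: "cond_law B P0 n m (z, w) = PiM ?I ?M"
    by (simp add: cond_law_def split_def)
  have comp: "integrable (PiM ?I ?M) (\<lambda>x. ?f ij (x ij))"
    "(\<integral>x. ?f ij (x ij) \<partial>PiM ?I ?M)
      = mean_llr B (P0 (z (fst ij)) (w (snd ij))) (P (z (fst ij)) (w (snd ij))) (P (z' (fst ij)) (w' (snd ij)))"
    if ij: "ij \<in> ?I" for ij
  proof -
    have d: "distr (PiM ?I ?M) (?M ij) (\<lambda>x. x ij) = ?M ij"
      by (rule distr_PiM_component) (use ij ent entry_density(3)[OF model] in auto)
    have m: "(\<lambda>x. x ij) \<in> measurable (PiM ?I ?M) (?M ij)"
      by (rule measurable_component_singleton) fact
    have fm: "?f ij \<in> borel_measurable (?M ij)"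
      using llr_measurable[OF model ent(2,3)[OF ij]] by (simp add: obs_dist_def)
    show "integrable (PiM ?I ?M) (\<lambda>x. ?f ij (x ij))"
      by (rule integrable_distr[OF m]) (unfold d, rule integral_obs_dist(1)[OF model fin ent[OF ij]])
    show "(\<integral>x. ?f ij (x ij) \<partial>PiM ?I ?M)
      = mean_llr B (P0 (z (fst ij)) (w (snd ij))) (P (z (fst ij)) (w (snd ij))) (P (z' (fst ij)) (w' (snd ij)))"
      using integral_distr[OF m fm] integral_obs_dist(2)[OF model fin ent[OF ij]] unfolding d by simp
  qed
  have "(\<integral>x. delta B P n m (z, w) (z', w') x \<partial>cond_law B P0 n m (z, w))
      = (\<integral>x. (\<Sum>ij\<in>?I. ?f ij (x ij)) \<partial>PiM ?I ?M)"
    unfolding law by (simp add: delta_def split_def)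
  also have "\<dots> = (\<Sum>ij\<in>?I. \<integral>x. ?f ij (x ij) \<partial>PiM ?I ?M)"
    by (rule Bochner_Integration.integral_sum) (rule comp(1))
  also have "\<dots> = (\<Sum>(i, j)\<in>?I. mean_llr B (P0 (z i) (w j)) (P (z i) (w j)) (P (z' i) (w' j)))"
    by (rule sum.cong) (auto simp: comp(2) split_def)
  finally show ?thesis .
qed

lemma mat_dist_commute: "mat_dist B P P' = mat_dist B P' P"
  unfolding mat_dist_def by (simp add: abs_minus_commute)

lemma mean_llr_self:
  "mean_llr B p p1 p1 = 0"
proof -
  have "(\<lambda>x. ln (dens B x p1 / dens B x p1) * dens B x p) = (\<lambda>_. 0)"
    by (rule ext) (simp add: divide_self_if)
  then show ?thesis
    by (simp only: mean_llr_def) simp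
qed

text \<open>
  The divergence of one pair of distinct entries lies between \<open>kappa_min\<close> and \<open>kappa_max\<close>, so both are
  finite.
\<close>

lemma kappa_min_le:
  assumes fin: "kappa_max B < \<infinity>" and pos: "0 < kappa_min B P0"
    and q: "q \<in> {1..numQ B}" "q' \<in> {1..numQ B}" and l: "l \<in> {1..numL B}" "l' \<in> {1..numL B}"
    and ent: "P0 q l \<in> Entries B" "P0 q' l' \<in> Entries B" and neq: "P0 q l \<noteq> P0 q' l'"
  shows "0 < real_of_ereal (kappa_min B P0)"
    and "real_of_ereal (kappa_min B P0) \<le> mean_llr B (P0 q l) (P0 q l) (P0 q' l')"
    and "real_of_ereal (kappa_min B P0) \<le> real_of_ereal (kappa_max B)"
    and "\<bar>kappa_max B\<bar> \<noteq> \<infinity>"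
proof -
  have "kappa_min B P0 \<le> KL B (P0 q l) (P0 q' l')"
    unfolding kappa_min_def by (rule Inf_lower) (use q l neq in blast)
  then have le: "kappa_min B P0 \<le> ereal (mean_llr B (P0 q l) (P0 q l) (P0 q' l'))"
    using KL_finite(3)[OF fin ent] by simp
  then show "0 < real_of_ereal (kappa_min B P0)"
    "real_of_ereal (kappa_min B P0) \<le> mean_llr B (P0 q l) (P0 q l) (P0 q' l')"
    using pos by (cases "kappa_min B P0"; simp)+
  moreover have "ereal (mean_llr B (P0 q l) (P0 q l) (P0 q' l')) \<le> kappa_max B"
    by (rule KL_finite(4)[OF fin ent])
  ultimately show "real_of_ereal (kappa_min B P0) \<le> real_of_ereal (kappa_max B)" "\<bar>kappa_max B\<bar> \<noteq> \<infinity>"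
    using fin by (cases "kappa_max B"; simp)+
qed

text \<open>
  The mean of \<open>ln (f(\<cdot>; P q l) / f(\<cdot>; P q' l'))\<close> differs from the divergence between the corresponding
  entries of \<open>P0\<close> by replacing \<open>P\<close> with \<open>P0\<close> in the numerator and in the denominator; each replacement
  costs at most \<open>L0 \<eta>\<close>.
\<close>

lemma mean_llr_bounds:
  assumes model: "block_model B" and fin: "kappa_max B < \<infinity>" and lip: "lipschitz_kl B L0"
    and pos: "0 < kappa_min B P0"
    and P0: "P0 \<in> Mats B" and P: "P \<in> Mats B" "mat_dist B P P0 \<le> \<eta>"
    and q: "q \<in> {1..numQ B}" "q' \<in> {1..numQ B}" and l: "l \<in> {1..numL B}" "l' \<in> {1..numL B}"
  shows "(if P0 q l \<noteq> P0 q' l' then real_of_ereal (kappa_min B P0) else 0) - 2 * L0 * \<eta>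
      \<le> mean_llr B (P0 q l) (P q l) (P q' l')"
    and "mean_llr B (P0 q l) (P q l) (P q' l') \<le> real_of_ereal (kappa_max B) + L0 * \<eta>"
proof -
  let ?J = "mean_llr B (P0 q l)"
  have mem: "P' q l \<in> Entries B" "P' q' l' \<in> Entries B" if "P' \<in> Mats B" for P'
    using model that q l unfolding block_model_def by blast+
  note ent0 = mem[OF P0] and ent = mem[OF P(1)]
  have L0: "0 < L0"
    using lip by (simp add: lipschitz_kl_def)
  have lip': "\<bar>?J (P0 a b) (P a b)\<bar> \<le> L0 * \<eta>" if "a \<in> {1..numQ B}" "b \<in> {1..numL B}" for a b
  proof -
    have "\<bar>?J (P0 a b) (P a b)\<bar> \<le> L0 * mat_dist B P0 P"
      using lip P0 P(1) q(1) l(1) that unfolding lipschitz_kl_def mean_llr_def by blast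
    also have "\<dots> \<le> L0 * \<eta>"
      using P(2) L0 by (simp add: mat_dist_commute)
    finally show ?thesis .
  qed
  note bounds = lip'[OF q(1) l(1)] lip'[OF q(2) l(2)]
  have 1: "?J (P q l) (P q' l') = ?J (P0 q l) (P q' l') - ?J (P0 q l) (P q l)"
    by (rule mean_llr_diff(2)[OF model fin ent0(1) ent])
  have 2: "?J (P0 q' l') (P q' l') = ?J (P0 q l) (P q' l') - ?J (P0 q l) (P0 q' l')"
    by (rule mean_llr_diff(2)[OF model fin ent0(1) ent0(2) ent(2)])
  have 3: "(if P0 q l \<noteq> P0 q' l' then real_of_ereal (kappa_min B P0) else 0) \<le> ?J (P0 q l) (P0 q' l')"
    using kappa_min_le(2)[OF fin pos q l ent0] by (auto simp: mean_llr_self)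
  show "(if P0 q l \<noteq> P0 q' l' then real_of_ereal (kappa_min B P0) else 0) - 2 * L0 * \<eta>
      \<le> ?J (P q l) (P q' l')"
    using 1 2 3 bounds by linarith
  have "ereal (?J (P0 q l) (P q' l')) \<le> kappa_max B"
    by (rule KL_finite(4)[OF fin ent0(1) ent(2)])
  then have "?J (P0 q l) (P q' l') \<le> real_of_ereal (kappa_max B)"
    using fin by (cases "kappa_max B") auto
  then show "?J (P q l) (P q' l') \<le> real_of_ereal (kappa_max B) + L0 * \<eta>"
    using 1 bounds by linarith
qed

lemma card_relabelled_mismatches:
  "real (card {(i, j)\<in>{1..n} \<times> {1..m}. z i \<noteq> s (z' i) \<or> w j \<noteq> t (w' j)})
    \<le> real m * real (hamming n z (s \<circ> z')) + real n * real (hamming m w (t \<circ> w'))"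
proof -
  let ?A = "{i\<in>{1..n}. z i \<noteq> (s \<circ> z') i}" and ?B = "{j\<in>{1..m}. w j \<noteq> (t \<circ> w') j}"
  have "card {(i, j)\<in>{1..n} \<times> {1..m}. z i \<noteq> s (z' i) \<or> w j \<noteq> t (w' j)}
      \<le> card (?A \<times> {1..m} \<union> {1..n} \<times> ?B)"
    by (rule card_mono) auto
  also have "\<dots> \<le> card (?A \<times> {1..m}) + card ({1..n} \<times> ?B)"
    by (rule card_Un_le)
  also have "\<dots> = m * hamming n z (s \<circ> z') + n * hamming m w (t \<circ> w')"
    by (simp add: hamming_def card_cartesian_product)
  finally show ?thesis
    using of_nat_mono by fastforce
qed

text \<open>
  After the alignment \<open>(s, t)\<close>, which leaves all matrices unchanged, only the entries with a
  misclassified row or column contribute, and there are at most \<open>r\<close> of them.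
\<close>

lemma expected_delta_bounds:
  assumes model: "block_model B" and fin: "kappa_max B < \<infinity>" and lip: "lipschitz_kl B L0"
    and pos: "0 < kappa_min B P0"
    and symm: "symmetry B S" and P0: "P0 \<in> Mats B"
    and P: "P \<in> Mats B" "mat_dist B P P0 \<le> \<eta>" and \<eta>: "0 \<le> \<eta>"
    and u: "(z, w) \<in> configs B n m" and v: "(z', w') \<in> configs B n m"
    and g: "(s, t) \<in> S"
    and r: "r = real m * real (hamming n z (s \<circ> z')) + real n * real (hamming m w (t \<circ> w'))"
  shows "real_of_ereal (kappa_min B P0) * real (card (disagreements P0 n m (z, w) (z', w') \<inter> obs_index B n m))
        - 2 * L0 * \<eta> * r \<le> (\<integral>x. delta B P n m (z, w) (z', w') x \<partial>cond_law B P0 n m (z, w))"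
    and "0 \<le> real_of_ereal (kappa_max B) \<Longrightarrow>
      (\<integral>x. delta B P n m (z, w) (z', w') x \<partial>cond_law B P0 n m (z, w))
        \<le> (real_of_ereal (kappa_max B) + L0 * \<eta>) * r"
proof -
  let ?I = "obs_index B n m"
  let ?H = "{(i, j)\<in>{1..n} \<times> {1..m}. z i \<noteq> s (z' i) \<or> w j \<noteq> t (w' j)}"
  let ?D = "disagreements P0 n m (z, w) (z', w')"
  let ?k = "real_of_ereal (kappa_min B P0)" and ?K = "real_of_ereal (kappa_max B)"
  let ?J = "\<lambda>(i, j). mean_llr B (P0 (z i) (w j)) (P (z i) (w j)) (P (z' i) (w' j))"
  have L0: "0 < L0"
    using lip by (simp add: lipschitz_kl_def)
  have finH: "finite ?H"
    by (rule finite_subset[of _ "{1..n} \<times> {1..m}"]) auto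
  have inv: "P' (s (z' i)) (t (w' j)) = P' (z' i) (w' j)" if "P' \<in> Mats B" "(i, j) \<in> {1..n} \<times> {1..m}" for P' i j
    using symm g that(1) config_entry(1,2)[OF model that(1) v that(2)]
    unfolding symmetry_def mats_eq_def permuted_def by fastforce
  have zero: "?J ij = 0" if ij0: "ij \<in> ?I - ?H" for ij
  proof -
    obtain i j where ij: "ij = (i, j)" "(i, j) \<in> {1..n} \<times> {1..m}" "z i = s (z' i)" "w j = t (w' j)"
      using ij0 obs_index_subset[of B n m] by (cases ij) blast
    then have "P (z i) (w j) = P (z' i) (w' j)"
      using inv[OF P(1) ij(2)] by simp
    then show ?thesis
      using ij(1) by (simp add: mean_llr_self)
  qed
  have DH: "?D \<subseteq> ?H"
    using inv[OF P0] by (auto simp: disagreements_def)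
  have cardH: "real (card (?I \<inter> ?H)) \<le> r"
    using card_mono[OF finH, of "?I \<inter> ?H"] card_relabelled_mismatches[of n m z s z' w t w'] r by simp
  have E: "(\<integral>x. delta B P n m (z, w) (z', w') x \<partial>cond_law B P0 n m (z, w)) = (\<Sum>ij\<in>?I \<inter> ?H. ?J ij)"
    unfolding expectation_delta[OF model fin P0 P(1) u v]
    by (rule sum.mono_neutral_right) (use zero finite_obs_index in auto)
  have bnd: "(if ij \<in> ?D then ?k else 0) - 2 * L0 * \<eta> \<le> ?J ij \<and> ?J ij \<le> ?K + L0 * \<eta>"
    if ijH: "ij \<in> ?I \<inter> ?H" for ij
  proof -
    obtain i j where ij: "ij = (i, j)" "(i, j) \<in> {1..n} \<times> {1..m}"
      using ijH by (cases ij) blast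
    note c = config_entry(1,2)[OF model P0 u ij(2)] config_entry(1,2)[OF model P0 v ij(2)]
    have "ij \<in> ?D \<longleftrightarrow> P0 (z i) (w j) \<noteq> P0 (z' i) (w' j)"
      using ij by (auto simp: disagreements_def)
    then show ?thesis
      using mean_llr_bounds[OF model fin lip pos P0 P c(1) c(3) c(2) c(4)] ij(1) by simp
  qed
  have "?D \<inter> ?I = (?I \<inter> ?H) \<inter> ?D"
    using DH by blast
  then have "?k * real (card (?D \<inter> ?I)) = (\<Sum>ij\<in>(?I \<inter> ?H) \<inter> ?D. ?k)"
    by simp
  also have "\<dots> = (\<Sum>ij\<in>?I \<inter> ?H. if ij \<in> ?D then ?k else 0)"
    by (rule sum.inter_restrict) (simp add: finite_obs_index)
  finally have "?k * real (card (?D \<inter> ?I)) - 2 * L0 * \<eta> * real (card (?I \<inter> ?H))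
      = (\<Sum>ij\<in>?I \<inter> ?H. (if ij \<in> ?D then ?k else 0) - 2 * L0 * \<eta>)"
    by (simp add: sum_subtractf)
  also have "\<dots> \<le> (\<Sum>ij\<in>?I \<inter> ?H. ?J ij)"
    by (rule sum_mono) (use bnd in blast)
  finally have "?k * real (card (?D \<inter> ?I)) - 2 * L0 * \<eta> * real (card (?I \<inter> ?H)) \<le> (\<Sum>ij\<in>?I \<inter> ?H. ?J ij)" .
  moreover have "2 * L0 * \<eta> * real (card (?I \<inter> ?H)) \<le> 2 * L0 * \<eta> * r"
    using cardH L0 \<eta> by (intro mult_left_mono) auto
  ultimately show "?k * real (card (?D \<inter> ?I)) - 2 * L0 * \<eta> * r
      \<le> (\<integral>x. delta B P n m (z, w) (z', w') x \<partial>cond_law B P0 n m (z, w))"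
    unfolding E by linarith
  assume K: "0 \<le> ?K"
  have "(\<Sum>ij\<in>?I \<inter> ?H. ?J ij) \<le> (\<Sum>ij\<in>?I \<inter> ?H. ?K + L0 * \<eta>)"
    by (rule sum_mono) (use bnd in blast)
  also have "\<dots> = (?K + L0 * \<eta>) * real (card (?I \<inter> ?H))"
    by (simp add: mult.commute)
  also have "\<dots> \<le> (?K + L0 * \<eta>) * r"
    using cardH L0 \<eta> K by (intro mult_left_mono) auto
  finally show "(\<integral>x. delta B P n m (z, w) (z', w') x \<partial>cond_law B P0 n m (z, w)) \<le> (?K + L0 * \<eta>) * r"
    unfolding E .
qed

text \<open>
  From all entries to the observed ones.  Removing the diagonal costs at most \<open>r1 = r / (2 n)\<close>
  disagreements, negligible for large \<open>n\<close>; keeping only the entries above the diagonal halves the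
  number, by symmetry.  The counting bound is applied with \<open>t = 2 / 3\<close> for undirected graphs and with
  \<open>t = 2 / 5\<close> otherwise.  With classes of size \<open>0.9 \<mu> n\<close> this gives \<open>0.135 \<mu>\<^sup>2 r\<close>, to be halved, and
  \<open>0.081 \<mu>\<^sup>2 r\<close>; both results exceed \<open>0.066 \<mu>\<^sup>2 r\<close>.
\<close>

lemma observed_disagreements:
  fixes B :: "'x block_model"
  assumes model: "block_model B" and ident: "identifiable B" and symm: "symmetry B S" and P: "P \<in> Mats B"
    and u: "(z, w) \<in> configs B n m" and v: "(z', w') \<in> configs B n m"
    and nm: "is_sbm B \<longrightarrow> n = m"
    and \<mu>: "mumin B \<le> 1" "200 \<le> real n * (mumin B)\<^sup>2"
    and rows: "\<forall>q\<in>{1..numQ B}. 9 / 10 * mumin B * real n \<le> real (card {i\<in>{1..n}. z i = q})"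
    and cols: "\<forall>l\<in>{1..numL B}. 9 / 10 * mumin B * real m \<le> real (card {j\<in>{1..m}. w j = l})"
    and g: "(s, t) \<in> S" "hamming n z (s \<circ> z') + hamming m w (t \<circ> w') = config_dist S n m (z, w) (z', w')"
    and r: "r = real m * real (hamming n z (s \<circ> z')) + real n * real (hamming m w (t \<circ> w'))"
  shows "33 / 500 * (mumin B)\<^sup>2 * r \<le> real (card (disagreements P n m (z, w) (z', w') \<inter> obs_index B n m))"
proof -
  let ?\<mu> = "mumin B" and ?I = "obs_index B n m" and ?D = "disagreements P n m (z, w) (z', w')"
  have \<mu>0: "0 < ?\<mu>"
    using model by (simp add: block_model_def mumin_def)
  have n1: "1 \<le> n"
    using \<mu>(2) by (cases n) auto
  have r0: "0 \<le> r"
    by (simp add: r)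
  have \<nu>: "0 < 9 / 10 * ?\<mu>" "9 / 10 * ?\<mu> \<le> 1"
    using \<mu>0 \<mu>(1) by auto
  note lower = disagreements_lower_bound[OF model ident symm P u v n1 nm \<nu> rows cols _ _ _ g, folded r]
  show ?thesis
  proof (cases "shape B")
    case LBM
    then have "?D \<inter> ?I = ?D"
      by (auto simp: disagreements_def obs_index_def)
    moreover have "(2 / 5) / 4 * (9 / 10 * ?\<mu>)\<^sup>2 * r \<le> real (card ?D)"
      by (rule lower) (use LBM in auto)
    moreover have "0 \<le> ?\<mu>\<^sup>2 * r"
      using r0 by simp
    ultimately show ?thesis
      by (simp add: power_mult_distrib power2_eq_square)
  next
    case (SBM undir lps)
    then have e: "z = w" "z' = w'" "s = t" "n = m"
      using u v nm symm g(1) by (auto simp: configs_def symmetry_def label_perms_def)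
    let ?h = "hamming n z (s \<circ> z')"
    let ?G = "(\<lambda>i. (i, i)) ` {i\<in>{1..n}. z i \<noteq> (s \<circ> z') i}"
    have finD: "finite ?D"
      by (rule finite_disagreements)
    have inv: "P (s (z' i)) (t (w' j)) = P (z' i) (w' j)" if "(i, j) \<in> {1..n} \<times> {1..m}" for i j
      using symm g P config_entry(1,2)[OF model P v that]
      unfolding symmetry_def mats_eq_def permuted_def by fastforce
    have G: "card ?G = ?h"
      unfolding hamming_def by (rule card_image) (auto intro: inj_onI)
    have diag: "(i, i) \<in> ?G" if "(i, i) \<in> ?D" for i
      using that inv[of i i] e by (auto simp: disagreements_def)
    have r2: "r = 2 * real n * real ?h"
      using e r by simp
    have "200 * (2 * real ?h) \<le> (real n * ?\<mu>\<^sup>2) * (2 * real ?h)"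
      by (rule mult_right_mono[OF \<mu>(2)]) simp
    then have h: "real ?h \<le> ?\<mu>\<^sup>2 * r / 400"
      unfolding r2 by (simp add: mult_ac)
    show ?thesis
    proof (cases undir)
      case False
      have "?D \<subseteq> (?D \<inter> ?I) \<union> ?G"
        using diag SBM False by (auto simp: obs_index_def disagreements_def)
      then have "card ?D \<le> card ((?D \<inter> ?I) \<union> ?G)"
        by (intro card_mono) (use finD in auto)
      also have "\<dots> \<le> card (?D \<inter> ?I) + card ?G"
        by (rule card_Un_le)
      finally have "real (card ?D) \<le> real (card (?D \<inter> ?I)) + real ?h"
        using G by simp
      moreover have "(2 / 5) / 4 * (9 / 10 * ?\<mu>)\<^sup>2 * r \<le> real (card ?D)"
        by (rule lower) auto
      moreover have "0 \<le> ?\<mu>\<^sup>2 * r"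
        using r0 by simp
      ultimately show ?thesis
        using h by (simp add: power_mult_distrib power2_eq_square)
    next
      case True
      have sym: "P q l = P l q" if "q \<in> {1..numQ B}" "l \<in> {1..numL B}" for q l
      proof -
        have "shape B = SBM True lps"
          using SBM True by simp
        then show ?thesis
          using model P that unfolding block_model_def by blast
      qed
      have swap: "(j, i) \<in> ?D" if "(i, j) \<in> ?D" for i j
      proof -
        have ij: "(i, j) \<in> {1..n} \<times> {1..m}" "P (z i) (w j) \<noteq> P (z' i) (w' j)"
          using that by (auto simp: disagreements_def)
        note c = config_entry(1,2)[OF model P u ij(1)] config_entry(1,2)[OF model P v ij(1)]
        have "P (w j) (z i) \<noteq> P (w' j) (z' i)"
          using ij(2) sym[OF c(1,2)] sym[OF c(3,4)] by simp
        then show ?thesis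
          using ij(1) e by (auto simp: disagreements_def)
      qed
      have "?D \<subseteq> (?D \<inter> ?I) \<union> prod.swap ` (?D \<inter> ?I) \<union> ?G"
      proof
        fix ij assume "ij \<in> ?D"
        moreover obtain i j where ij: "ij = (i, j)"
          by (cases ij)
        ultimately have D: "(i, j) \<in> ?D" "(i, j) \<in> {1..n} \<times> {1..m}"
          by (auto simp: disagreements_def)
        consider "i = j" | "i < j" | "j < i"
          by linarith
        then show "ij \<in> (?D \<inter> ?I) \<union> prod.swap ` (?D \<inter> ?I) \<union> ?G"
        proof cases
          case 1
          then show ?thesis
            using diag D ij by blast
        next
          case 2
          then have "(i, j) \<in> ?I"
            using D SBM by (simp add: obs_index_def)
          then show ?thesis
            using D ij by blast
        next
          case 3
          then have "(j, i) \<in> ?I"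
            using D SBM e by (simp add: obs_index_def)
          then have "prod.swap (j, i) \<in> prod.swap ` (?D \<inter> ?I)"
            using swap[OF D(1)] by blast
          then show ?thesis
            using ij by simp
        qed
      qed
      then have "card ?D \<le> card ((?D \<inter> ?I) \<union> prod.swap ` (?D \<inter> ?I) \<union> ?G)"
        by (intro card_mono) (use finD in auto)
      also have "\<dots> \<le> card ((?D \<inter> ?I) \<union> prod.swap ` (?D \<inter> ?I)) + card ?G"
        by (rule card_Un_le)
      also have "card ((?D \<inter> ?I) \<union> prod.swap ` (?D \<inter> ?I)) \<le> card (?D \<inter> ?I) + card (prod.swap ` (?D \<inter> ?I))"
        by (rule card_Un_le)
      also have "card (prod.swap ` (?D \<inter> ?I)) = card (?D \<inter> ?I)"
        by (rule card_image) (rule inj_swap)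
      finally have "real (card ?D) \<le> 2 * real (card (?D \<inter> ?I)) + real ?h"
        using G by simp
      moreover have "(2 / 3) / 4 * (9 / 10 * ?\<mu>)\<^sup>2 * r \<le> real (card ?D)"
        by (rule lower) (use SBM True in auto)
      moreover have "0 \<le> ?\<mu>\<^sup>2 * r"
        using r0 by simp
      ultimately show ?thesis
        using h by (simp add: power_mult_distrib power2_eq_square)
    qed
  qed
qed

section \<open>Equivalent configurations\<close>

definition relabel :: "nat \<Rightarrow> nat \<Rightarrow> (nat \<Rightarrow> nat) \<times> (nat \<Rightarrow> nat) \<Rightarrow> config \<Rightarrow> config" where
  "relabel n m = (\<lambda>(s, t) (z, w). (restrict (s \<circ> z) {1..n}, restrict (t \<circ> w) {1..m}))"

lemma relabel_config:
  assumes "symmetry B S" and "g \<in> S" and "u \<in> configs B n m" and "is_sbm B \<longrightarrow> n = m"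
  shows "relabel n m g u \<in> configs B n m"
proof -
  obtain s t z w where gu: "g = (s, t)" "u = (z, w)"
    by (cases g, cases u)
  note p = symmetry_permutes[OF assms(1) assms(2)[unfolded gu(1)]]
  show ?thesis
    using assms(3,4) p permutes_in_image[OF p(1)] permutes_in_image[OF p(2)] unfolding gu
    by (auto simp: relabel_def configs_def PiE_iff simp del: atLeastAtMost_iff)
qed

lemma equivalent_iff_relabel:
  assumes "v \<in> configs B n m"
  shows "equivalent S n m v u \<longleftrightarrow> (\<exists>g\<in>S. v = relabel n m g u)"
proof -
  obtain z w z' w' where uv: "u = (z, w)" "v = (z', w')"
    by (cases u, cases v)
  have ext: "z' \<in> extensional {1..n}" "w' \<in> extensional {1..m}"
    using assms by (auto simp: uv configs_def PiE_def)
  have "(\<forall>i\<in>{1..n}. s (z i) = z' i) \<and> (\<forall>j\<in>{1..m}. t (w j) = w' j) \<longleftrightarrow> v = relabel n m (s, t) u" for s t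
    using ext unfolding uv relabel_def prod.case prod.inject
    by (auto simp: fun_eq_iff extensional_def simp del: atLeastAtMost_iff)
  then show ?thesis
    unfolding equivalent_def uv by (auto simp: split_beta)
qed

lemma relabel_inv:
  assumes "symmetry B S" and "(s, t) \<in> S" and "v \<in> configs B n m"
  shows "relabel n m (inv' s, inv' t) (relabel n m (s, t) v) = v"
proof -
  obtain z w where v: "v = (z, w)"
    by (cases v)
  note p = symmetry_permutes[OF assms(1,2)]
  have "z \<in> extensional {1..n}" "w \<in> extensional {1..m}"
    using assms(3) by (auto simp: v configs_def PiE_def)
  then show ?thesis
    using permutes_inverses(2)[OF p(1)] permutes_inverses(2)[OF p(2)]
    by (auto simp: v relabel_def fun_eq_iff extensional_def)
qed

lemma inj_on_relabel_group:
  assumes "symmetry B S"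
    and rows: "\<And>q. q \<in> {1..numQ B} \<Longrightarrow> \<exists>i\<in>{1..n}. z i = q"
    and cols: "\<And>l. l \<in> {1..numL B} \<Longrightarrow> \<exists>j\<in>{1..m}. w j = l"
  shows "inj_on (\<lambda>g. relabel n m g (z, w)) S"
proof (rule inj_onI, clarify)
  fix s t s' t' assume g: "(s, t) \<in> S" "(s', t') \<in> S"
    and eq: "relabel n m (s, t) (z, w) = relabel n m (s', t') (z, w)"
  note p = symmetry_permutes[OF assms(1) g(1)] and p' = symmetry_permutes[OF assms(1) g(2)]
  have e: "s (z i) = s' (z i)" if "i \<in> {1..n}" for i
    using eq that by (auto simp: relabel_def dest!: fun_cong[where x = i] simp del: atLeastAtMost_iff)
  have e': "t (w j) = t' (w j)" if "j \<in> {1..m}" for j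
    using eq that by (auto simp: relabel_def dest!: fun_cong[where x = j] simp del: atLeastAtMost_iff)
  have "s q = s' q" for q
    using rows[of q] e permutes_not_in[OF p(1), of q] permutes_not_in[OF p'(1), of q] by metis
  moreover have "t l = t' l" for l
    using cols[of l] e' permutes_not_in[OF p(2), of l] permutes_not_in[OF p'(2), of l] by metis
  ultimately show "s = s' \<and> t = t'"
    by auto
qed

lemma card_equivalence_class:
  assumes symm: "symmetry B S" and u: "(z, w) \<in> configs B n m" and nm: "is_sbm B \<longrightarrow> n = m"
    and rows: "\<And>q. q \<in> {1..numQ B} \<Longrightarrow> \<exists>i\<in>{1..n}. z i = q"
    and cols: "\<And>l. l \<in> {1..numL B} \<Longrightarrow> \<exists>j\<in>{1..m}. w j = l"
  shows "card {v \<in> configs B n m. equivalent S n m v (z, w)} = card S"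
proof -
  have "{v \<in> configs B n m. equivalent S n m v (z, w)} = (\<lambda>g. relabel n m g (z, w)) ` S"
    using relabel_config[OF symm _ u nm] equivalent_iff_relabel[of _ B n m S "(z, w)"] by blast
  then show ?thesis
    using card_image[OF inj_on_relabel_group[OF symm rows cols]] by simp
qed

lemma lik_relabel:
  assumes model: "block_model B" and symm: "symmetry B S" and P: "P \<in> Mats B" and g: "g \<in> S"
    and u: "u \<in> configs B n m"
  shows "lik B P n m (relabel n m g u) x = lik B P n m u x"
proof -
  obtain s t z w where gu: "g = (s, t)" "u = (z, w)"
    by (cases g, cases u)
  have "P (s (z i)) (t (w j)) = P (z i) (w j)" if "(i, j) \<in> obs_index B n m" for i j
    using symm g P config_entry(1,2)[OF model P u[unfolded gu] subsetD[OF obs_index_subset that]]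
    unfolding symmetry_def mats_eq_def permuted_def gu by fastforce
  then show ?thesis
    unfolding lik_def relabel_def gu prod.case
    using obs_index_subset[of B n m] by (intro prod.cong refl) auto
qed

section \<open>Sums over configurations\<close>

text \<open>
  The relation between two configurations and the number \<open>r\<close> in the concentration inequality.  It is
  a relation because several alignments may attain the distance.
\<close>

definition aligned_cost ::
    "((nat \<Rightarrow> nat) \<times> (nat \<Rightarrow> nat)) set \<Rightarrow> nat \<Rightarrow> nat \<Rightarrow> config \<Rightarrow> config \<Rightarrow> real \<Rightarrow> bool" where
  "aligned_cost S n m = (\<lambda>(z, w) (z', w') r. \<exists>(s, t)\<in>S.
     hamming n z (s \<circ> z') + hamming m w (t \<circ> w') = config_dist S n m (z, w) (z', w') \<and>
     r = real m * real (hamming n z (s \<circ> z')) + real n * real (hamming m w (t \<circ> w')))"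

text \<open>
  The sum is a product over the nodes, with factors of at most \<open>1 + Q x\<close>.
\<close>

lemma sum_power_hamming_le:
  fixes x :: real
  assumes x: "0 \<le> x"
  shows "(\<Sum>z'\<in>{1..n} \<rightarrow>\<^sub>E {1..Q}. x ^ hamming n z z') \<le> exp (real Q * real n * x)"
proof -
  let ?f = "\<lambda>i q. if z i \<noteq> q then x else 1"
  have pow: "x ^ hamming n z z' = (\<Prod>i\<in>{1..n}. ?f i (z' i))" for z'
  proof -
    have "(\<Prod>i\<in>{1..n}. ?f i (z' i)) = (\<Prod>i\<in>{1..n} \<inter> {i. z i \<noteq> z' i}. x)"
      by (subst prod.inter_restrict) auto
    then show ?thesis
      by (simp add: hamming_def Int_def)
  qed
  have row: "(\<Sum>q\<in>{1..Q}. ?f i q) \<le> exp (real Q * x)" for i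
  proof -
    have "(\<Sum>q\<in>{1..Q}. ?f i q) \<le> (\<Sum>q\<in>{1..Q}. x + (if q = z i then 1 else 0))"
      by (rule sum_mono) (use x in auto)
    also have "\<dots> \<le> real Q * x + 1"
      by (simp add: sum.distrib sum.delta)
    also have "\<dots> \<le> exp (real Q * x)"
      using exp_ge_add_one_self[of "real Q * x"] by linarith
    finally show ?thesis .
  qed
  have "(\<Sum>z'\<in>{1..n} \<rightarrow>\<^sub>E {1..Q}. x ^ hamming n z z') = (\<Prod>i\<in>{1..n}. \<Sum>q\<in>{1..Q}. ?f i q)"
    unfolding pow by (rule prod_sum_PiE[symmetric]) auto
  also have "\<dots> \<le> (\<Prod>i\<in>{1..n}. exp (real Q * x))"
    by (rule prod_mono) (use row x in \<open>auto intro!: sum_nonneg\<close>)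
  also have "\<dots> = exp (real Q * real n * x)"
    by (simp add: exp_of_nat_mult[symmetric] mult_ac)
  finally show ?thesis .
qed

text \<open>
  The exponent in \<open>(1 + Q x)^n (1 + L x')^m \<le> exp (Q n x + L m x')\<close>, where \<open>x\<close> and \<open>x'\<close> are the
  weights of one misclassified row and column.
\<close>

definition far_weight :: "'x block_model \<Rightarrow> real \<Rightarrow> nat \<Rightarrow> nat \<Rightarrow> real" where
  "far_weight B y n m =
     (if is_sbm B then real (numQ B) * real n * exp (- (2 * real n * y))
      else real (numQ B) * real n * exp (- (y * real m)) + real (numL B) * real m * exp (- (y * real n)))"

lemma sum_exp_hamming_le:
  assumes nm: "is_sbm B \<longrightarrow> n = m"
    and u: "(z, w) \<in> configs B n m"
  shows "(\<Sum>(z', w')\<in>configs B n m. exp (- (y * (real m * real (hamming n z z') + real n * real (hamming m w w')))))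
    \<le> exp (far_weight B y n m)"
proof (cases "is_sbm B")
  case False
  let ?x = "exp (- (y * real m))" and ?x' = "exp (- (y * real n))"
  have c: "configs B n m = ({1..n} \<rightarrow>\<^sub>E {1..numQ B}) \<times> ({1..m} \<rightarrow>\<^sub>E {1..numL B})"
    using False by (auto simp: configs_def)
  have "(\<Sum>(z', w')\<in>configs B n m. exp (- (y * (real m * real (hamming n z z') + real n * real (hamming m w w')))))
      = (\<Sum>(z', w')\<in>configs B n m. ?x ^ hamming n z z' * ?x' ^ hamming m w w')"
    by (intro sum.cong refl) (auto simp: exp_of_nat_mult[symmetric] exp_add[symmetric] algebra_simps)
  also have "\<dots> = (\<Sum>z'\<in>{1..n} \<rightarrow>\<^sub>E {1..numQ B}. ?x ^ hamming n z z')
      * (\<Sum>w'\<in>{1..m} \<rightarrow>\<^sub>E {1..numL B}. ?x' ^ hamming m w w')"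
    unfolding c by (simp add: sum.cartesian_product[symmetric] sum_product)
  also have "\<dots> \<le> exp (real (numQ B) * real n * ?x) * exp (real (numL B) * real m * ?x')"
    by (intro mult_mono sum_power_hamming_le sum_nonneg) auto
  also have "\<dots> = exp (far_weight B y n m)"
    using False by (simp add: far_weight_def exp_add)
  finally show ?thesis .
next
  case True
  let ?x = "exp (- (2 * real n * y))"
  have c: "configs B n m = (\<lambda>z. (z, z)) ` ({1..n} \<rightarrow>\<^sub>E {1..numQ B})" if "numQ B = numL B"
    using True nm that by (auto simp: configs_def)
  have "(\<Sum>(z', w')\<in>configs B n m. exp (- (y * (real m * real (hamming n z z') + real n * real (hamming m w w')))))
      = (\<Sum>(z', w')\<in>configs B n m. ?x ^ hamming n z z')"
    using u True nm by (intro sum.cong refl) (auto simp: configs_def exp_of_nat_mult[symmetric] algebra_simps)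
  also have "\<dots> \<le> (\<Sum>(z', w')\<in>(\<lambda>z. (z, z)) ` ({1..n} \<rightarrow>\<^sub>E {1..numQ B}). ?x ^ hamming n z z')"
    by (rule sum_mono2) (use True nm in \<open>auto simp: configs_def finite_PiE\<close>)
  also have "\<dots> = (\<Sum>z'\<in>{1..n} \<rightarrow>\<^sub>E {1..numQ B}. ?x ^ hamming n z z')"
    by (subst sum.reindex) (auto intro: inj_onI)
  also have "\<dots> \<le> exp (real (numQ B) * real n * ?x)"
    by (rule sum_power_hamming_le) simp
  also have "\<dots> = exp (far_weight B y n m)"
    using True by (simp add: far_weight_def)
  finally show ?thesis .
qed

text \<open>
  Replacing each \<open>v\<close> by its best alignment \<open>g v\<close> with \<open>u\<close> turns the distance into a Hamming distance
  from \<open>u\<close>.  The map \<open>v \<mapsto> (g, g v)\<close> is injective, whence the factor \<open>|S|\<close>, and it never hits \<open>u\<close>, whence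
  the term \<open>- 1\<close>.
\<close>

lemma sum_exp_distance_le:
  assumes symm: "symmetry B S" and nm: "is_sbm B \<longrightarrow> n = m"
    and u: "(z, w) \<in> configs B n m"
    and r: "\<And>v. v \<in> configs B n m \<Longrightarrow> \<not> equivalent S n m v (z, w) \<Longrightarrow> aligned_cost S n m (z, w) v (r v)"
  shows "(\<Sum>v | v \<in> configs B n m \<and> \<not> equivalent S n m v (z, w). exp (- (y * r v)))
    \<le> real (card S) * (exp (far_weight B y n m) - 1)"
proof -
  let ?F = "{v \<in> configs B n m. \<not> equivalent S n m v (z, w)}"
  let ?\<phi> = "\<lambda>(z', w'). exp (- (y * (real m * real (hamming n z z') + real n * real (hamming m w w'))))"
  have h: "hamming n z (restrict f {1..n}) = hamming n z f" for n z f
    unfolding hamming_def by (intro arg_cong[where f = card]) auto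
  have "\<exists>g\<in>S. exp (- (y * r v)) = ?\<phi> (relabel n m g v)" if v: "v \<in> ?F" for v
  proof -
    obtain z' w' where v': "v = (z', w')"
      by (cases v)
    obtain s t where st: "(s, t) \<in> S"
      "r v = real m * real (hamming n z (s \<circ> z')) + real n * real (hamming m w (t \<circ> w'))"
      using r[of v] v unfolding v' aligned_cost_def prod.case by blast
    then show ?thesis
      by (intro bexI[of _ "(s, t)"]) (simp_all add: v' relabel_def h del: One_nat_def)
  qed
  then obtain G where G: "\<And>v. v \<in> ?F \<Longrightarrow> G v \<in> S"
    "\<And>v. v \<in> ?F \<Longrightarrow> exp (- (y * r v)) = ?\<phi> (relabel n m (G v) v)"
    using bchoice[of ?F "\<lambda>v g. g \<in> S \<and> exp (- (y * r v)) = ?\<phi> (relabel n m g v)"] by blast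
  let ?h = "\<lambda>v. (G v, relabel n m (G v) v)"
  have inv: "v = relabel n m (inv' (fst (G v)), inv' (snd (G v))) (relabel n m (G v) v)" if "v \<in> ?F" for v
    using relabel_inv[OF symm, of "fst (G v)" "snd (G v)" v n m] G(1)[OF that] that by simp
  have inj: "inj_on ?h ?F"
  proof (rule inj_onI)
    fix v v' assume v: "v \<in> ?F" "v' \<in> ?F" and eq: "?h v = ?h v'"
    show "v = v'"
    proof (rule box_equals[OF _ inv[OF v(1), symmetric] inv[OF v(2), symmetric]])
      have e: "G v = G v'" "relabel n m (G v) v = relabel n m (G v') v'"
        using eq by auto
      show "relabel n m (inv' (fst (G v)), inv' (snd (G v))) (relabel n m (G v) v)
          = relabel n m (inv' (fst (G v')), inv' (snd (G v'))) (relabel n m (G v') v')"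
        unfolding e(2) by (simp only: e(1))
    qed
  qed
  have "?h ` ?F \<subseteq> S \<times> (configs B n m - {(z, w)})"
  proof
    fix p assume "p \<in> ?h ` ?F"
    then obtain v where v: "v \<in> ?F" "p = ?h v"
      by blast
    have "relabel n m (G v) v \<noteq> (z, w)"
    proof
      assume "relabel n m (G v) v = (z, w)"
      then have "v = relabel n m (inv' (fst (G v)), inv' (snd (G v))) (z, w)"
        using inv[OF v(1)] by simp
      moreover have "(inv' (fst (G v)), inv' (snd (G v))) \<in> S"
        using symmetry_inv[OF symm, of "fst (G v)" "snd (G v)"] G(1)[OF v(1)] by simp
      ultimately have "equivalent S n m v (z, w)"
        using v(1) equivalent_iff_relabel[of v B n m S "(z, w)"] by blast
      then show False
        using v(1) by simp
    qed
    then show "p \<in> S \<times> (configs B n m - {(z, w)})"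
      using v G(1) relabel_config[OF symm G(1)[OF v(1)] _ nm] by auto
  qed
  then have "(\<Sum>p\<in>?h ` ?F. ?\<phi> (snd p)) \<le> (\<Sum>p\<in>S \<times> (configs B n m - {(z, w)}). ?\<phi> (snd p))"
    by (intro sum_mono2) (use symmetry_finite[OF symm] in \<open>auto simp: split_beta finite_configs\<close>)
  also have "\<dots> = real (card S) * (\<Sum>v\<in>configs B n m - {(z, w)}. ?\<phi> v)"
    using sum.cartesian_product[of "\<lambda>_ v. ?\<phi> v" "configs B n m - {(z, w)}" S] by (simp add: split_beta)
  also have "(\<Sum>v\<in>configs B n m - {(z, w)}. ?\<phi> v) = (\<Sum>v\<in>configs B n m. ?\<phi> v) - 1"
    using u by (subst sum_diff1) (auto simp: finite_configs hamming_def)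
  also have "real (card S) * ((\<Sum>v\<in>configs B n m. ?\<phi> v) - 1) \<le> real (card S) * (exp (far_weight B y n m) - 1)"
    using sum_exp_hamming_le[OF nm u, of y] by (intro mult_left_mono) auto
  also have "(\<Sum>p\<in>?h ` ?F. ?\<phi> (snd p)) = (\<Sum>v\<in>?F. exp (- (y * r v)))"
    by (subst sum.reindex[OF inj]) (auto simp: G(2) intro!: sum.cong)
  finally show ?thesis .
qed

section \<open>The posterior under uniform proportions\<close>

text \<open>
  \<open>K = 0\<close> says that the largest weights equal the lower bounds \<open>amin\<close> and \<open>bmin\<close>.
\<close>

lemma uniform_weights:
  assumes model: "block_model B" and K: "K_const B = 0" and \<theta>: "(\<alpha>, \<beta>, P) \<in> Theta B"
  shows "\<And>q. q \<in> {1..numQ B} \<Longrightarrow> pmf \<alpha> q = amin B" and "\<And>l. l \<in> {1..numL B} \<Longrightarrow> pmf \<beta> l = bmin B"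
proof -
  have amin: "0 < amin B" "0 < bmin B"
    using model by (simp_all add: block_model_def)
  have ln: "ln (amax B / amin B) \<le> 0" "ln (bmax B / bmin B) \<le> 0"
    using K unfolding K_const_def by linarith+
  let ?A = "{pmf \<alpha> q |\<alpha> \<beta> P q. (\<alpha>, \<beta>, P) \<in> Theta B \<and> q \<in> {1..numQ B}}"
  let ?B = "{pmf \<beta> l |\<alpha> \<beta> P l. (\<alpha>, \<beta>, P) \<in> Theta B \<and> l \<in> {1..numL B}}"
  have bdd: "bdd_above ?A" "bdd_above ?B"
    by (auto intro!: bdd_aboveI[of _ 1] pmf_le_1)
  show "pmf \<alpha> q = amin B" if q: "q \<in> {1..numQ B}" for q
  proof -
    have 1: "amin B \<le> pmf \<alpha> q"
      using \<theta> q by (auto simp: Theta_def)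
    have 2: "pmf \<alpha> q \<le> amax B"
      unfolding amax_def by (rule cSup_upper[OF _ bdd(1)]) (use \<theta> q in blast)
    have "amax B / amin B \<le> 1"
      using ln(1) 1 2 amin ln_le_zero_iff[of "amax B / amin B"] by (simp add: zero_less_divide_iff)
    then show ?thesis
      using 1 2 amin by simp
  qed
  show "pmf \<beta> l = bmin B" if l: "l \<in> {1..numL B}" for l
  proof -
    have 1: "bmin B \<le> pmf \<beta> l"
      using \<theta> l by (auto simp: Theta_def)
    have 2: "pmf \<beta> l \<le> bmax B"
      unfolding bmax_def by (rule cSup_upper[OF _ bdd(2)]) (use \<theta> l in blast)
    have "bmax B / bmin B \<le> 1"
      using ln(2) 1 2 amin ln_le_zero_iff[of "bmax B / bmin B"] by (simp add: zero_less_divide_iff)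
    then show ?thesis
      using 1 2 amin by simp
  qed
qed

lemma pmf_latent:
  assumes nm: "is_sbm B \<longrightarrow> n = m" and u: "(z, w) \<in> configs B n m"
  shows "pmf (latent B \<alpha> \<beta> n m) (z, w)
    = (\<Prod>i\<in>{1..n}. pmf \<alpha> (z i)) * (if is_sbm B then 1 else (\<Prod>j\<in>{1..m}. pmf \<beta> (w j)))"
proof -
  have ext: "\<And>i. i \<notin> {1..n} \<Longrightarrow> z i = undefined" "\<And>j. j \<notin> {1..m} \<Longrightarrow> w j = undefined"
    using u by (auto simp: configs_def PiE_def extensional_def)
  have z: "pmf (Pi_pmf {1..n} undefined (\<lambda>_. \<alpha>)) z = (\<Prod>i\<in>{1..n}. pmf \<alpha> (z i))"
    by (rule pmf_Pi') (use ext in auto)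
  have w: "pmf (Pi_pmf {1..m} undefined (\<lambda>_. \<beta>)) w = (\<Prod>j\<in>{1..m}. pmf \<beta> (w j))"
    by (rule pmf_Pi') (use ext in auto)
  show ?thesis
  proof (cases "is_sbm B")
    case True
    then have "w = z"
      using u by (auto simp: configs_def)
    then show ?thesis
      using True z pmf_map_inj'[of "\<lambda>z. (z, z)" "Pi_pmf {1..n} undefined (\<lambda>_. \<alpha>)" z]
      by (simp add: latent_def inj_def)
  next
    case False
    then show ?thesis
      using z w by (simp add: latent_def pmf_pair)
  qed
qed

lemma posterior_uniform:
  assumes model: "block_model B" and K: "K_const B = 0" and \<theta>: "(\<alpha>, \<beta>, P) \<in> Theta B"
    and nm: "is_sbm B \<longrightarrow> n = m" and u: "u \<in> configs B n m"
  shows "posterior B (\<alpha>, \<beta>, P) n m x u = lik B P n m u x / (\<Sum>v\<in>configs B n m. lik B P n m v x)"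
proof -
  define c where "c = amin B ^ n * (if is_sbm B then 1 else bmin B ^ m)"
  have c: "0 < c"
    using model by (simp add: c_def block_model_def)
  have w: "pmf (latent B \<alpha> \<beta> n m) v = c" if v: "v \<in> configs B n m" for v
  proof -
    obtain z w where zw: "v = (z, w)"
      by (cases v)
    have "(\<Prod>i\<in>{1..n}. pmf \<alpha> (z i)) = (\<Prod>i\<in>{1..n}. amin B)"
      by (rule prod.cong[OF refl], rule uniform_weights(1)[OF model K \<theta>])
         (use v in \<open>auto simp: zw configs_def simp del: atLeastAtMost_iff\<close>)
    moreover have "(\<Prod>j\<in>{1..m}. pmf \<beta> (w j)) = (\<Prod>j\<in>{1..m}. bmin B)"
      by (rule prod.cong[OF refl], rule uniform_weights(2)[OF model K \<theta>])
         (use v in \<open>auto simp: zw configs_def simp del: atLeastAtMost_iff\<close>)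
    ultimately show ?thesis
      unfolding zw pmf_latent[OF nm v[unfolded zw]] c_def by simp
  qed
  have "(\<Sum>v\<in>configs B n m. pmf (latent B \<alpha> \<beta> n m) v * lik B P n m v x)
      = c * (\<Sum>v\<in>configs B n m. lik B P n m v x)"
    unfolding sum_distrib_left by (rule sum.cong) (simp_all add: w)
  then show ?thesis
    using c w[OF u] by (simp add: posterior_def)
qed

lemma lik_nonneg:
  assumes model: "block_model B" and P: "P \<in> Mats B" and u: "u \<in> configs B n m"
    and x: "x \<in> space (obs_space B n m)"
  shows "0 \<le> lik B P n m u x"
proof -
  obtain z w where zw: "u = (z, w)"
    by (cases u)
  have "0 \<le> dens B (x (i, j)) (P (z i) (w j))" if ij: "(i, j) \<in> obs_index B n m" for i j
  proof -
    have "x (i, j) \<in> space (refm B)"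
      using x ij by (auto simp: space_PiM)
    then show ?thesis
      using entry_density(2)[OF model config_entry(3)[OF model P u[unfolded zw] subsetD[OF obs_index_subset ij]]] by simp
  qed
  then show ?thesis
    unfolding lik_def zw by (auto intro!: prod_nonneg)
qed

lemma lik_measurable:
  assumes model: "block_model B" and P: "P \<in> Mats B" and u: "u \<in> configs B n m"
  shows "lik B P n m u \<in> borel_measurable (obs_space B n m)"
proof -
  obtain z w where zw: "u = (z, w)"
    by (cases u)
  show ?thesis
    unfolding lik_def zw prod.case
  proof (rule borel_measurable_prod, clarify)
    fix i j assume ij: "(i, j) \<in> obs_index B n m"
    show "(\<lambda>x. dens B (x (i, j)) (P (z i) (w j))) \<in> borel_measurable (obs_space B n m)"
      by (rule measurable_compose[OF measurable_component_singleton[OF ij] entry_density(1)[OF model]])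
         (rule config_entry(3)[OF model P u[unfolded zw] subsetD[OF obs_index_subset ij]])
  qed
qed

lemma lik_ratio:
  assumes model: "block_model B" and P: "P \<in> Mats B"
    and u: "u \<in> configs B n m" and v: "v \<in> configs B n m"
    and x: "x \<in> space (obs_space B n m)" and nz: "lik B P n m u x \<noteq> 0" "lik B P n m v x \<noteq> 0"
  shows "lik B P n m v x = lik B P n m u x * exp (- delta B P n m u v x)"
proof -
  obtain z w z' w' where uv: "u = (z, w)" "v = (z', w')"
    by (cases u, cases v)
  let ?I = "obs_index B n m"
  let ?f = "\<lambda>(i, j). dens B (x (i, j)) (P (z i) (w j))" and ?g = "\<lambda>(i, j). dens B (x (i, j)) (P (z' i) (w' j))"
  have pos: "0 < ?f ij" "0 < ?g ij" if ij: "ij \<in> ?I" for ij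
  proof -
    obtain i j where e: "ij = (i, j)" "(i, j) \<in> {1..n} \<times> {1..m}"
      using ij obs_index_subset[of B n m] by (cases ij) blast
    have "x (i, j) \<in> space (refm B)"
      using x ij e by (auto simp: space_PiM)
    then have "0 \<le> ?f ij" "0 \<le> ?g ij"
      using entry_density(2)[OF model config_entry(3)[OF model P u[unfolded uv] e(2)]]
        entry_density(2)[OF model config_entry(3)[OF model P v[unfolded uv] e(2)]] e by auto
    moreover have "?f ij \<noteq> 0" "?g ij \<noteq> 0"
      using nz ij finite_obs_index[of B n m] unfolding lik_def uv prod.case by auto
    ultimately show "0 < ?f ij" "0 < ?g ij"
      by linarith+
  qed
  have "exp (- delta B P n m u v x) = (\<Prod>ij\<in>?I. exp (- ln (?f ij / ?g ij)))"
    unfolding delta_def uv prod.case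
    by (simp add: sum_negf[symmetric] exp_sum finite_obs_index split_def)
  also have "\<dots> = (\<Prod>ij\<in>?I. ?g ij / ?f ij)"
  proof (rule prod.cong[OF refl])
    fix ij assume "ij \<in> ?I"
    then show "exp (- ln (?f ij / ?g ij)) = ?g ij / ?f ij"
      using pos[of ij] by (simp add: exp_minus)
  qed
  also have "\<dots> = lik B P n m v x / lik B P n m u x"
    unfolding lik_def uv prod.case by (simp add: prod_dividef split_def)
  finally show ?thesis
    using nz by simp
qed

locale uniform_block_model =
  fixes B :: "'x block_model" and \<alpha>s \<beta>s :: "nat pmf" and Ps :: params
    and S :: "((nat \<Rightarrow> nat) \<times> (nat \<Rightarrow> nat)) set" and L0 \<eta> :: real
  assumes model: "block_model B"
    and true_parameter: "(\<alpha>s, \<beta>s, Ps) \<in> Theta B"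
    and ident: "identifiable B"
    and kappa_pos: "0 < kappa_min B Ps"
    and symm: "symmetry B S"
    and fin: "kappa_max B < \<infinity>"
    and lip: "lipschitz_kl B L0"
    and uniform: "K_const B = 0"
    and \<eta>: "0 < \<eta>" "\<eta> < c_rate B Ps / (2 * L0)"
begin

text \<open>
  \<open>e\<close> is the deviation for which the concentration inequality is used, and \<open>k\<close> is the rate in \<open>a_term\<close>.
\<close>

definition "\<mu> = mumin B"
definition "\<kappa> = real_of_ereal (kappa_min B Ps)"
definition "\<kappa>m = real_of_ereal (kappa_max B)"
definition "e = \<kappa> * \<mu>\<^sup>2 / 1000"
definition "k = c_rate B Ps - 2 * L0 * \<eta>"

lemma Ps: "Ps \<in> Mats B"
  using true_parameter by (simp add: Theta_def)

lemma L0_pos: "0 < L0"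
  using lip by (simp add: lipschitz_kl_def)

lemma c_rate_eq: "c_rate B Ps = \<mu>\<^sup>2 * \<kappa> / 16"
  by (simp add: c_rate_def \<mu>_def \<kappa>_def)

lemma \<mu>_pos: "0 < \<mu>" and \<mu>_le_1: "\<mu> \<le> 1"
proof -
  show "0 < \<mu>"
    using model by (simp add: \<mu>_def mumin_def block_model_def)
  have "1 \<in> {1..numQ B}"
    using model by (simp add: block_model_def)
  then have "amin B = pmf \<alpha>s 1"
    using uniform_weights(1)[OF model uniform true_parameter] by metis
  then have "amin B \<le> 1"
    by (simp add: pmf_le_1)
  then show "\<mu> \<le> 1"
    by (simp add: \<mu>_def mumin_def)
qed

lemma distinct_entries:
  obtains q l q' l' where "q \<in> {1..numQ B}" "l \<in> {1..numL B}" "q' \<in> {1..numQ B}" "l' \<in> {1..numL B}"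
    "Ps q l \<noteq> Ps q' l'"
proof (rule ccontr)
  assume "\<not> thesis"
  then have "{KL B (Ps q l) (Ps q' l') |q l q' l'. q \<in> {1..numQ B} \<and> l \<in> {1..numL B} \<and>
      q' \<in> {1..numQ B} \<and> l' \<in> {1..numL B} \<and> Ps q l \<noteq> Ps q' l'} = {}"
    using that by blast
  then have "kappa_min B Ps = \<infinity>"
    unfolding kappa_min_def by (simp only: Inf_empty top_ereal_def)
  then have "c_rate B Ps = 0"
    by (simp add: c_rate_def)
  then show False
    using \<eta> by simp
qed

lemma \<kappa>_pos: "0 < \<kappa>" and \<kappa>_le_\<kappa>m: "\<kappa> \<le> \<kappa>m"
proof -
  obtain q l q' l' where d: "q \<in> {1..numQ B}" "l \<in> {1..numL B}" "q' \<in> {1..numQ B}" "l' \<in> {1..numL B}"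
    "Ps q l \<noteq> Ps q' l'"
    by (rule distinct_entries)
  then have ent: "Ps q l \<in> Entries B" "Ps q' l' \<in> Entries B"
    using model Ps unfolding block_model_def by blast+
  show "0 < \<kappa>" "\<kappa> \<le> \<kappa>m"
    using kappa_min_le(1,3)[OF fin kappa_pos d(1,3,2,4) ent d(5)] by (simp_all add: \<kappa>_def \<kappa>m_def)
qed

lemma several_labels: "2 \<le> numQ B \<or> 2 \<le> numL B"
proof (rule ccontr)
  assume "\<not> ?thesis"
  then have "{1..numQ B} \<subseteq> {1}" "{1..numL B} \<subseteq> {1}"
    by auto
  then show False
    by (rule_tac distinct_entries) blast
qed

lemma e_pos: "0 < e"
  using \<kappa>_pos \<mu>_pos by (simp add: e_def)

lemma L0_\<eta>: "2 * L0 * \<eta> < \<mu>\<^sup>2 * \<kappa> / 16"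
  using \<eta>(2) L0_pos unfolding c_rate_eq[symmetric] by (simp add: pos_less_divide_eq mult_ac)

lemma k_pos: "0 < k"
  using L0_\<eta> by (simp add: k_def c_rate_eq)

text \<open>
  Class sizes are required to be at least \<open>0.9\<close> of the smallest possible expectation, compared with
  \<open>0.5\<close> for regular configurations; the disagreement bounds need the larger constant.
\<close>

definition good_configs :: "nat \<Rightarrow> nat \<Rightarrow> config set" where
  "good_configs n m = {(z, w) \<in> configs B n m.
     (\<forall>q\<in>{1..numQ B}. 9 / 10 * \<mu> * real n \<le> real (card {i\<in>{1..n}. z i = q})) \<and>
     (\<forall>l\<in>{1..numL B}. 9 / 10 * \<mu> * real m \<le> real (card {j\<in>{1..m}. w j = l}))}"

text \<open>
  Observations at which \<open>\<delta>\<close> is close to its mean for every wrong configuration \<open>v\<close>.  As vanishing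
  likelihoods count as deviations, the likelihood ratios are then equal to \<open>exp (- \<delta>)\<close>.
\<close>

definition concentrated :: "nat \<Rightarrow> nat \<Rightarrow> params \<Rightarrow> config \<Rightarrow> (nat \<times> nat \<Rightarrow> 'x) \<Rightarrow> bool" where
  "concentrated n m P u x \<longleftrightarrow> x \<in> space (obs_space B n m) \<and>
     (\<forall>v\<in>configs B n m. \<not> equivalent S n m v u \<longrightarrow>
        (\<exists>r. aligned_cost S n m u v r \<and> x \<notin> deviation B Ps n m u v P (e * r)))"

text \<open>
  What the sizes have to satisfy for the exponential gains to beat all constants.
\<close>

definition large :: "nat \<Rightarrow> nat \<Rightarrow> bool" where
  "large n m \<longleftrightarrow> m \<le> n \<and> 200 \<le> real n * \<mu>\<^sup>2 \<and> 2 \<le> 9 / 10 * \<mu> * real m \<and>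
     real (numQ B) * exp (- (e * real m)) \<le> 1 \<and> real (numL B) * exp (- (e * real m)) \<le> 1 \<and>
     b_term B n m \<le> 1 \<and> 6 * (real (card S))\<^sup>2 \<le> exp (9 / 10 * \<kappa>m * real m)"

text \<open>
  The constants: the mean is at least \<open>(0.066 \<mu>\<^sup>2 \<kappa> - 2 L0 \<eta>) r\<close>, and \<open>k\<close> needs \<open>0.0625 \<mu>\<^sup>2 \<kappa>\<close> of it;
  with \<open>e = 0.001 \<mu>\<^sup>2 \<kappa>\<close> there is room both for the deviation and for the surplus \<open>e\<close> in the
  exponent.  The upper bound uses that \<open>L0 \<eta>\<close> and \<open>e\<close> are small multiples of \<open>\<kappa> \<le> \<kappa>m\<close>.
\<close>

lemma delta_bounds:
  assumes nm: "is_sbm B \<longrightarrow> n = m" and lg: "large n m" and P: "P \<in> Mats B" "mat_dist B P Ps \<le> \<eta>"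
    and u: "(z, w) \<in> good_configs n m" and v: "(z', w') \<in> configs B n m"
    and r: "aligned_cost S n m (z, w) (z', w') r"
    and x: "x \<in> space (obs_space B n m)" "x \<notin> deviation B Ps n m (z, w) (z', w') P (e * r)"
  shows "(k + e) * r \<le> delta B P n m (z, w) (z', w') x" (is ?lower)
    and "delta B P n m (z, w) (z', w') x \<le> 11 / 10 * \<kappa>m * r" (is ?upper)
    and "lik B P n m (z, w) x \<noteq> 0" "lik B P n m (z', w') x \<noteq> 0"
proof -
  obtain s t where g: "(s, t) \<in> S" "hamming n z (s \<circ> z') + hamming m w (t \<circ> w') = config_dist S n m (z, w) (z', w')"
    and r: "r = real m * real (hamming n z (s \<circ> z')) + real n * real (hamming m w (t \<circ> w'))"
    using r unfolding aligned_cost_def prod.case by blast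
  have uc: "(z, w) \<in> configs B n m"
    and rows: "\<forall>q\<in>{1..numQ B}. 9 / 10 * mumin B * real n \<le> real (card {i\<in>{1..n}. z i = q})"
    and cols: "\<forall>l\<in>{1..numL B}. 9 / 10 * mumin B * real m \<le> real (card {j\<in>{1..m}. w j = l})"
    using u by (auto simp: good_configs_def \<mu>_def)
  let ?E = "\<integral>x. delta B P n m (z, w) (z', w') x \<partial>cond_law B Ps n m (z, w)"
  let ?d = "delta B P n m (z, w) (z', w') x"
  have dev: "\<bar>?d - ?E\<bar> < e * r" and nz: "lik B P n m (z, w) x \<noteq> 0" "lik B P n m (z', w') x \<noteq> 0"
    using x prob_space_cond_law(3)[OF model Ps uc] by (auto simp: deviation_def)
  show "lik B P n m (z, w) x \<noteq> 0" "lik B P n m (z', w') x \<noteq> 0"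
    by (fact nz)+
  have r0: "0 \<le> r"
    by (simp add: r)
  have D: "33 / 500 * \<mu>\<^sup>2 * r \<le> real (card (disagreements Ps n m (z, w) (z', w') \<inter> obs_index B n m))"
    unfolding \<mu>_def
    by (rule observed_disagreements[OF model ident symm Ps uc v nm _ _ rows cols g r])
       (use lg \<mu>_le_1 in \<open>auto simp: large_def \<mu>_def\<close>)
  note bnd = expected_delta_bounds[OF model fin lip kappa_pos symm Ps P _ uc v g(1) r, folded \<kappa>_def \<kappa>m_def]
  have "\<kappa> * (33 / 500 * \<mu>\<^sup>2 * r) - 2 * L0 * \<eta> * r \<le> ?E"
    using bnd(1) \<eta>(1) mult_left_mono[OF D less_imp_le[OF \<kappa>_pos]] by linarith
  moreover have "\<kappa> * (33 / 500 * \<mu>\<^sup>2 * r) - 2 * L0 * \<eta> * r - e * r = (k + e) * r + \<kappa> * \<mu>\<^sup>2 * r * (33 / 500 - 1 / 16 - 2 / 1000)"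
    by (simp add: k_def c_rate_eq e_def algebra_simps)
  moreover have "0 \<le> \<kappa> * \<mu>\<^sup>2 * r"
    using \<kappa>_pos r0 by simp
  ultimately show ?lower
    using dev by (simp add: abs_less_iff)
  have "\<mu>\<^sup>2 \<le> 1"
    using \<mu>_pos \<mu>_le_1 by (simp add: power_le_one)
  then have "\<mu>\<^sup>2 * \<kappa> \<le> 1 * \<kappa>m"
    using \<kappa>_pos \<kappa>_le_\<kappa>m by (intro mult_mono) auto
  then have "\<kappa>m + L0 * \<eta> + e \<le> 11 / 10 * \<kappa>m"
    using L0_\<eta> \<kappa>_pos \<kappa>_le_\<kappa>m unfolding e_def by (simp add: mult.commute[of \<kappa>])
  then have "(\<kappa>m + L0 * \<eta> + e) * r \<le> 11 / 10 * \<kappa>m * r"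
    using r0 by (rule mult_right_mono)
  moreover have "?E \<le> (\<kappa>m + L0 * \<eta>) * r"
    using bnd(2) \<eta>(1) \<kappa>_pos \<kappa>_le_\<kappa>m by linarith
  ultimately show ?upper
    using dev by (simp add: abs_less_iff algebra_simps)
qed

lemma good_labels:
  assumes "large n m" and "(z, w) \<in> good_configs n m"
  shows "\<And>q. q \<in> {1..numQ B} \<Longrightarrow> 2 \<le> card {i\<in>{1..n}. z i = q}"
    and "\<And>l. l \<in> {1..numL B} \<Longrightarrow> 2 \<le> card {j\<in>{1..m}. w j = l}"
    and "\<And>q. q \<in> {1..numQ B} \<Longrightarrow> \<exists>i\<in>{1..n}. z i = q"
    and "\<And>l. l \<in> {1..numL B} \<Longrightarrow> \<exists>j\<in>{1..m}. w j = l"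
proof -
  have two: "2 \<le> 9 / 10 * \<mu> * real m" and mn: "m \<le> n"
    using assms(1) unfolding large_def by blast+
  have "9 / 10 * \<mu> * real m \<le> 9 / 10 * \<mu> * real n"
    using mn \<mu>_pos by (intro mult_left_mono) auto
  note two = order_trans[OF two this] two
  show 1: "2 \<le> card {i\<in>{1..n}. z i = q}" if "q \<in> {1..numQ B}" for q
  proof -
    have "9 / 10 * \<mu> * real n \<le> real (card {i\<in>{1..n}. z i = q})"
      using assms(2) that unfolding good_configs_def by blast
    then have "2 \<le> real (card {i\<in>{1..n}. z i = q})"
      using two by linarith
    then show ?thesis
      by linarith
  qed
  show 2: "2 \<le> card {j\<in>{1..m}. w j = l}" if "l \<in> {1..numL B}" for l
  proof -
    have "9 / 10 * \<mu> * real m \<le> real (card {j\<in>{1..m}. w j = l})"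
      using assms(2) that unfolding good_configs_def by blast
    then have "2 \<le> real (card {j\<in>{1..m}. w j = l})"
      using two by linarith
    then show ?thesis
      by linarith
  qed
  show "\<exists>i\<in>{1..n}. z i = q" if "q \<in> {1..numQ B}" for q
  proof -
    have "{i\<in>{1..n}. z i = q} \<noteq> {}"
      using 1[OF that] by (metis card.empty not_numeral_le_zero)
    then show ?thesis
      by blast
  qed
  show "\<exists>j\<in>{1..m}. w j = l" if "l \<in> {1..numL B}" for l
  proof -
    have "{j\<in>{1..m}. w j = l} \<noteq> {}"
      using 2[OF that] by (metis card.empty not_numeral_le_zero)
    then show ?thesis
      by blast
  qed
qed

text \<open>
  A constant configuration misses a label, so it is not equivalent to a good one.  The existence of some
  wrong configuration guarantees that the likelihood of the true one does not vanish on the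
  concentration event.
\<close>

lemma ex_inequivalent:
  assumes nm: "is_sbm B \<longrightarrow> n = m" and lg: "large n m" and u: "(z, w) \<in> good_configs n m"
  obtains v where "v \<in> configs B n m" "\<not> equivalent S n m v (z, w)"
proof -
  let ?v = "(restrict (\<lambda>_. 1) {1..n}, restrict (\<lambda>_. 1) {1..m}) :: config"
  have "1 \<le> numQ B" "1 \<le> numL B"
    using model by (auto simp: block_model_def)
  then have v: "?v \<in> configs B n m"
    using nm by (auto simp: configs_def PiE_iff)
  moreover have "\<not> equivalent S n m ?v (z, w)"
  proof
    assume "equivalent S n m ?v (z, w)"
    then obtain s t where g: "(s, t) \<in> S" "\<forall>i\<in>{1..n}. s (z i) = 1" "\<forall>j\<in>{1..m}. t (w j) = 1"
      unfolding equivalent_def prod.case by (auto split: prod.splits)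
    note p = symmetry_permutes[OF symm g(1)]
    have 1: "q = q'" if q12: "q \<in> {1..numQ B}" "q' \<in> {1..numQ B}" for q q'
    proof -
      obtain i i' where "i \<in> {1..n}" "z i = q" "i' \<in> {1..n}" "z i' = q'"
        using good_labels(3)[OF lg u q12(1)] good_labels(3)[OF lg u q12(2)] by blast
      then show ?thesis
        using g(2) injD[OF permutes_inj[OF p(1)], of q q'] by force
    qed
    have 2: "l = l'" if l12: "l \<in> {1..numL B}" "l' \<in> {1..numL B}" for l l'
    proof -
      obtain j j' where "j \<in> {1..m}" "w j = l" "j' \<in> {1..m}" "w j' = l'"
        using good_labels(4)[OF lg u l12(1)] good_labels(4)[OF lg u l12(2)] by blast
      then show ?thesis
        using g(3) injD[OF permutes_inj[OF p(2)], of l l'] by force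
    qed
    show False
      using several_labels 1[of 1 2] 2[of 1 2] by auto
  qed
  ultimately show thesis
    by (rule that)
qed

definition odds :: "nat \<Rightarrow> nat \<Rightarrow> params \<Rightarrow> config \<Rightarrow> (nat \<times> nat \<Rightarrow> 'x) \<Rightarrow> real" where
  "odds n m P u x = (\<Sum>v | v \<in> configs B n m \<and> \<not> equivalent S n m v u.
     lik B P n m v x / lik B P n m u x) / real (card S)"

lemma posterior_class_odds:
  assumes nm: "is_sbm B \<longrightarrow> n = m" and lg: "large n m" and \<theta>: "(\<alpha>, \<beta>, P) \<in> Theta B"
    and u: "(z, w) \<in> good_configs n m"
    and x: "x \<in> space (obs_space B n m)" and nz: "lik B P n m (z, w) x \<noteq> 0"
  shows "posterior_class B S (\<alpha>, \<beta>, P) n m x (z, w) = 1 / (1 + odds n m P (z, w) x)"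
    and "posterior B (\<alpha>, \<beta>, P) n m x (z, w)
      = 1 / real (card S) * posterior_class B S (\<alpha>, \<beta>, P) n m x (z, w)"
    and "0 \<le> odds n m P (z, w) x"
proof -
  have uc: "(z, w) \<in> configs B n m"
    using u by (auto simp: good_configs_def)
  have P: "P \<in> Mats B"
    using \<theta> by (simp add: Theta_def)
  let ?l = "\<lambda>v. lik B P n m v x" and ?u = "(z, w)"
  let ?C = "{v. v \<in> configs B n m \<and> equivalent S n m v ?u}"
  let ?F = "{v. v \<in> configs B n m \<and> \<not> equivalent S n m v ?u}"
  have S: "1 \<le> real (card S)"
    using symmetry_card_pos[OF symm] by simp
  have lu: "0 < ?l ?u"
    using lik_nonneg[OF model P uc x] nz by simp
  have cls: "?l v = ?l ?u" if "v \<in> ?C" for v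
    using that lik_relabel[OF model symm P _ uc] equivalent_iff_relabel[of v B n m S ?u] by auto
  have card: "card ?C = card S"
    using card_equivalence_class[OF symm uc nm good_labels(3,4)[OF lg u]] by simp
  have "(\<Sum>v\<in>configs B n m. ?l v) = (\<Sum>v\<in>?C. ?l v) + (\<Sum>v\<in>?F. ?l v)"
    by (subst sum.union_disjoint[symmetric]) (auto simp: finite_configs intro!: sum.cong)
  also have "(\<Sum>v\<in>?C. ?l v) = real (card S) * ?l ?u"
    using cls card by simp
  also have "(\<Sum>v\<in>?F. ?l v) = real (card S) * ?l ?u * odds n m P ?u x"
    using lu S by (simp add: odds_def sum_divide_distrib[symmetric])
  finally have tot: "(\<Sum>v\<in>configs B n m. ?l v) = real (card S) * ?l ?u * (1 + odds n m P ?u x)"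
    by (simp add: algebra_simps)
  show o: "0 \<le> odds n m P ?u x"
    unfolding odds_def
    by (intro divide_nonneg_nonneg sum_nonneg) (use lik_nonneg[OF model P _ x] uc in auto)
  have post: "posterior B (\<alpha>, \<beta>, P) n m x v = ?l v / (\<Sum>v\<in>configs B n m. ?l v)" if "v \<in> configs B n m" for v
    by (rule posterior_uniform[OF model uniform \<theta> nm that])
  have "posterior_class B S (\<alpha>, \<beta>, P) n m x ?u = (\<Sum>v\<in>?C. ?l ?u / (\<Sum>v\<in>configs B n m. ?l v))"
    unfolding posterior_class_def by (rule sum.cong) (simp_all add: post cls)
  also have "\<dots> = real (card S) * ?l ?u / (\<Sum>v\<in>configs B n m. ?l v)"
    using card by simp
  finally have pc: "posterior_class B S (\<alpha>, \<beta>, P) n m x ?u = real (card S) * ?l ?u / (\<Sum>v\<in>configs B n m. ?l v)" .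
  show "posterior_class B S (\<alpha>, \<beta>, P) n m x ?u = 1 / (1 + odds n m P ?u x)"
    unfolding pc tot using lu S o by simp
  show "posterior B (\<alpha>, \<beta>, P) n m x ?u = 1 / real (card S) * posterior_class B S (\<alpha>, \<beta>, P) n m x ?u"
    unfolding pc post[OF uc] using S by simp
qed

end

section \<open>Bounds on the posterior odds\<close>

lemma exp_minus_one_le:
  fixes a :: real
  shows "exp a - 1 \<le> a * exp a"
proof -
  have "(1 + - a) * exp a \<le> exp (- a) * exp a"
    by (rule mult_right_mono[OF exp_ge_add_one_self]) simp
  then show ?thesis
    by (simp add: exp_minus algebra_simps)
qed

context uniform_block_model
begin

lemma a_term_eq:
  "a_term B Ps L0 \<eta> n m =
    (if is_sbm B then real n * exp (- (2 * real n * k))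
     else real n * exp (- (k * real m)) + real m * exp (- (k * real n)))"
  by (simp add: a_term_def k_def Let_def)

lemma b_term_eq:
  "b_term B n m =
    (if is_sbm B then real n * exp (- (4 * \<kappa>m * real n))
     else real n * exp (- (2 * \<kappa>m * real m)) + real m * exp (- (2 * \<kappa>m * real n)))"
  by (simp add: b_term_def C_rate_def \<kappa>m_def Let_def)

lemma far_weight_le_a_term:
  assumes nm: "is_sbm B \<longrightarrow> n = m" and lg: "large n m"
  shows "far_weight B (k + e) n m \<le> a_term B Ps L0 \<eta> n m"
proof -
  let ?Q = "real (numQ B)" and ?L = "real (numL B)"
  have mn: "real m \<le> real n"
    using lg by (simp add: large_def)
  have Q: "?Q * exp (- (e * real m)) \<le> 1" and L: "?L * exp (- (e * real m)) \<le> 1"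
    using lg by (auto simp: large_def)
  have le: "exp (- (e * real n)) \<le> exp (- (e * real m))" "exp (- (2 * (e * real n))) \<le> exp (- (e * real m))"
  proof -
    have "e * real m \<le> e * real n" "0 \<le> e * real n"
      using mult_left_mono[OF mn less_imp_le[OF e_pos]] e_pos by simp_all
    then show "exp (- (e * real n)) \<le> exp (- (e * real m))" "exp (- (2 * (e * real n))) \<le> exp (- (e * real m))"
      unfolding exp_le_cancel_iff by linarith+
  qed
  show ?thesis
  proof (cases "is_sbm B")
    case True
    have "far_weight B (k + e) n m = real n * exp (- (2 * real n * k)) * (?Q * exp (- (2 * (e * real n))))"
      using True by (simp add: far_weight_def exp_add[symmetric] algebra_simps)
    also have "\<dots> \<le> real n * exp (- (2 * real n * k)) * 1"
      using order.trans[OF mult_left_mono[OF le(2), of ?Q] Q] by (intro mult_left_mono) auto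
    finally show ?thesis
      using True by (simp add: a_term_eq)
  next
    case False
    have "far_weight B (k + e) n m = real n * exp (- (k * real m)) * (?Q * exp (- (e * real m)))
        + real m * exp (- (k * real n)) * (?L * exp (- (e * real n)))"
      using False by (simp add: far_weight_def exp_add[symmetric] algebra_simps)
    also have "\<dots> \<le> real n * exp (- (k * real m)) * 1 + real m * exp (- (k * real n)) * 1"
      using Q order.trans[OF mult_left_mono[OF le(1), of ?L] L] by (intro add_mono mult_left_mono) auto
    finally show ?thesis
      using False by (simp add: a_term_eq)
  qed
qed

lemma odds_le:
  assumes nm: "is_sbm B \<longrightarrow> n = m" and lg: "large n m" and P: "P \<in> Mats B" "mat_dist B P Ps \<le> \<eta>"
    and u: "(z, w) \<in> good_configs n m" and conc: "concentrated n m P (z, w) x"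
  shows "odds n m P (z, w) x \<le> a_term B Ps L0 \<eta> n m * exp (a_term B Ps L0 \<eta> n m)"
proof -
  let ?F = "{v. v \<in> configs B n m \<and> \<not> equivalent S n m v (z, w)}"
  let ?a = "a_term B Ps L0 \<eta> n m" and ?f = "far_weight B (k + e) n m"
  have uc: "(z, w) \<in> configs B n m"
    using u by (auto simp: good_configs_def)
  have x: "x \<in> space (obs_space B n m)"
    using conc by (simp add: concentrated_def)
  have S: "1 \<le> real (card S)"
    using symmetry_card_pos[OF symm] by simp
  have "\<forall>v\<in>?F. \<exists>r. aligned_cost S n m (z, w) v r \<and> lik B P n m v x / lik B P n m (z, w) x \<le> exp (- ((k + e) * r))"
  proof
    fix v assume v: "v \<in> ?F"
    obtain z' w' where v': "v = (z', w')"
      by (cases v)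
    have vc: "(z', w') \<in> configs B n m"
      using v v' by auto
    obtain r where r: "aligned_cost S n m (z, w) v r" "x \<notin> deviation B Ps n m (z, w) v P (e * r)"
      using conc v unfolding concentrated_def by blast
    note d = delta_bounds[OF nm lg P u vc r(1)[unfolded v'] x r(2)[unfolded v']]
    have "lik B P n m v x / lik B P n m (z, w) x = exp (- delta B P n m (z, w) v x)"
      using lik_ratio[OF model P(1) uc vc x d(3,4)] d(3) v' by simp
    then show "\<exists>r. aligned_cost S n m (z, w) v r \<and> lik B P n m v x / lik B P n m (z, w) x \<le> exp (- ((k + e) * r))"
      using d(1) r(1) v' by auto
  qed
  then obtain r where r: "\<forall>v\<in>?F. aligned_cost S n m (z, w) v (r v) \<and>
      lik B P n m v x / lik B P n m (z, w) x \<le> exp (- ((k + e) * r v))"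
    by (rule bchoice[THEN exE])
  have "(\<Sum>v\<in>?F. lik B P n m v x / lik B P n m (z, w) x) \<le> (\<Sum>v\<in>?F. exp (- ((k + e) * r v)))"
    by (rule sum_mono) (use r in blast)
  also have "\<dots> \<le> real (card S) * (exp ?f - 1)"
    by (rule sum_exp_distance_le[OF symm nm uc]) (use r in blast)
  finally have "odds n m P (z, w) x \<le> exp ?f - 1"
    using S by (simp add: odds_def pos_divide_le_eq mult.commute)
  also have "\<dots> \<le> exp ?a - 1"
    using far_weight_le_a_term[OF nm lg] by simp
  also have "\<dots> \<le> ?a * exp ?a"
    by (rule exp_minus_one_le)
  finally show ?thesis .
qed

text \<open>
  Changing the label of a single row leads out of the class, since every label occurs at least twice.
  For the same reason the best alignment is trivial on the columns, so only one row (in the SBM one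
  row and one column) contributes to \<open>r\<close>.
\<close>

lemma flipped_ratio_ge:
  assumes nm: "is_sbm B \<longrightarrow> n = m" and lg: "large n m" and P: "P \<in> Mats B" "mat_dist B P Ps \<le> \<eta>"
    and u: "(z, w) \<in> good_configs n m" and conc: "concentrated n m P (z, w) x"
    and i: "i \<in> {1..n}" and q: "q \<in> {1..numQ B}" "q \<noteq> z i"
    and v: "v = (z(i := q), if is_sbm B then w(i := q) else w)"
  shows "v \<in> configs B n m" and "\<not> equivalent S n m v (z, w)"
    and "exp (- (11 / 10 * \<kappa>m * (if is_sbm B then 2 * real n else real m)))
      \<le> lik B P n m v x / lik B P n m (z, w) x"
proof -
  obtain w' where w': "w' = (if is_sbm B then w(i := q) else w)" "v = (z(i := q), w')"
    using v by blast
  have uc: "(z, w) \<in> configs B n m"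
    using u by (auto simp: good_configs_def)
  have QL: "is_sbm B \<longrightarrow> numQ B = numL B"
    using model by (simp add: block_model_def)
  show vc: "v \<in> configs B n m"
    using uc q i nm QL unfolding v configs_def
    by (auto simp: PiE_iff extensional_def simp del: atLeastAtMost_iff)
  show ne: "\<not> equivalent S n m v (z, w)"
  proof
    assume "equivalent S n m v (z, w)"
    then obtain s t where s: "(s, t) \<in> S" "\<forall>l\<in>{1..n}. s (z l) = (z(i := q)) l"
      unfolding equivalent_def v by auto
    have "z i \<in> {1..numQ B}"
      using uc i by (auto simp: configs_def simp del: atLeastAtMost_iff)
    then have "\<not> {l\<in>{1..n}. z l = z i} \<subseteq> {i}"
      using good_labels(1)[OF lg u] card_mono[of "{i}" "{l\<in>{1..n}. z l = z i}"] by force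
    then obtain l where l: "l \<in> {1..n}" "z l = z i" "l \<noteq> i"
      by blast
    then have "q = z i"
      using s(2)[rule_format, of l] s(2)[rule_format, OF i] by simp
    then show False
      using q by simp
  qed
  obtain r where r: "aligned_cost S n m (z, w) (z(i := q), w') r"
    "x \<notin> deviation B Ps n m (z, w) (z(i := q), w') P (e * r)"
    using conc vc ne unfolding concentrated_def w'(2) by blast
  then obtain s t where st: "(s, t) \<in> S"
    "hamming n z (s \<circ> z(i := q)) + hamming m w (t \<circ> w') = config_dist S n m (z, w) (z(i := q), w')"
    and r_eq: "r = real m * real (hamming n z (s \<circ> z(i := q))) + real n * real (hamming m w (t \<circ> w'))"
    unfolding aligned_cost_def prod.case by blast
  have x: "x \<in> space (obs_space B n m)"
    using conc by (simp add: concentrated_def)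
  note d = delta_bounds[OF nm lg P u vc[unfolded w'(2)] r(1) x r(2)]
  have "config_dist S n m (z, w) (z(i := q), w') \<le> hamming n z (id \<circ> z(i := q)) + hamming m w (id \<circ> w')"
    unfolding config_dist_def prod.case
    using symmetry_id[OF symm] symmetry_finite[OF symm] by (intro Min_le) force+
  moreover have one: "hamming n z (z(i := q)) = 1"
  proof -
    have "{j\<in>{1..n}. z j \<noteq> (z(i := q)) j} = {i}"
      using i q by auto
    then show ?thesis
      by (simp add: hamming_def)
  qed
  ultimately have dist: "hamming n z (s \<circ> z(i := q)) + hamming m w (t \<circ> w') \<le> 1 + hamming m w w'"
    using st(2) by simp
  have r_le: "r \<le> (if is_sbm B then 2 * real n else real m)"
  proof (cases "is_sbm B")
    case True
    then have e: "w' = z(i := q)" "n = m" "w = z" "t = s"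
      using w'(1) nm uc symmetry_permutes(3)[OF symm st(1)] by (auto simp: configs_def)
    then have "hamming n z (s \<circ> z(i := q)) \<le> 1"
      using dist one by simp
    then have "real n * real (hamming n z (s \<circ> z(i := q))) \<le> real n * 1"
      by (intro mult_left_mono) auto
    then show ?thesis
      using True e by (simp add: r_eq)
  next
    case False
    then have w: "w' = w"
      using w'(1) by simp
    have dist1: "hamming n z (s \<circ> z(i := q)) + hamming m w (t \<circ> w) \<le> 1"
      using dist w by (simp add: hamming_def)
    \<comment> \<open>A nontrivial \<open>t\<close> would relabel a whole class of columns, which has at least two elements.\<close>
    have "t l = l" if l: "l \<in> {1..numL B}" for l
    proof (rule ccontr)
      assume "t l \<noteq> l"
      then have "card {j\<in>{1..m}. w j = l} \<le> hamming m w (t \<circ> w)"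
        unfolding hamming_def by (intro card_mono) auto
      then show False
        using good_labels(2)[OF lg u l] dist1 by simp
    qed
    then have "hamming m w (t \<circ> w) = 0"
      using uc by (auto simp: hamming_def configs_def PiE_iff simp del: atLeastAtMost_iff)
    moreover have "real m * real (hamming n z (s \<circ> z(i := q))) \<le> real m * 1"
      using dist1 by (intro mult_left_mono) auto
    ultimately show ?thesis
      using False w by (simp add: r_eq)
  qed
  have "delta B P n m (z, w) v x \<le> 11 / 10 * \<kappa>m * (if is_sbm B then 2 * real n else real m)"
    using d(2) mult_left_mono[OF r_le, of "11 / 10 * \<kappa>m"] \<kappa>_pos \<kappa>_le_\<kappa>m unfolding w'(2) by linarith
  moreover have "lik B P n m v x / lik B P n m (z, w) x = exp (- delta B P n m (z, w) v x)"
    using lik_ratio[OF model P(1) uc vc x d(3)] d(3,4) unfolding w'(2) by simp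
  ultimately show "exp (- (11 / 10 * \<kappa>m * (if is_sbm B then 2 * real n else real m)))
      \<le> lik B P n m v x / lik B P n m (z, w) x"
    by simp
qed

text \<open>
  The \<open>n\<close> single changes alone give odds of at least \<open>n exp (- 1.1 \<kappa>m \<rho>) / |S|\<close>, where \<open>\<rho>\<close> is \<open>m\<close> or \<open>2 n\<close>,
  while \<open>|S| b exp b \<le> 6 |S| n exp (- 2 \<kappa>m \<rho>)\<close>.
\<close>

lemma odds_ge:
  assumes nm: "is_sbm B \<longrightarrow> n = m" and lg: "large n m" and P: "P \<in> Mats B" "mat_dist B P Ps \<le> \<eta>"
    and u: "(z, w) \<in> good_configs n m" and conc: "concentrated n m P (z, w) x" and Q: "2 \<le> numQ B"
  shows "real (card S) * b_term B n m * exp (b_term B n m) \<le> odds n m P (z, w) x"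
proof -
  let ?F = "{v. v \<in> configs B n m \<and> \<not> equivalent S n m v (z, w)}"
  let ?q = "\<lambda>i. if z i = 1 then 2 else (1::nat)"
  let ?v = "\<lambda>i. (z(i := ?q i), if is_sbm B then w(i := ?q i) else w)"
  let ?l = "\<lambda>v. lik B P n m v x / lik B P n m (z, w) x"
  let ?\<rho> = "if is_sbm B then 2 * real n else real m"
  let ?b = "b_term B n m" and ?s = "real (card S)"
  have x: "x \<in> space (obs_space B n m)"
    using conc by (simp add: concentrated_def)
  have uc: "(z, w) \<in> configs B n m"
    using u by (auto simp: good_configs_def)
  have S: "1 \<le> ?s"
    using symmetry_card_pos[OF symm] by simp
  have q: "?q i \<in> {1..numQ B}" "?q i \<noteq> z i" for i
    using Q by auto
  note flip = flipped_ratio_ge[OF nm lg P u conc _ q refl]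
  have inj: "inj_on ?v {1..n}"
  proof (rule inj_onI)
    fix i j assume "?v i = ?v j"
    then have "(z(i := ?q i)) i = (z(j := ?q j)) i"
      by (simp only: prod.inject)
    then show "i = j"
      using q(2)[of i] by (auto split: if_splits)
  qed
  have "real n * exp (- (11 / 10 * \<kappa>m * ?\<rho>)) = (\<Sum>i\<in>{1..n}. exp (- (11 / 10 * \<kappa>m * ?\<rho>)))"
    by simp
  also have "\<dots> \<le> (\<Sum>i\<in>{1..n}. ?l (?v i))"
    by (rule sum_mono) (rule flip(3))
  also have "\<dots> = (\<Sum>v\<in>?v ` {1..n}. ?l v)"
    by (rule sum.reindex_cong[OF inj refl refl, symmetric])
  also have "\<dots> \<le> (\<Sum>v\<in>?F. ?l v)"
    by (rule sum_mono2)
       (use flip(1,2) lik_nonneg[OF model P(1) _ x] uc in \<open>auto simp: finite_configs\<close>)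
  finally have lower: "real n * exp (- (11 / 10 * \<kappa>m * ?\<rho>)) / ?s \<le> odds n m P (z, w) x"
    unfolding odds_def using S by (intro divide_right_mono) auto
  have \<kappa>m: "0 < \<kappa>m"
    using \<kappa>_pos \<kappa>_le_\<kappa>m by linarith
  have mn: "m \<le> n"
    using lg by (simp add: large_def)
  have b: "0 \<le> ?b" "?b \<le> 1" "?b \<le> 2 * (real n * exp (- (2 * \<kappa>m * ?\<rho>)))"
  proof -
    show "0 \<le> ?b"
      by (simp add: b_term_eq)
    show "?b \<le> 1"
      using lg by (simp add: large_def)
    have "real m * exp (- (2 * \<kappa>m * real n)) \<le> real n * exp (- (2 * \<kappa>m * real m))"
      using mn \<kappa>m by (intro mult_mono) auto
    then show "?b \<le> 2 * (real n * exp (- (2 * \<kappa>m * ?\<rho>)))"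
      by (auto simp: b_term_eq mult_ac)
  qed
  have "exp ?b \<le> exp 1"
    using b(2) by simp
  then have "exp ?b \<le> 3"
    using exp_le by linarith
  then have "?b * exp ?b \<le> (2 * (real n * exp (- (2 * \<kappa>m * ?\<rho>)))) * 3"
    using b by (intro mult_mono) auto
  then have "?s * (?b * exp ?b) \<le> ?s * ((2 * (real n * exp (- (2 * \<kappa>m * ?\<rho>)))) * 3)"
    by (rule mult_left_mono) simp
  also have "\<dots> = (6 * ?s\<^sup>2) * (real n * exp (- (2 * \<kappa>m * ?\<rho>))) / ?s"
    using S by (simp add: power2_eq_square)
  also have "\<dots> \<le> exp (9 / 10 * \<kappa>m * ?\<rho>) * (real n * exp (- (2 * \<kappa>m * ?\<rho>))) / ?s"
  proof (intro divide_right_mono mult_right_mono)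
    have "6 * ?s\<^sup>2 \<le> exp (9 / 10 * \<kappa>m * real m)"
      using lg by (simp add: large_def)
    also have "\<dots> \<le> exp (9 / 10 * \<kappa>m * ?\<rho>)"
      using \<kappa>m mn by auto
    finally show "6 * ?s\<^sup>2 \<le> exp (9 / 10 * \<kappa>m * ?\<rho>)" .
  qed auto
  also have "\<dots> = real n * exp (- (11 / 10 * \<kappa>m * ?\<rho>)) / ?s"
    by (simp add: exp_add[symmetric] mult.left_commute[of "exp _"])
  finally show ?thesis
    using lower by (simp add: mult.assoc)
qed

lemma posterior_bounds:
  assumes nm: "is_sbm B \<longrightarrow> n = m" and lg: "large n m" and \<theta>: "(\<alpha>, \<beta>, P) \<in> Theta B" "mat_dist B P Ps \<le> \<eta>"
    and u: "(z, w) \<in> good_configs n m" and conc: "concentrated n m P (z, w) x"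
  shows "1 - real (card S) * a_term B Ps L0 \<eta> n m * exp (a_term B Ps L0 \<eta> n m)
      \<le> posterior_class B S (\<alpha>, \<beta>, P) n m x (z, w)"
    and "2 \<le> numQ B \<Longrightarrow> posterior_class B S (\<alpha>, \<beta>, P) n m x (z, w)
      \<le> inverse (1 + real (card S) * b_term B n m * exp (b_term B n m))"
    and "posterior B (\<alpha>, \<beta>, P) n m x (z, w)
      = 1 / real (card S) * posterior_class B S (\<alpha>, \<beta>, P) n m x (z, w)"
proof -
  have P: "P \<in> Mats B"
    using \<theta> by (simp add: Theta_def)
  have x: "x \<in> space (obs_space B n m)"
    using conc by (simp add: concentrated_def)
  obtain v where v: "v \<in> configs B n m" "\<not> equivalent S n m v (z, w)"
    by (rule ex_inequivalent[OF nm lg u])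
  obtain z' w' where v': "v = (z', w')"
    by (cases v)
  obtain r where r: "aligned_cost S n m (z, w) v r" "x \<notin> deviation B Ps n m (z, w) v P (e * r)"
    using conc v unfolding concentrated_def by blast
  have nz: "lik B P n m (z, w) x \<noteq> 0"
    by (rule delta_bounds(3)[OF nm lg P \<theta>(2) u v(1)[unfolded v'] r(1)[unfolded v'] x r(2)[unfolded v']])
  note odds = posterior_class_odds[OF nm lg \<theta>(1) u x nz]
  let ?a = "a_term B Ps L0 \<eta> n m" and ?s = "real (card S)" and ?o = "odds n m P (z, w) x"
  have a: "0 \<le> ?a * exp ?a"
    by (simp add: a_term_eq)
  have S: "1 \<le> ?s"
    using symmetry_card_pos[OF symm] by simp
  have "?o \<le> ?s * (?a * exp ?a)"
    using odds_le[OF nm lg P \<theta>(2) u conc] mult_right_mono[OF S a] by simp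
  moreover have "1 - ?o \<le> 1 / (1 + ?o)"
  proof -
    have "(1 - ?o) * (1 + ?o) \<le> 1"
      by (simp add: algebra_simps)
    then show ?thesis
      using odds(3) by (simp add: pos_le_divide_eq)
  qed
  ultimately show "1 - ?s * ?a * exp ?a \<le> posterior_class B S (\<alpha>, \<beta>, P) n m x (z, w)"
    unfolding odds(1) by (simp add: mult.assoc)
  show "posterior B (\<alpha>, \<beta>, P) n m x (z, w) = 1 / ?s * posterior_class B S (\<alpha>, \<beta>, P) n m x (z, w)"
    by (rule odds(2))
  assume Q: "2 \<le> numQ B"
  have "0 \<le> ?s * b_term B n m * exp (b_term B n m)"
    by (simp add: b_term_eq)
  then show "posterior_class B S (\<alpha>, \<beta>, P) n m x (z, w) \<le> inverse (1 + ?s * b_term B n m * exp (b_term B n m))"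
    unfolding odds(1) using odds_ge[OF nm lg P \<theta>(2) u conc Q]
    by (simp add: divide_inverse le_imp_inverse_le)
qed

end

section \<open>The probability of the good event\<close>

lemma integrable_pmf_bounded:
  fixes f :: "'a \<Rightarrow> real"
  assumes "\<And>z. \<bar>f z\<bar> \<le> b"
  shows "integrable (measure_pmf p) f"
  by (rule measure_pmf.integrable_const_bound[of _ b]) (use assms in auto)

text \<open>
  Chernoff bound: Markov's inequality for \<open>exp (- card / 10)\<close>.  The parameter \<open>1 / 10\<close> is small enough
  for \<open>1 - exp (- 1 / 10) \<ge> 0.095 > 0.9 / 10\<close>.
\<close>

lemma class_frequency_tail:
  fixes \<alpha> :: "nat pmf"
  assumes \<mu>: "\<mu> \<le> pmf \<alpha> q"
  shows "measure (measure_pmf (Pi_pmf {1..n} undefined (\<lambda>_. \<alpha>)))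
      {z. real (card {i\<in>{1..n}. z i = q}) < 9 / 10 * \<mu> * real n} \<le> exp (- (\<mu> / 200 * real n))"
proof -
  let ?p = "Pi_pmf {1..n} undefined (\<lambda>_. \<alpha>)"
  let ?g = "\<lambda>a. if a = q then exp (- (1 / 10)) else (1::real)"
  let ?u = "\<lambda>z. \<Prod>i\<in>{1..n}. ?g (z i)"
  have u: "?u z = exp (- (1 / 10) * real (card {i\<in>{1..n}. z i = q}))" for z
  proof -
    have "?u z = (\<Prod>i\<in>{1..n} \<inter> {i. z i = q}. exp (- (1 / 10)))"
      by (subst prod.inter_restrict) auto
    then show ?thesis
      by (simp add: exp_of_nat_mult[symmetric] Int_def mult.commute)
  qed
  have e1: "exp (- (1 / 10)) \<le> (1 - 95 / 1000 :: real)"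
  proof -
    have "(1 + 1 / 10 + (1 / 10)\<^sup>2 / 2 :: real) \<le> exp (1 / 10)"
      by (rule exp_lower_Taylor_quadratic) simp
    then have "1 * (1000 / 905 :: real) \<le> exp (1 / 10)"
      by (simp add: power2_eq_square)
    then show ?thesis
      by (simp add: exp_minus field_simps)
  qed
  have one: "measure_pmf.expectation \<alpha> ?g \<le> exp (- (95 / 1000 * \<mu>))"
  proof -
    have "measure_pmf.expectation \<alpha> ?g
        = measure_pmf.expectation \<alpha> (\<lambda>a. 1 - (1 - exp (- (1 / 10))) * indicator {q} a)"
      by (rule Bochner_Integration.integral_cong) auto
    also have "\<dots> = 1 - (1 - exp (- (1 / 10))) * pmf \<alpha> q"
      by (subst Bochner_Integration.integral_diff) (auto simp: measure_pmf_single intro!: integrable_pmf_bounded[of _ 1])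
    also have "\<dots> \<le> 1 - 95 / 1000 * pmf \<alpha> q"
      using mult_right_mono[OF e1, of "pmf \<alpha> q"] by (simp add: algebra_simps)
    also have "\<dots> \<le> 1 + - (95 / 1000 * \<mu>)"
      using \<mu> by simp
    also have "\<dots> \<le> exp (- (95 / 1000 * \<mu>))"
      by (rule exp_ge_add_one_self)
    finally show ?thesis .
  qed
  have E: "measure_pmf.expectation ?p ?u \<le> exp (- (95 / 1000 * \<mu> * real n))"
  proof -
    have "measure_pmf.expectation ?p ?u = (\<Prod>i\<in>{1..n}. measure_pmf.expectation \<alpha> ?g)"
      by (rule expectation_prod_Pi_pmf) (auto intro!: integrable_pmf_bounded[of _ 1])
    also have "\<dots> \<le> (\<Prod>i\<in>{1..n}. exp (- (95 / 1000 * \<mu>)))"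
      by (rule prod_mono) (use one in \<open>auto intro!: Bochner_Integration.integral_nonneg\<close>)
    also have "\<dots> = exp (- (95 / 1000 * \<mu> * real n))"
      by (simp add: exp_of_nat_mult[symmetric] mult_ac)
    finally show ?thesis .
  qed
  let ?c = "exp (- (9 / 100 * \<mu> * real n))"
  have "measure ?p {z. real (card {i\<in>{1..n}. z i = q}) < 9 / 10 * \<mu> * real n}
      \<le> measure ?p {z \<in> space ?p. ?c \<le> ?u z}"
    by (rule measure_pmf.finite_measure_mono) (auto simp: u simp del: One_nat_def)
  also have "\<dots> \<le> measure_pmf.expectation ?p ?u / ?c"
    by (rule integral_Markov_inequality_measure[where A = UNIV])
       (auto intro!: integrable_pmf_bounded[of _ 1] simp: u simp del: One_nat_def)
  also have "\<dots> \<le> exp (- (95 / 1000 * \<mu> * real n)) / ?c"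
    by (rule divide_right_mono[OF E]) simp
  also have "\<dots> = exp (- (\<mu> / 200 * real n))"
    by (simp add: exp_diff[symmetric] algebra_simps)
  finally show ?thesis .
qed

lemma measure_joint_law:
  assumes model: "block_model B" and P: "P \<in> Mats B" and nm: "is_sbm B \<longrightarrow> n = m"
  shows "sets (joint_law B (\<alpha>, \<beta>, P) n m) = sets (count_space UNIV \<Otimes>\<^sub>M obs_space B n m)"
    and "\<Omega> \<in> sets (count_space UNIV \<Otimes>\<^sub>M obs_space B n m) \<Longrightarrow>
      measure (joint_law B (\<alpha>, \<beta>, P) n m) \<Omega>
        = (\<Sum>v\<in>configs B n m. pmf (latent B \<alpha> \<beta> n m) v *
            measure (cond_law B P n m v) {x \<in> space (obs_space B n m). (v, x) \<in> \<Omega>})"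
proof -
  let ?N = "count_space UNIV \<Otimes>\<^sub>M obs_space B n m :: (config \<times> (nat \<times> nat \<Rightarrow> 'a)) measure"
  let ?M = "point_measure (configs B n m) (\<lambda>u. ennreal (pmf (latent B \<alpha> \<beta> n m) u))"
  let ?K = "\<lambda>v. distr (cond_law B P n m v) ?N (\<lambda>x. (v, x))"
  note cl = prob_space_cond_law[OF model P]
  have "(restrict (\<lambda>_. 1) {1..n}, restrict (\<lambda>_. 1) {1..m}) \<in> configs B n m"
    using model nm by (auto simp: configs_def PiE_iff block_model_def)
  then have ne: "space ?M \<noteq> {}"
    by (auto simp: space_point_measure)
  have Pm: "(\<lambda>x. (v, x)) \<in> measurable (cond_law B P n m v) ?N" if "v \<in> configs B n m" for v
    unfolding measurable_cong_sets[OF cl(2)[OF that] refl] by (rule measurable_Pair1') simp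
  have K: "?K \<in> measurable ?M (subprob_algebra ?N)"
  proof (subst measurable_point_measure_eq1, rule)
    fix v assume v: "v \<in> configs B n m"
    have "prob_space (?K v)"
      by (rule prob_space.prob_space_distr[OF cl(1)[OF v] Pm[OF v]])
    then show "?K v \<in> space (subprob_algebra ?N)"
      by (auto simp: space_subprob_algebra intro: prob_space_imp_subprob_space)
  qed
  show "sets (joint_law B (\<alpha>, \<beta>, P) n m) = sets ?N"
    unfolding joint_law_def prod.case by (rule sets_bind[OF _ ne]) simp
  assume \<Omega>: "\<Omega> \<in> sets ?N"
  let ?X = "\<lambda>v. {x \<in> space (obs_space B n m). (v, x) \<in> \<Omega>}"
  have "emeasure (joint_law B (\<alpha>, \<beta>, P) n m) \<Omega>
      = (\<Sum>v\<in>configs B n m. ennreal (pmf (latent B \<alpha> \<beta> n m) v) * emeasure (?K v) \<Omega>)"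
    unfolding joint_law_def prod.case
    by (subst emeasure_bind[OF ne K \<Omega>]) (simp add: nn_integral_point_measure_finite finite_configs)
  also have "\<dots> = (\<Sum>v\<in>configs B n m. ennreal (pmf (latent B \<alpha> \<beta> n m) v * measure (cond_law B P n m v) (?X v)))"
  proof (rule sum.cong[OF refl])
    fix v assume v: "v \<in> configs B n m"
    have "emeasure (?K v) \<Omega> = emeasure (cond_law B P n m v) ((\<lambda>x. (v, x)) -` \<Omega> \<inter> space (cond_law B P n m v))"
      by (rule emeasure_distr[OF Pm[OF v] \<Omega>])
    also have "(\<lambda>x. (v, x)) -` \<Omega> \<inter> space (cond_law B P n m v) = ?X v"
      using cl(3)[OF v] by auto
    finally show "ennreal (pmf (latent B \<alpha> \<beta> n m) v) * emeasure (?K v) \<Omega>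
        = ennreal (pmf (latent B \<alpha> \<beta> n m) v * measure (cond_law B P n m v) (?X v))"
      using finite_measure.emeasure_eq_measure[OF prob_space.finite_measure[OF cl(1)[OF v]], of "?X v"]
      by (simp add: ennreal_mult')
  qed
  also have "\<dots> = ennreal (\<Sum>v\<in>configs B n m. pmf (latent B \<alpha> \<beta> n m) v * measure (cond_law B P n m v) (?X v))"
    by (rule sum_ennreal) simp
  finally show "measure (joint_law B (\<alpha>, \<beta>, P) n m) \<Omega>
      = (\<Sum>v\<in>configs B n m. pmf (latent B \<alpha> \<beta> n m) v * measure (cond_law B P n m v) (?X v))"
    by (rule measure_eq_emeasure_eq_ennreal[rotated]) (simp add: sum_nonneg)
qed

context uniform_block_model
begin

lemma prob_good_configs:
  assumes nm: "is_sbm B \<longrightarrow> n = m"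
  shows "1 - (real (numQ B) * exp (- (\<mu> / 200 * real n)) + real (numL B) * exp (- (\<mu> / 200 * real m)))
    \<le> (\<Sum>u\<in>good_configs n m. pmf (latent B \<alpha>s \<beta>s n m) u)"
proof -
  let ?p = "latent B \<alpha>s \<beta>s n m"
  let ?bz = "\<lambda>q. {z. real (card {i\<in>{1..n}. z i = q}) < 9 / 10 * \<mu> * real n}"
  let ?bw = "\<lambda>l. {w. real (card {j\<in>{1..m}. w j = l}) < 9 / 10 * \<mu> * real m}"
  let ?Z = "\<lambda>q. fst -` ?bz q :: config set" and ?W = "\<lambda>l. snd -` ?bw l :: config set"
  let ?bad = "(\<Union>q\<in>{1..numQ B}. ?Z q) \<union> (\<Union>l\<in>{1..numL B}. ?W l)"
  have sbm: "\<alpha>s = \<beta>s" if "is_sbm B"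
    using true_parameter that by (simp add: Theta_def)
  have fst: "map_pmf fst ?p = Pi_pmf {1..n} undefined (\<lambda>_. \<alpha>s)"
    by (simp add: latent_def map_fst_pair_pmf pmf.map_comp comp_def)
  have snd: "map_pmf snd ?p = Pi_pmf {1..m} undefined (\<lambda>_. \<beta>s)"
    using nm sbm by (simp add: latent_def map_snd_pair_pmf pmf.map_comp comp_def)
  have bz: "measure ?p (?Z q) \<le> exp (- (\<mu> / 200 * real n))" if q: "q \<in> {1..numQ B}" for q
  proof -
    have "\<mu> \<le> pmf \<alpha>s q"
      using uniform_weights(1)[OF model uniform true_parameter q] by (simp add: \<mu>_def mumin_def)
    then show ?thesis
      using class_frequency_tail[of \<mu> \<alpha>s q n] unfolding fst[symmetric] measure_map_pmf by simp
  qed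
  have bw: "measure ?p (?W l) \<le> exp (- (\<mu> / 200 * real m))" if l: "l \<in> {1..numL B}" for l
  proof -
    have "\<mu> \<le> pmf \<beta>s l"
      using uniform_weights(2)[OF model uniform true_parameter l] by (simp add: \<mu>_def mumin_def)
    then show ?thesis
      using class_frequency_tail[of \<mu> \<beta>s l m] unfolding snd[symmetric] measure_map_pmf by simp
  qed
  have set: "set_pmf ?p \<subseteq> configs B n m"
  proof -
    have "set_pmf \<alpha>s = {1..numQ B}" "set_pmf \<beta>s = {1..numL B}"
      using true_parameter by (auto simp: Theta_def)
    then show ?thesis
      using nm sbm
      by (auto simp: latent_def configs_def set_Pi_pmf PiE_dflt_def PiE_iff extensional_def
          simp del: atLeastAtMost_iff split: if_splits)
  qed
  have "measure ?p ?bad \<le> measure ?p (\<Union>q\<in>{1..numQ B}. ?Z q) + measure ?p (\<Union>l\<in>{1..numL B}. ?W l)"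
    by (rule measure_Un_le) auto
  also have "\<dots> \<le> (\<Sum>q\<in>{1..numQ B}. measure ?p (?Z q)) + (\<Sum>l\<in>{1..numL B}. measure ?p (?W l))"
    by (intro add_mono measure_pmf.finite_measure_subadditive_finite) auto
  also have "\<dots> \<le> (\<Sum>q\<in>{1..numQ B}. exp (- (\<mu> / 200 * real n))) + (\<Sum>l\<in>{1..numL B}. exp (- (\<mu> / 200 * real m)))"
    by (intro add_mono sum_mono bz bw)
  finally have bad: "measure ?p ?bad
      \<le> real (numQ B) * exp (- (\<mu> / 200 * real n)) + real (numL B) * exp (- (\<mu> / 200 * real m))"
    by simp
  have "1 - measure ?p ?bad = measure ?p (- ?bad)"
    using measure_pmf.prob_compl[of ?bad ?p] by (simp add: Compl_eq_Diff_UNIV)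
  also have "\<dots> = measure ?p (- ?bad \<inter> set_pmf ?p)"
    by (rule measure_Int_set_pmf[symmetric])
  also have "\<dots> \<le> measure ?p (good_configs n m)"
  proof (rule measure_pmf.finite_measure_mono)
    show "- ?bad \<inter> set_pmf ?p \<subseteq> good_configs n m"
    proof
      fix u assume u: "u \<in> - ?bad \<inter> set_pmf ?p"
      obtain z w where zw: "u = (z, w)"
        by (cases u)
      have "\<forall>q\<in>{1..numQ B}. \<not> real (card {i\<in>{1..n}. z i = q}) < 9 / 10 * \<mu> * real n"
        "\<forall>l\<in>{1..numL B}. \<not> real (card {j\<in>{1..m}. w j = l}) < 9 / 10 * \<mu> * real m"
        using u unfolding zw Compl_Un Compl_UN by (simp_all del: atLeastAtMost_iff One_nat_def)
      then show "u \<in> good_configs n m"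
        using u set unfolding zw good_configs_def not_less by blast
    qed
  qed simp
  also have "\<dots> = (\<Sum>u\<in>good_configs n m. pmf ?p u)"
    by (rule measure_measure_pmf_finite)
       (rule finite_subset[OF _ finite_configs[of B n m]], auto simp: good_configs_def)
  finally show ?thesis
    using bad by linarith
qed

text \<open>
  The common form of the two concentration hypotheses, for one fixed deviation \<open>e\<close> and with a finite
  rate \<open>y\<close>: the pointwise one is the case of singletons \<open>N\<close>.  The measurable set \<open>A\<close> is needed because
  a union over \<open>N\<close> need not be measurable.
\<close>

definition covered :: "real \<Rightarrow> params set \<Rightarrow> nat \<Rightarrow> nat \<Rightarrow> bool" where
  "covered y N n m \<longleftrightarrow> (\<forall>u\<in>good_configs n m. \<forall>v\<in>configs B n m. \<not> equivalent S n m v u \<longrightarrow>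
     (\<exists>r. \<exists>A\<in>sets (obs_space B n m). aligned_cost S n m u v r \<and>
        (\<Union>P\<in>N. deviation B Ps n m u v P (e * r)) \<subseteq> A \<and>
        measure (cond_law B Ps n m u) A \<le> 2 * exp (- (y * r))))"

lemma good_regular: "good_configs n m \<subseteq> regular_configs B n m"
proof -
  have le: "real a * mumin B / 2 \<le> x" if "9 / 10 * \<mu> * real a \<le> x" for a x
  proof (rule order_trans[OF _ that])
    have "mumin B * real a * (1 / 2) \<le> mumin B * real a * (9 / 10)"
      using \<mu>_pos by (intro mult_left_mono) (auto simp: \<mu>_def)
    then show "real a * mumin B / 2 \<le> 9 / 10 * \<mu> * real a"
      by (simp add: \<mu>_def mult_ac)
  qed
  show ?thesis
    unfolding good_configs_def regular_configs_def using le by blast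
qed

lemma ex_exp_neg_rate:
  assumes "0 < (a :: ereal)"
  obtains y where "0 < y" "\<And>r. exp_neg a r \<le> exp (- (y * r))"
proof (rule that)
  show "0 < (if a = \<infinity> then 1 else real_of_ereal a)"
    using assms by (cases a) auto
  show "exp_neg a r \<le> exp (- ((if a = \<infinity> then 1 else real_of_ereal a) * r))" for r
    by (simp add: exp_neg_def)
qed

lemma covered_if_uniform_concentration:
  assumes "uniform_concentration B Ps S m N"
  obtains y where "0 < y" "\<And>n. 1 \<le> n \<Longrightarrow> covered y N n (m n)"
proof -
  obtain \<psi> :: "real \<Rightarrow> ereal" where \<psi>: "\<forall>e>0. 0 < \<psi> e"
    and c: "\<forall>n\<ge>1. \<forall>(z', w')\<in>regular_configs B n (m n). \<forall>(z, w)\<in>configs B n (m n).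
        \<not> equivalent S n (m n) (z, w) (z', w') \<longrightarrow>
        (\<exists>(s, t)\<in>S. \<exists>r.
           hamming n z' (s \<circ> z) + hamming (m n) w' (t \<circ> w) = config_dist S n (m n) (z', w') (z, w) \<and>
           r = real (m n) * real (hamming n z' (s \<circ> z)) + real n * real (hamming (m n) w' (t \<circ> w)) \<and>
           (\<forall>e>0. \<exists>A\<in>sets (cond_law B Ps n (m n) (z', w')).
              (\<Union>P\<in>N. deviation B Ps n (m n) (z', w') (z, w) P (e * r)) \<subseteq> A \<and>
              measure (cond_law B Ps n (m n) (z', w')) A \<le> 2 * exp_neg (\<psi> e) r))"
    using assms unfolding uniform_concentration_def by blast
  have "0 < \<psi> e"
    using \<psi> e_pos by blast
  then obtain y where y: "0 < y" "\<And>r. exp_neg (\<psi> e) r \<le> exp (- (y * r))"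
    by (rule ex_exp_neg_rate) blast
  show thesis
  proof (rule that[OF y(1)])
    fix n :: nat assume n: "1 \<le> n"
    show "covered y N n (m n)"
      unfolding covered_def
    proof (intro ballI impI)
      fix u v assume u: "u \<in> good_configs n (m n)" and v: "v \<in> configs B n (m n)"
        and ne: "\<not> equivalent S n (m n) v u"
      obtain z w z' w' where uv: "u = (z, w)" "v = (z', w')"
        by (cases u, cases v)
      have uc: "(z, w) \<in> regular_configs B n (m n)" "u \<in> configs B n (m n)"
        using u good_regular uv by (auto simp: good_configs_def)
      obtain s t r where st: "(s, t) \<in> S"
        "hamming n z (s \<circ> z') + hamming (m n) w (t \<circ> w') = config_dist S n (m n) (z, w) (z', w')"
        and r: "r = real (m n) * real (hamming n z (s \<circ> z')) + real n * real (hamming (m n) w (t \<circ> w'))"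
        and A: "\<forall>e>0. \<exists>A\<in>sets (cond_law B Ps n (m n) (z, w)).
            (\<Union>P\<in>N. deviation B Ps n (m n) (z, w) (z', w') P (e * r)) \<subseteq> A \<and>
            measure (cond_law B Ps n (m n) (z, w)) A \<le> 2 * exp_neg (\<psi> e) r"
        using c[THEN spec, THEN mp, OF n, THEN bspec, OF uc(1), unfolded prod.case, THEN bspec, OF v[unfolded uv],
            unfolded prod.case, THEN mp, OF ne[unfolded uv]]
        by (elim bexE case_prodE exE conjE) (rule that; (assumption | simp only:))
      obtain A where A': "A \<in> sets (cond_law B Ps n (m n) u)"
          "(\<Union>P\<in>N. deviation B Ps n (m n) u v P (e * r)) \<subseteq> A"
          "measure (cond_law B Ps n (m n) u) A \<le> 2 * exp_neg (\<psi> e) r"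
        using A[rule_format, OF e_pos, folded uv] by blast
      have "aligned_cost S n (m n) u v r"
        unfolding aligned_cost_def uv prod.case using st r by blast
      moreover have "measure (cond_law B Ps n (m n) u) A \<le> 2 * exp (- (y * r))"
        by (rule order_trans[OF A'(3)]) (simp add: y(2))
      moreover have "A \<in> sets (obs_space B n (m n))"
        using A'(1) unfolding prob_space_cond_law(2)[OF model Ps uc(2)] .
      ultimately show "\<exists>r. \<exists>A\<in>sets (obs_space B n (m n)). aligned_cost S n (m n) u v r \<and>
          (\<Union>P\<in>N. deviation B Ps n (m n) u v P (e * r)) \<subseteq> A \<and>
          measure (cond_law B Ps n (m n) u) A \<le> 2 * exp (- (y * r))"
        using A'(2) by (intro exI[of _ r] bexI[of _ A] conjI)
    qed
  qed
qed

lemma deviation_measurable: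
  assumes P: "P \<in> Mats B" and u: "u \<in> configs B n m" and v: "v \<in> configs B n m"
  shows "deviation B Ps n m u v P a \<in> sets (cond_law B Ps n m u)"
proof -
  obtain z w z' w' where uv: "u = (z, w)" "v = (z', w')"
    by (cases u, cases v)
  note s = prob_space_cond_law(2,3)[OF model Ps u]
  have d: "delta B P n m u v \<in> borel_measurable (obs_space B n m)"
    unfolding delta_def uv prod.case
  proof (rule borel_measurable_sum, clarify)
    fix i j assume ij: "(i, j) \<in> obs_index B n m"
    note ij' = subsetD[OF obs_index_subset ij]
    show "(\<lambda>x. ln (dens B (x (i, j)) (P (z i) (w j)) / dens B (x (i, j)) (P (z' i) (w' j))))
        \<in> borel_measurable (obs_space B n m)"
      by (rule measurable_compose[OF measurable_component_singleton[OF ij] llr_measurable[OF model]])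
         (rule config_entry(3)[OF model P u[unfolded uv] ij'], rule config_entry(3)[OF model P v[unfolded uv] ij'])
  qed
  define c where "c = (\<integral>y. delta B P n m u v y \<partial>cond_law B Ps n m u)"
  note [measurable] = d lik_measurable[OF model P u] lik_measurable[OF model P v]
  have "{x \<in> space (obs_space B n m). lik B P n m u x = 0 \<or> lik B P n m v x = 0 \<or>
      a \<le> \<bar>delta B P n m u v x - c\<bar>} \<in> sets (obs_space B n m)"
    by measurable
  then show ?thesis
    unfolding deviation_def s c_def .
qed

lemma covered_if_concentration:
  assumes "concentration B Ps S m"
  obtains y where "0 < y" "\<And>n P. 1 \<le> n \<Longrightarrow> P \<in> Mats B \<Longrightarrow> covered y {P} n (m n)"
proof -
  obtain \<psi> :: "real \<Rightarrow> ereal" where \<psi>: "\<forall>e>0. 0 < \<psi> e"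
    and c: "\<forall>n\<ge>1. \<forall>(z', w')\<in>regular_configs B n (m n). \<forall>(z, w)\<in>configs B n (m n).
        \<not> equivalent S n (m n) (z, w) (z', w') \<longrightarrow>
        (\<exists>(s, t)\<in>S. \<exists>r.
           hamming n z' (s \<circ> z) + hamming (m n) w' (t \<circ> w) = config_dist S n (m n) (z', w') (z, w) \<and>
           r = real (m n) * real (hamming n z' (s \<circ> z)) + real n * real (hamming (m n) w' (t \<circ> w)) \<and>
           (\<forall>P\<in>Mats B. \<forall>e>0.
              measure (cond_law B Ps n (m n) (z', w'))
                (deviation B Ps n (m n) (z', w') (z, w) P (e * r)) \<le> 2 * exp_neg (\<psi> e) r))"
    using assms unfolding concentration_def by blast
  have "0 < \<psi> e"
    using \<psi> e_pos by blast
  then obtain y where y: "0 < y" "\<And>r. exp_neg (\<psi> e) r \<le> exp (- (y * r))"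
    by (rule ex_exp_neg_rate) blast
  show thesis
  proof (rule that[OF y(1)])
    fix n :: nat and P assume n: "1 \<le> n" and P: "P \<in> Mats B"
    show "covered y {P} n (m n)"
      unfolding covered_def
    proof (intro ballI impI)
      fix u v assume u: "u \<in> good_configs n (m n)" and v: "v \<in> configs B n (m n)"
        and ne: "\<not> equivalent S n (m n) v u"
      obtain z w z' w' where uv: "u = (z, w)" "v = (z', w')"
        by (cases u, cases v)
      have uc: "(z, w) \<in> regular_configs B n (m n)" "u \<in> configs B n (m n)"
        using u good_regular uv by (auto simp: good_configs_def)
      obtain s t r where st: "(s, t) \<in> S"
        "hamming n z (s \<circ> z') + hamming (m n) w (t \<circ> w') = config_dist S n (m n) (z, w) (z', w')"
        and r: "r = real (m n) * real (hamming n z (s \<circ> z')) + real n * real (hamming (m n) w (t \<circ> w'))"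
        and A: "\<forall>P\<in>Mats B. \<forall>e>0. measure (cond_law B Ps n (m n) (z, w))
            (deviation B Ps n (m n) (z, w) (z', w') P (e * r)) \<le> 2 * exp_neg (\<psi> e) r"
        using c[THEN spec, THEN mp, OF n, THEN bspec, OF uc(1), unfolded prod.case, THEN bspec, OF v[unfolded uv],
            unfolded prod.case, THEN mp, OF ne[unfolded uv]]
        by (elim bexE case_prodE exE conjE) (rule that; (assumption | simp only:))
      let ?A = "deviation B Ps n (m n) u v P (e * r)"
      have "measure (cond_law B Ps n (m n) u) ?A \<le> 2 * exp_neg (\<psi> e) r"
        using A[folded uv] P e_pos by blast
      also have "\<dots> \<le> 2 * exp (- (y * r))"
        using y(2)[of r] by simp
      finally have le: "measure (cond_law B Ps n (m n) u) ?A \<le> 2 * exp (- (y * r))" .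
      have cost: "aligned_cost S n (m n) u v r"
        unfolding aligned_cost_def uv prod.case using st r by blast
      have sets: "?A \<in> sets (obs_space B n (m n))"
        using deviation_measurable[OF P uc(2) v] unfolding prob_space_cond_law(2)[OF model Ps uc(2)] .
      have sub: "(\<Union>P\<in>{P}. deviation B Ps n (m n) u v P (e * r)) \<subseteq> ?A"
        by blast
      show "\<exists>r. \<exists>A\<in>sets (obs_space B n (m n)). aligned_cost S n (m n) u v r \<and>
          (\<Union>P\<in>{P}. deviation B Ps n (m n) u v P (e * r)) \<subseteq> A \<and>
          measure (cond_law B Ps n (m n) u) A \<le> 2 * exp (- (y * r))"
        by (rule exI[of _ r], rule bexI[OF _ sets], intro conjI, rule cost, rule sub, rule le)
    qed
  qed
qed

lemma covered_mono:
  assumes cov: "covered y N n m" and N: "N' \<subseteq> N"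
  shows "covered y N' n m"
  unfolding covered_def
proof (intro ballI impI)
  fix u v assume "u \<in> good_configs n m" "v \<in> configs B n m" "\<not> equivalent S n m v u"
  then obtain r A where A: "A \<in> sets (obs_space B n m)" "aligned_cost S n m u v r"
    "(\<Union>P\<in>N. deviation B Ps n m u v P (e * r)) \<subseteq> A" "measure (cond_law B Ps n m u) A \<le> 2 * exp (- (y * r))"
    using cov unfolding covered_def by blast
  have "(\<Union>P\<in>N'. deviation B Ps n m u v P (e * r)) \<subseteq> A"
    using A(3) N by blast
  then show "\<exists>r. \<exists>A\<in>sets (obs_space B n m). aligned_cost S n m u v r \<and>
      (\<Union>P\<in>N'. deviation B Ps n m u v P (e * r)) \<subseteq> A \<and> measure (cond_law B Ps n m u) A \<le> 2 * exp (- (y * r))"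
    using A(1,2,4) by blast
qed

lemma cover_for_config:
  assumes nm: "is_sbm B \<longrightarrow> n = m" and cov: "covered y N n m" and u: "u \<in> good_configs n m"
  shows "\<exists>A\<in>sets (obs_space B n m).
      measure (cond_law B Ps n m u) A \<le> 2 * (real (card S) * (exp (far_weight B y n m) - 1)) \<and>
      (\<forall>x\<in>space (obs_space B n m) - A. \<forall>P\<in>N. concentrated n m P u x)"
proof -
  let ?F = "{v. v \<in> configs B n m \<and> \<not> equivalent S n m v u}"
  let ?C = "cond_law B Ps n m u" and ?X = "obs_space B n m"
  let ?R = "\<lambda>v r A. A \<in> sets ?X \<and> aligned_cost S n m u v r \<and>
      (\<Union>P\<in>N. deviation B Ps n m u v P (e * r)) \<subseteq> A \<and> measure ?C A \<le> 2 * exp (- (y * r))"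
  have uc: "u \<in> configs B n m"
    using u by (auto simp: good_configs_def)
  interpret C: prob_space ?C
    by (rule prob_space_cond_law(1)[OF model Ps uc])
  have finF: "finite ?F"
    using finite_configs[of B n m] by simp
  have "\<forall>v\<in>?F. \<exists>p. ?R v (fst p) (snd p)"
    using cov u unfolding covered_def by (simp only: split_paired_Ex fst_conv snd_conv) blast
  then obtain f where f: "\<forall>v\<in>?F. ?R v (fst (f v)) (snd (f v))"
    by (rule bchoice[THEN exE])
  define r where "r v = fst (f v)" for v
  define A where "A v = snd (f v)" for v
  have R: "?R v (r v) (A v)" if "v \<in> ?F" for v
    using bspec[OF f that] by (simp only: r_def A_def)
  show ?thesis
  proof (rule bexI[of _ "\<Union>v\<in>?F. A v"], intro conjI ballI)
    show "(\<Union>v\<in>?F. A v) \<in> sets ?X"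
      by (rule sets.finite_UN[OF finF]) (use R in blast)
    have "measure ?C (\<Union>v\<in>?F. A v) \<le> (\<Sum>v\<in>?F. measure ?C (A v))"
      by (rule C.finite_measure_subadditive_finite[OF finF])
         (use R prob_space_cond_law(2)[OF model Ps uc] in blast)
    also have "\<dots> \<le> (\<Sum>v\<in>?F. 2 * exp (- (y * r v)))"
      by (rule sum_mono) (use R in blast)
    also have "\<dots> = 2 * (\<Sum>v\<in>?F. exp (- (y * r v)))"
      by (simp add: sum_distrib_left)
    also have "(\<Sum>v\<in>?F. exp (- (y * r v))) \<le> real (card S) * (exp (far_weight B y n m) - 1)"
      using sum_exp_distance_le[OF symm nm, of "fst u" "snd u" r y] uc R by (simp only: prod.collapse) blast
    finally show "measure ?C (\<Union>v\<in>?F. A v) \<le> 2 * (real (card S) * (exp (far_weight B y n m) - 1))"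
      by simp
    show "concentrated n m P u x" if x: "x \<in> space ?X - (\<Union>v\<in>?F. A v)" and P: "P \<in> N" for x P
      unfolding concentrated_def
    proof (intro conjI ballI impI)
      show "x \<in> space ?X"
        using x by simp
      fix v assume "v \<in> configs B n m" "\<not> equivalent S n m v u"
      then have v: "v \<in> ?F"
        by simp
      then have "x \<notin> deviation B Ps n m u v P (e * r v)"
        using x P R[OF v] by blast
      then show "\<exists>r. aligned_cost S n m u v r \<and> x \<notin> deviation B Ps n m u v P (e * r)"
        using R[OF v] by blast
    qed
  qed
qed

definition failure_bound :: "real \<Rightarrow> nat \<Rightarrow> nat \<Rightarrow> real" where
  "failure_bound y n m = 2 * (real (card S) * (exp (far_weight B y n m) - 1)) +
     (real (numQ B) * exp (- (\<mu> / 200 * real n)) + real (numL B) * exp (- (\<mu> / 200 * real m)))"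

lemma far_weight_nonneg: "0 \<le> far_weight B y n m"
  by (simp add: far_weight_def)

lemma failure_bound_pos: "0 < failure_bound y n m"
proof -
  have "0 < numQ B" "0 < numL B"
    using model by (auto simp: block_model_def)
  then show ?thesis
    unfolding failure_bound_def
    by (intro add_nonneg_pos mult_nonneg_nonneg add_pos_pos mult_pos_pos) (auto simp: far_weight_nonneg)
qed

text \<open>
  The event consists of the good configurations together with the observations outside the covers of
  \<open>cover_for_config\<close>.
\<close>

lemma concentrated_event:
  assumes nm: "is_sbm B \<longrightarrow> n = m" and cov: "covered y N n m"
  shows "\<exists>\<Omega>\<in>sets (joint_law B (\<alpha>s, \<beta>s, Ps) n m).
    1 - failure_bound y n m \<le> measure (joint_law B (\<alpha>s, \<beta>s, Ps) n m) \<Omega> \<and>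
    (\<forall>(u, x)\<in>\<Omega>. \<forall>P\<in>N. u \<in> good_configs n m \<and> concentrated n m P u x)"
proof -
  let ?d = "2 * (real (card S) * (exp (far_weight B y n m) - 1))"
  let ?p = "pmf (latent B \<alpha>s \<beta>s n m)" and ?C = "cond_law B Ps n m" and ?X = "obs_space B n m"
  have "\<forall>u\<in>good_configs n m. \<exists>A. A \<in> sets ?X \<and> measure (?C u) A \<le> ?d \<and>
      (\<forall>x\<in>space ?X - A. \<forall>P\<in>N. concentrated n m P u x)"
    using cover_for_config[OF nm cov] by blast
  then obtain A where A: "\<forall>u\<in>good_configs n m. A u \<in> sets ?X \<and> measure (?C u) (A u) \<le> ?d \<and>
      (\<forall>x\<in>space ?X - A u. \<forall>P\<in>N. concentrated n m P u x)"
    by (rule bchoice[THEN exE])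
  have good: "good_configs n m \<subseteq> configs B n m" "finite (good_configs n m)"
  proof -
    show "good_configs n m \<subseteq> configs B n m"
      by (auto simp: good_configs_def)
    then show "finite (good_configs n m)"
      by (rule finite_subset) (rule finite_configs)
  qed
  define \<Omega> where "\<Omega> = (\<Union>u\<in>good_configs n m. {u} \<times> (space ?X - A u))"
  have \<Omega>: "\<Omega> \<in> sets (count_space UNIV \<Otimes>\<^sub>M ?X)"
    unfolding \<Omega>_def using A good(2) by (intro sets.finite_UN pair_measureI) auto
  have d0: "0 \<le> ?d"
    by (simp add: far_weight_nonneg)
  have le: "?p u * (1 - ?d) \<le> ?p u * measure (?C u) {x \<in> space ?X. (u, x) \<in> \<Omega>}" if u: "u \<in> good_configs n m" for u
  proof (rule mult_left_mono)
    have uc: "u \<in> configs B n m"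
      using u good(1) by blast
    interpret C: prob_space "?C u"
      by (rule prob_space_cond_law(1)[OF model Ps uc])
    have "{x \<in> space ?X. (u, x) \<in> \<Omega>} = space (?C u) - A u"
      using u prob_space_cond_law(3)[OF model Ps uc] by (auto simp: \<Omega>_def)
    moreover have "measure (?C u) (space (?C u) - A u) = 1 - measure (?C u) (A u)"
      using A u prob_space_cond_law(2)[OF model Ps uc] by (intro C.prob_compl) auto
    ultimately show "1 - ?d \<le> measure (?C u) {x \<in> space ?X. (u, x) \<in> \<Omega>}"
      using A u by simp
  qed simp
  let ?G = "\<Sum>u\<in>good_configs n m. ?p u"
  have "?G \<le> 1"
    using measure_measure_pmf_finite[OF good(2), of "latent B \<alpha>s \<beta>s n m"] by (metis measure_pmf.prob_le_1)
  then have "?G * ?d \<le> 1 * ?d"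
    using d0 by (rule mult_right_mono)
  then have "?G - ?d \<le> ?G * (1 - ?d)"
    using right_diff_distrib[of ?G 1 ?d] by linarith
  also have "\<dots> = (\<Sum>u\<in>good_configs n m. ?p u * (1 - ?d))"
    by (rule sum_distrib_right)
  also have "\<dots> \<le> (\<Sum>u\<in>good_configs n m. ?p u * measure (?C u) {x \<in> space ?X. (u, x) \<in> \<Omega>})"
    by (rule sum_mono) (rule le)
  also have "\<dots> \<le> (\<Sum>u\<in>configs B n m. ?p u * measure (?C u) {x \<in> space ?X. (u, x) \<in> \<Omega>})"
    by (rule sum_mono2) (use good finite_configs[of B n m] in auto)
  also have "\<dots> = measure (joint_law B (\<alpha>s, \<beta>s, Ps) n m) \<Omega>"
    by (rule measure_joint_law(2)[OF model Ps nm \<Omega>, symmetric])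
  finally have "1 - failure_bound y n m \<le> measure (joint_law B (\<alpha>s, \<beta>s, Ps) n m) \<Omega>"
    using prob_good_configs[OF nm] unfolding failure_bound_def by linarith
  moreover have "\<Omega> \<in> sets (joint_law B (\<alpha>s, \<beta>s, Ps) n m)"
    using \<Omega> unfolding measure_joint_law(1)[OF model Ps nm] .
  moreover have "u \<in> good_configs n m \<and> concentrated n m P u x" if "(u, x) \<in> \<Omega>" "P \<in> N" for u x P
    using that A unfolding \<Omega>_def by blast
  ultimately show ?thesis
    by blast
qed

end

section \<open>Asymptotics\<close>

text \<open>
  Eventually \<open>c m \<ge> 3 ln n\<close>, so that the exponential is at most \<open>n\<close> to the power \<open>- 3\<close>.
\<close>

lemma asymptotic_setup_decay:
  assumes asy: "asymptotic_setup B m" and c: "0 < c"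
  shows "\<forall>\<^sub>F n in sequentially. real n * exp (- (c * real (m n))) \<le> inverse (real n ^ 2)"
proof -
  have lim: "(\<lambda>n. ln (real n) / real (m n)) \<longlonglongrightarrow> 0"
    using asy by (simp add: asymptotic_setup_def)
  have "\<forall>\<^sub>F n in sequentially. ln (real n) / real (m n) < c / 3"
    by (rule order_tendstoD(2)[OF lim]) (use c in simp)
  then show ?thesis
    using eventually_ge_at_top[of 1]
  proof eventually_elim
    case (elim n)
    have m: "1 \<le> m n"
      using asy elim(2) by (simp add: asymptotic_setup_def)
    then have "3 * ln (real n) \<le> c * real (m n)"
      using elim(1) by (simp add: pos_divide_less_eq)
    then have "exp (- (c * real (m n))) \<le> exp (- (3 * ln (real n)))"
      by simp
    also have "\<dots> = inverse (real n ^ 3)"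
      using elim(2) exp_of_nat_mult[of 3 "ln (real n)"] by (simp add: exp_minus)
    finally have "real n * exp (- (c * real (m n))) \<le> real n * inverse (real n ^ 3)"
      by (rule mult_left_mono) simp
    also have "\<dots> = inverse (real n ^ 2)"
      using elim(2) by (simp add: field_simps power_numeral_reduce)
    finally show ?case .
  qed
qed

lemma asymptotic_setup_summable:
  assumes asy: "asymptotic_setup B m" and c: "0 < c"
  shows "summable (\<lambda>n. real n * exp (- (c * real (m n))))"
proof (rule summable_comparison_test_ev)
  show "\<forall>\<^sub>F n in sequentially. norm (real n * exp (- (c * real (m n)))) \<le> inverse (real n ^ 2)"
    using asymptotic_setup_decay[OF asy c] by simp
  show "summable (\<lambda>n. inverse (real n ^ 2))"
    by (rule inverse_power_summable) simp
qed

lemma asymptotic_setup_tendsto: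
  assumes asy: "asymptotic_setup B m" and c: "0 < c"
  shows "(\<lambda>n. real n * exp (- (c * real (m n)))) \<longlonglongrightarrow> 0"
  by (rule summable_LIMSEQ_zero[OF asymptotic_setup_summable[OF asy c]])

lemma asymptotic_setup_bounds:
  assumes "asymptotic_setup B m"
  shows "is_sbm B \<longrightarrow> n = m n" and "1 \<le> n \<Longrightarrow> m n \<le> n"
  using assms by (auto simp: asymptotic_setup_def)

context uniform_block_model
begin

lemma \<kappa>m_pos: "0 < \<kappa>m"
  using \<kappa>_pos \<kappa>_le_\<kappa>m by linarith

lemma exp_weights_le:
  assumes "m \<le> n" and "0 \<le> c"
  shows "real m * exp (- (c * real n)) \<le> real n * exp (- (c * real m))"
  using assms by (intro mult_mono) (auto intro: mult_left_mono)

lemma a_term_tendsto: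
  assumes asy: "asymptotic_setup B m"
  shows "(\<lambda>n. a_term B Ps L0 \<eta> n (m n)) \<longlonglongrightarrow> 0"
proof (rule tendsto_sandwich)
  show "\<forall>\<^sub>F n in sequentially. 0 \<le> a_term B Ps L0 \<eta> n (m n)"
    by (simp add: a_term_eq)
  show "\<forall>\<^sub>F n in sequentially. a_term B Ps L0 \<eta> n (m n) \<le> 2 * (real n * exp (- (k * real (m n))))"
    using eventually_ge_at_top[of 1]
  proof eventually_elim
    case (elim n)
    have le: "real (m n) * exp (- (k * real n)) \<le> real n * exp (- (k * real (m n)))"
      using asymptotic_setup_bounds(2)[OF asy elim] k_pos by (intro exp_weights_le) auto
    show ?case
    proof (cases "is_sbm B")
      case True
      then have mn: "m n = n"
        using asymptotic_setup_bounds(1)[OF asy, of n] by simp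
      have "exp (- (2 * real n * k)) \<le> 2 * exp (- (k * real n))"
        using k_pos by (intro order_trans[OF _ mult_right_mono[of 1 2]]) auto
      then have "real n * exp (- (2 * real n * k)) \<le> real n * (2 * exp (- (k * real n)))"
        by (rule mult_left_mono) simp
      then show ?thesis
        using True mn by (simp add: a_term_eq)
    next
      case False
      then show ?thesis
        using le by (simp add: a_term_eq)
    qed
  qed
  show "(\<lambda>n. 2 * (real n * exp (- (k * real (m n))))) \<longlonglongrightarrow> 0"
    using tendsto_mult_right_zero[OF asymptotic_setup_tendsto[OF asy k_pos], of 2] by simp
qed simp

lemma b_term_tendsto:
  assumes asy: "asymptotic_setup B m"
  shows "(\<lambda>n. b_term B n (m n)) \<longlonglongrightarrow> 0"
proof (rule tendsto_sandwich)
  show "\<forall>\<^sub>F n in sequentially. 0 \<le> b_term B n (m n)"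
    by (simp add: b_term_eq)
  show "\<forall>\<^sub>F n in sequentially. b_term B n (m n) \<le> 2 * (real n * exp (- (2 * \<kappa>m * real (m n))))"
    using eventually_ge_at_top[of 1]
  proof eventually_elim
    case (elim n)
    have le: "real (m n) * exp (- (2 * \<kappa>m * real n)) \<le> real n * exp (- (2 * \<kappa>m * real (m n)))"
      using asymptotic_setup_bounds(2)[OF asy elim] \<kappa>m_pos by (intro exp_weights_le) auto
    show ?case
    proof (cases "is_sbm B")
      case True
      then have mn: "m n = n"
        using asymptotic_setup_bounds(1)[OF asy, of n] by simp
      have "exp (- (4 * \<kappa>m * real n)) \<le> 2 * exp (- (2 * \<kappa>m * real n))"
        using \<kappa>m_pos by (intro order_trans[OF _ mult_right_mono[of 1 2]]) auto
      then have "real n * exp (- (4 * \<kappa>m * real n)) \<le> real n * (2 * exp (- (2 * \<kappa>m * real n)))"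
        by (rule mult_left_mono) simp
      then show ?thesis
        using True mn by (simp add: b_term_eq)
    next
      case False
      then show ?thesis
        using le by (simp add: b_term_eq)
    qed
  qed
  show "(\<lambda>n. 2 * (real n * exp (- (2 * \<kappa>m * real (m n))))) \<longlonglongrightarrow> 0"
    using tendsto_mult_right_zero[OF asymptotic_setup_tendsto[OF asy, of "2 * \<kappa>m"], of 2] \<kappa>m_pos by simp
qed simp

lemma eventually_large:
  assumes asy: "asymptotic_setup B m"
  shows "\<forall>\<^sub>F n in sequentially. large n (m n)"
proof -
  have m: "filterlim (\<lambda>n. real (m n)) at_top sequentially"
    using asy by (auto simp: asymptotic_setup_def intro: filterlim_compose[OF filterlim_real_sequentially])
  have mult: "filterlim (\<lambda>n. d * real (m n)) at_top sequentially" if "0 < d" for d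
    by (rule filterlim_tendsto_pos_mult_at_top[OF tendsto_const that m])
  have small: "\<forall>\<^sub>F n in sequentially. c * exp (- (e * real (m n))) \<le> 1" for c :: real
  proof -
    have "filterlim (\<lambda>n. - (e * real (m n))) at_bot sequentially"
      using mult[OF e_pos] by (simp add: filterlim_uminus_at_top)
    then have "(\<lambda>n. exp (- (e * real (m n)))) \<longlonglongrightarrow> 0"
      by (rule filterlim_compose[OF exp_at_bot])
    then have "(\<lambda>n. c * exp (- (e * real (m n)))) \<longlonglongrightarrow> 0"
      by (rule tendsto_mult_right_zero)
    from order_tendstoD(2)[OF this, of 1] show ?thesis
      by (auto elim: eventually_mono)
  qed
  have big: "\<forall>\<^sub>F n in sequentially. 6 * (real (card S))\<^sup>2 \<le> exp (9 / 10 * \<kappa>m * real (m n))"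
  proof -
    have "filterlim (\<lambda>n. exp (9 / 10 * \<kappa>m * real (m n))) at_top sequentially"
      by (rule filterlim_compose[OF exp_at_top mult]) (use \<kappa>m_pos in simp)
    then show ?thesis
      unfolding filterlim_at_top by blast
  qed
  have b: "\<forall>\<^sub>F n in sequentially. b_term B n (m n) \<le> 1"
    using order_tendstoD(2)[OF b_term_tendsto[OF asy], of 1] by (auto elim: eventually_mono)
  have two: "\<forall>\<^sub>F n in sequentially. 2 \<le> 9 / 10 * \<mu> * real (m n)"
  proof -
    have "filterlim (\<lambda>n. 9 / 10 * \<mu> * real (m n)) at_top sequentially"
      by (rule mult) (use \<mu>_pos in simp)
    then show ?thesis
      unfolding filterlim_at_top by blast
  qed
  have "filterlim (\<lambda>n. \<mu>\<^sup>2 * real n) at_top sequentially"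
    by (rule filterlim_tendsto_pos_mult_at_top[OF tendsto_const _ filterlim_real_sequentially]) (use \<mu>_pos in simp)
  then have n: "\<forall>\<^sub>F n in sequentially. 200 \<le> \<mu>\<^sup>2 * real n"
    unfolding filterlim_at_top by blast
  show ?thesis
    using small[of "real (numQ B)"] small[of "real (numL B)"] big b two n eventually_ge_at_top[of 1]
  proof eventually_elim
    case (elim n)
    then show ?case
      using asymptotic_setup_bounds(2)[OF asy] by (simp add: large_def mult.commute)
  qed
qed

lemma far_weight_le:
  assumes mn: "is_sbm B \<longrightarrow> n = m" "m \<le> n" and y: "0 < y"
  shows "far_weight B y n m \<le> real (numQ B + numL B) * (real n * exp (- (y * real m)))"
proof (cases "is_sbm B")
  case True
  then have nm: "n = m"
    using mn by simp
  have "exp (- (2 * real n * y)) \<le> exp (- (y * real m))"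
    using nm y by simp
  then have "real (numQ B) * real n * exp (- (2 * real n * y)) \<le> real (numQ B) * real n * exp (- (y * real m))"
    by (rule mult_left_mono) simp
  also have "\<dots> \<le> real (numQ B + numL B) * (real n * exp (- (y * real m)))"
    by (simp add: algebra_simps)
  finally show ?thesis
    using True by (simp add: far_weight_def)
next
  case False
  have "real (numL B) * (real m * exp (- (y * real n))) \<le> real (numL B) * (real n * exp (- (y * real m)))"
    using exp_weights_le[OF mn(2), of y] y by (intro mult_left_mono) auto
  then show ?thesis
    using False by (simp add: far_weight_def algebra_simps)
qed

lemma summable_failure_bound:
  assumes asy: "asymptotic_setup B m" and y: "0 < y"
  shows "summable (\<lambda>n. failure_bound y n (m n))"
proof (rule summable_comparison_test_ev)
  let ?QL = "real (numQ B + numL B)" and ?s = "real (card S)"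
  let ?A = "\<lambda>n. ?QL * (real n * exp (- (y * real (m n))))"
  let ?G = "\<lambda>n. ?QL * (real n * exp (- (\<mu> / 200 * real (m n))))"
  have \<mu>2: "0 < \<mu> / 200"
    using \<mu>_pos by simp
  show "summable (\<lambda>n. 6 * ?s * ?A n + ?G n)"
    by (intro summable_add summable_mult asymptotic_setup_summable[OF asy] y \<mu>2)
  have "?A \<longlonglongrightarrow> 0"
    by (rule tendsto_mult_right_zero[OF asymptotic_setup_tendsto[OF asy y]])
  from order_tendstoD(2)[OF this, of 1] have "\<forall>\<^sub>F n in sequentially. ?A n < 1"
    by simp
  then show "\<forall>\<^sub>F n in sequentially. norm (failure_bound y n (m n)) \<le> 6 * ?s * ?A n + ?G n"
    using eventually_ge_at_top[of 1]
  proof eventually_elim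
    case (elim n)
    note asy' = asymptotic_setup_bounds[OF asy, of n]
    let ?f = "far_weight B y n (m n)"
    have f: "0 \<le> ?f" "?f \<le> ?A n"
      using far_weight_nonneg far_weight_le[OF asy'(1) asy'(2)[OF elim(2)] y] by auto
    have "exp ?f \<le> exp 1"
      using f elim(1) by simp
    then have "exp ?f \<le> 3"
      using exp_le by linarith
    then have "?f * exp ?f \<le> ?A n * 3"
      using f by (intro mult_mono) auto
    then have "exp ?f - 1 \<le> 3 * ?A n"
      using exp_minus_one_le[of ?f] by linarith
    then have "2 * ?s * (exp ?f - 1) \<le> 2 * ?s * (3 * ?A n)"
      by (intro mult_left_mono) auto
    then have 1: "2 * (?s * (exp ?f - 1)) \<le> 6 * ?s * ?A n"
      by linarith
    have "exp (- (\<mu> / 200 * real n)) \<le> exp (- (\<mu> / 200 * real (m n)))"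
      using asy'(2)[OF elim(2)] \<mu>_pos by simp
    then have "real (numQ B) * exp (- (\<mu> / 200 * real n)) + real (numL B) * exp (- (\<mu> / 200 * real (m n)))
        \<le> real (numQ B) * exp (- (\<mu> / 200 * real (m n))) + real (numL B) * exp (- (\<mu> / 200 * real (m n)))"
      by (intro add_mono mult_left_mono) auto
    also have "\<dots> = ?QL * (1 * exp (- (\<mu> / 200 * real (m n))))"
      by (simp add: algebra_simps)
    also have "\<dots> \<le> ?G n"
      using elim(2) by (intro mult_left_mono mult_right_mono) auto
    finally have "failure_bound y n (m n) \<le> 6 * ?s * ?A n + ?G n"
      unfolding failure_bound_def by (rule add_mono[OF 1])
    then show ?case
      unfolding real_norm_def abs_of_pos[OF failure_bound_pos] .
  qed
qed

text \<open>
  The rate must be chosen before it is known whether the uniform inequality holds.  If it does, its rate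
  also serves for single matrices; otherwise the rate of the pointwise inequality does.
\<close>

lemma ex_covering_rate:
  assumes conc: "concentration B Ps S m" and N: "N \<subseteq> Mats B"
  shows "\<exists>y>0. (uniform_concentration B Ps S m N \<longrightarrow> (\<forall>n\<ge>1. covered y N n (m n))) \<and>
    (\<forall>n\<ge>1. \<forall>P\<in>N. covered y {P} n (m n))"
proof (cases "uniform_concentration B Ps S m N")
  case True
  then obtain y where y: "0 < y" "\<And>n. 1 \<le> n \<Longrightarrow> covered y N n (m n)"
    by (rule covered_if_uniform_concentration) blast
  have "covered y {P} n (m n)" if "1 \<le> n" "P \<in> N" for n P
    by (rule covered_mono[OF y(2)[OF that(1)]]) (use that(2) in blast)
  then show ?thesis
    using y by blast
next
  case False
  obtain y where "0 < y" "\<And>n P. 1 \<le> n \<Longrightarrow> P \<in> Mats B \<Longrightarrow> covered y {P} n (m n)"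
    by (rule covered_if_concentration[OF conc]) blast
  then show ?thesis
    using False N by blast
qed

definition posterior_sandwich ::
    "nat \<Rightarrow> nat \<Rightarrow> nat pmf \<times> nat pmf \<times> params \<Rightarrow> config \<times> (nat \<times> nat \<Rightarrow> 'x) \<Rightarrow> bool" where
  "posterior_sandwich n m \<theta> = (\<lambda>(u, x).
     1 - real (card S) * a_term B Ps L0 \<eta> n m * exp (a_term B Ps L0 \<eta> n m)
       \<le> posterior_class B S \<theta> n m x u \<and>
     (2 \<le> numQ B \<longrightarrow>
       posterior_class B S \<theta> n m x u \<le> inverse (1 + real (card S) * b_term B n m * exp (b_term B n m))) \<and>
     posterior B \<theta> n m x u = 1 / real (card S) * posterior_class B S \<theta> n m x u)"

lemma bounds_event:
  assumes nm: "is_sbm B \<longrightarrow> n = m" and cov: "covered y N n m" and N: "N \<subseteq> {P \<in> Mats B. mat_dist B P Ps \<le> \<eta>}"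
  shows "\<exists>\<Omega>\<in>sets (joint_law B (\<alpha>s, \<beta>s, Ps) n m).
    1 - (if large n m then failure_bound y n m else 1) \<le> measure (joint_law B (\<alpha>s, \<beta>s, Ps) n m) \<Omega> \<and>
    (\<forall>\<omega>\<in>\<Omega>. \<forall>(\<alpha>, \<beta>, P)\<in>Theta B. P \<in> N \<longrightarrow> posterior_sandwich n m (\<alpha>, \<beta>, P) \<omega>)"
proof (cases "large n m")
  case False
  then show ?thesis
    by (intro bexI[of _ "{}"]) auto
next
  case lg: True
  obtain \<Omega> where \<Omega>: "\<Omega> \<in> sets (joint_law B (\<alpha>s, \<beta>s, Ps) n m)"
    "1 - failure_bound y n m \<le> measure (joint_law B (\<alpha>s, \<beta>s, Ps) n m) \<Omega>"
    "\<forall>(u, x)\<in>\<Omega>. \<forall>P\<in>N. u \<in> good_configs n m \<and> concentrated n m P u x"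
    using concentrated_event[OF nm cov] by blast
  show ?thesis
  proof (intro bexI[OF _ \<Omega>(1)] conjI)
    show "1 - (if large n m then failure_bound y n m else 1) \<le> measure (joint_law B (\<alpha>s, \<beta>s, Ps) n m) \<Omega>"
      using lg \<Omega>(2) by simp
    show "\<forall>\<omega>\<in>\<Omega>. \<forall>(\<alpha>, \<beta>, P)\<in>Theta B. P \<in> N \<longrightarrow> posterior_sandwich n m (\<alpha>, \<beta>, P) \<omega>"
    proof (clarify)
      fix z w x \<alpha> \<beta> P
      assume zw: "((z, w), x) \<in> \<Omega>" and \<theta>: "(\<alpha>, \<beta>, P) \<in> Theta B" and P: "P \<in> N"
      have d: "mat_dist B P Ps \<le> \<eta>"
        using N P by blast
      have g: "(z, w) \<in> good_configs n m" "concentrated n m P (z, w) x"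
        using \<Omega>(3) zw P by auto
      note b = posterior_bounds[OF nm lg \<theta> d g]
      show "posterior_sandwich n m (\<alpha>, \<beta>, P) ((z, w), x)"
        unfolding posterior_sandwich_def prod.case by (intro conjI impI b)
    qed
  qed
qed

end

theorem corollary2:
  fixes B :: "'x block_model"
    and \<alpha>s \<beta>s :: "nat pmf" and Ps :: params
    and S :: "((nat \<Rightarrow> nat) \<times> (nat \<Rightarrow> nat)) set"
    and m :: "nat \<Rightarrow> nat" and L0 \<eta> :: real
  assumes model: "block_model B"
    and true_parameter: "(\<alpha>s, \<beta>s, Ps) \<in> Theta B"
    and identifiability: "identifiable B"
    and kappa_pos: "0 < kappa_min B Ps"
    and symm: "symmetry B S"
    and conc: "concentration B Ps S m"
    and bounded_KL: "kappa_max B < \<infinity>"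
    and lipschitz: "lipschitz_kl B L0"
    and asymptotics: "asymptotic_setup B m"
    and uniform_proportions: "K_const B = 0"
    and \<eta>: "0 < \<eta>" "\<eta> < c_rate B Ps / (2 * L0)"
  shows "let near = {(\<alpha>, \<beta>, P) \<in> Theta B. mat_dist B P Ps \<le> \<eta>};
      law = (\<lambda>n. joint_law B (\<alpha>s, \<beta>s, Ps) n (m n));
      a = (\<lambda>n. a_term B Ps L0 \<eta> n (m n));
      b = (\<lambda>n. b_term B n (m n));
      bounds = (\<lambda>n \<theta> (u, x).
        1 - real (card S) * a n * exp (a n) \<le> posterior_class B S \<theta> n (m n) x u \<and>
        (2 \<le> numQ B \<longrightarrow>
          posterior_class B S \<theta> n (m n) x u \<le> inverse (1 + real (card S) * b n * exp (b n))) \<and>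
        posterior B \<theta> n (m n) x u = 1 / real (card S) * posterior_class B S \<theta> n (m n) x u)
    in a \<longlonglongrightarrow> 0 \<and> b \<longlonglongrightarrow> 0 \<and>
      (\<exists>\<epsilon> :: nat \<Rightarrow> nat \<Rightarrow> real.
        (\<forall>n k. 0 < \<epsilon> n k) \<and> summable (\<lambda>n. \<epsilon> n (m n)) \<and>
        (uniform_concentration B Ps S m {P \<in> Mats B. mat_dist B P Ps \<le> \<eta>} \<longrightarrow>
          (\<forall>n\<ge>1. \<exists>\<Omega>\<in>sets (law n). 1 - \<epsilon> n (m n) \<le> measure (law n) \<Omega> \<and>
            (\<forall>\<omega>\<in>\<Omega>. \<forall>\<theta>\<in>near. bounds n \<theta> \<omega>))) \<and>
        (\<forall>n\<ge>1. \<forall>\<theta>\<in>near. \<exists>\<Omega>\<in>sets (law n). 1 - \<epsilon> n (m n) \<le> measure (law n) \<Omega> \<and>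
            (\<forall>\<omega>\<in>\<Omega>. bounds n \<theta> \<omega>)))"
proof -
  interpret uniform_block_model B \<alpha>s \<beta>s Ps S L0 \<eta>
    by unfold_locales
       (fact model true_parameter identifiability kappa_pos symm bounded_KL lipschitz uniform_proportions \<eta>)+
  note asy = asymptotics
  let ?N = "{P \<in> Mats B. mat_dist B P Ps \<le> \<eta>}"
  have "?N \<subseteq> Mats B"
    by blast
  then obtain y where y: "0 < y" "uniform_concentration B Ps S m ?N \<longrightarrow> (\<forall>n\<ge>1. covered y ?N n (m n))"
    "\<forall>n\<ge>1. \<forall>P\<in>?N. covered y {P} n (m n)"
    using ex_covering_rate[OF conc] by blast
  \<comment> \<open>At small sizes the bound \<open>1\<close> is attained by the empty event.\<close>
  define \<epsilon> where "\<epsilon> n k = (if large n k then failure_bound y n k else 1)" for n k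
  have pos: "\<forall>n k. 0 < \<epsilon> n k"
    by (simp add: \<epsilon>_def failure_bound_pos)
  have ev: "\<forall>\<^sub>F n in sequentially. \<epsilon> n (m n) = failure_bound y n (m n)"
    using eventually_large[OF asy] by (auto simp: \<epsilon>_def elim: eventually_mono)
  have sum: "summable (\<lambda>n. \<epsilon> n (m n))"
    using summable_cong[OF ev] summable_failure_bound[OF asy y(1)] by simp
  have theta: "P \<in> Mats B" if "(\<alpha>, \<beta>, P) \<in> Theta B" for \<alpha> \<beta> P
    using that by (simp add: Theta_def)
  note event = bounds_event[OF asymptotic_setup_bounds(1)[OF asy]]
  show ?thesis
    unfolding Let_def
  proof (intro conjI exI[of _ \<epsilon>] impI allI)
    show "(\<lambda>n. a_term B Ps L0 \<eta> n (m n)) \<longlonglongrightarrow> 0" "(\<lambda>n. b_term B n (m n)) \<longlonglongrightarrow> 0"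
      by (rule a_term_tendsto[OF asy], rule b_term_tendsto[OF asy])
    show "0 < \<epsilon> n k" for n k
      using pos by blast
    show "summable (\<lambda>n. \<epsilon> n (m n))"
      by (fact sum)
  next
    fix n :: nat
    assume "uniform_concentration B Ps S m ?N" and n: "1 \<le> n"
    then have "covered y ?N n (m n)"
      using y(2) by blast
    from event[OF this subset_refl, folded \<epsilon>_def]
    obtain \<Omega> where \<Omega>: "\<Omega> \<in> sets (joint_law B (\<alpha>s, \<beta>s, Ps) n (m n))"
      "1 - \<epsilon> n (m n) \<le> measure (joint_law B (\<alpha>s, \<beta>s, Ps) n (m n)) \<Omega>"
      and bnd: "\<forall>\<omega>\<in>\<Omega>. \<forall>(\<alpha>, \<beta>, P)\<in>Theta B. P \<in> ?N \<longrightarrow> posterior_sandwich n (m n) (\<alpha>, \<beta>, P) \<omega>"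
      by (elim bexE conjE) (rule that)
    have "posterior_sandwich n (m n) \<theta> \<omega>"
      if "\<omega> \<in> \<Omega>" "\<theta> \<in> {(\<alpha>, \<beta>, P) \<in> Theta B. mat_dist B P Ps \<le> \<eta>}" for \<theta> \<omega>
      using bnd that theta by (cases \<theta>) blast
    then show "\<exists>\<Omega>\<in>sets (joint_law B (\<alpha>s, \<beta>s, Ps) n (m n)).
        1 - \<epsilon> n (m n) \<le> measure (joint_law B (\<alpha>s, \<beta>s, Ps) n (m n)) \<Omega> \<and>
        (\<forall>\<omega>\<in>\<Omega>. \<forall>\<theta>\<in>{(\<alpha>, \<beta>, P) \<in> Theta B. mat_dist B P Ps \<le> \<eta>}. case \<omega> of (u, x) \<Rightarrow>
          1 - real (card S) * a_term B Ps L0 \<eta> n (m n) * exp (a_term B Ps L0 \<eta> n (m n))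
            \<le> posterior_class B S \<theta> n (m n) x u \<and>
          (2 \<le> numQ B \<longrightarrow> posterior_class B S \<theta> n (m n) x u
            \<le> inverse (1 + real (card S) * b_term B n (m n) * exp (b_term B n (m n)))) \<and>
          posterior B \<theta> n (m n) x u = 1 / real (card S) * posterior_class B S \<theta> n (m n) x u)"
      unfolding posterior_sandwich_def by (intro bexI[OF _ \<Omega>(1)] conjI \<Omega>(2) ballI) blast
  next
    fix n :: nat
    assume n: "1 \<le> n"
    show "\<forall>\<theta>\<in>{(\<alpha>, \<beta>, P) \<in> Theta B. mat_dist B P Ps \<le> \<eta>}. \<exists>\<Omega>\<in>sets (joint_law B (\<alpha>s, \<beta>s, Ps) n (m n)).
        1 - \<epsilon> n (m n) \<le> measure (joint_law B (\<alpha>s, \<beta>s, Ps) n (m n)) \<Omega> \<and>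
        (\<forall>\<omega>\<in>\<Omega>. case \<omega> of (u, x) \<Rightarrow>
          1 - real (card S) * a_term B Ps L0 \<eta> n (m n) * exp (a_term B Ps L0 \<eta> n (m n))
            \<le> posterior_class B S \<theta> n (m n) x u \<and>
          (2 \<le> numQ B \<longrightarrow> posterior_class B S \<theta> n (m n) x u
            \<le> inverse (1 + real (card S) * b_term B n (m n) * exp (b_term B n (m n)))) \<and>
          posterior B \<theta> n (m n) x u = 1 / real (card S) * posterior_class B S \<theta> n (m n) x u)"
    proof (clarify)
      fix \<alpha> \<beta> P assume \<theta>: "(\<alpha>, \<beta>, P) \<in> Theta B" "mat_dist B P Ps \<le> \<eta>"
      then have P: "P \<in> ?N"
        using theta by blast
      then have "{P} \<subseteq> ?N"
        by blast
      have "covered y {P} n (m n)"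
        using y(3) n P by blast
      from event[OF this \<open>{P} \<subseteq> ?N\<close>, folded \<epsilon>_def]
      obtain \<Omega> where \<Omega>: "\<Omega> \<in> sets (joint_law B (\<alpha>s, \<beta>s, Ps) n (m n))"
        "1 - \<epsilon> n (m n) \<le> measure (joint_law B (\<alpha>s, \<beta>s, Ps) n (m n)) \<Omega>"
        and bnd: "\<forall>\<omega>\<in>\<Omega>. \<forall>(\<alpha>, \<beta>, P')\<in>Theta B. P' \<in> {P} \<longrightarrow> posterior_sandwich n (m n) (\<alpha>, \<beta>, P') \<omega>"
        by (elim bexE conjE) (rule that)
      have "posterior_sandwich n (m n) (\<alpha>, \<beta>, P) \<omega>" if "\<omega> \<in> \<Omega>" for \<omega>
        using bnd that \<theta>(1) by blast
      then show "\<exists>\<Omega>\<in>sets (joint_law B (\<alpha>s, \<beta>s, Ps) n (m n)).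
        1 - \<epsilon> n (m n) \<le> measure (joint_law B (\<alpha>s, \<beta>s, Ps) n (m n)) \<Omega> \<and>
        (\<forall>\<omega>\<in>\<Omega>. case \<omega> of (u, x) \<Rightarrow>
          1 - real (card S) * a_term B Ps L0 \<eta> n (m n) * exp (a_term B Ps L0 \<eta> n (m n))
            \<le> posterior_class B S (\<alpha>, \<beta>, P) n (m n) x u \<and>
          (2 \<le> numQ B \<longrightarrow> posterior_class B S (\<alpha>, \<beta>, P) n (m n) x u
            \<le> inverse (1 + real (card S) * b_term B n (m n) * exp (b_term B n (m n)))) \<and>
          posterior B (\<alpha>, \<beta>, P) n (m n) x u = 1 / real (card S) * posterior_class B S (\<alpha>, \<beta>, P) n (m n) x u)"
        unfolding posterior_sandwich_def by (intro bexI[OF _ \<Omega>(1)] conjI \<Omega>(2) ballI) blast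
    qed
  qed
qed

end
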